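(* Let $V\subset\mathbb{R}^n$ be a non-singular irreducible real algebraic variety. Then $\mathcal{R}^0(V)$ has the substitution property over $\mathbb{R}[V]$. Moreover, the induced map $\mathrm{Spec}_r\mathcal{R}^0(V)\to\mathrm{Spec}_r\mathbb{R}[V]$ is a homeomorphism with respect to the constructible topology.
   Context: $\mathbb{R}[V]$ is the coordinate ring of $V$. $\mathcal{R}^0(V)$ is the ring of continuous rational functions on $V$: continuous (Euclidean topology) functions $f:V\to\mathbb{R}$ such that $f|_W$ is regular on some non-empty Zariski open $W\subset V$; it contains $\mathbb{R}[V]$. Substitution property: for every real closed field $R$ and every ring homomorphism $\phi:\mathbb{R}[V]\to R$ there is exactly one ring homomorphism $\mathcal{R}^0(V)\to R$ extending $\phi$. The real spectrum $\mathrm{Spec}_r A$ is the set of equivalence classes of homomorphisms from $A$ to real closed fields (classes generated by factorization through field extensions); its constructible topology is generated by boolean combinations of sets $\{\alpha\mid a(\alpha)>0\}$, $a\in A$. *)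

theory Defs
  imports "HOL-Analysis.Analysis" "HOL-Computational_Algebra.Polynomial"
begin

inductive_set poly_fun :: "(real^'n \<Rightarrow> real) set" where
  pf_const: "(\<lambda>x. c) \<in> poly_fun"
| pf_coord: "(\<lambda>x. x $ i) \<in> poly_fun"
| pf_add: "p \<in> poly_fun \<Longrightarrow> q \<in> poly_fun \<Longrightarrow> (\<lambda>x. p x + q x) \<in> poly_fun"
| pf_mult: "p \<in> poly_fun \<Longrightarrow> q \<in> poly_fun \<Longrightarrow> (\<lambda>x. p x * q x) \<in> poly_fun"

definition zero_set :: "(real^'n \<Rightarrow> real) set \<Rightarrow> (real^'n) set" where
  "zero_set S = {x. \<forall>p\<in>S. p x = 0}"

definition algebraic_set :: "(real^'n) set \<Rightarrow> bool" where
  "algebraic_set V \<longleftrightarrow> (\<exists>S \<subseteq> poly_fun. V = zero_set S)"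

definition zariski_closed_in :: "(real^'n) set \<Rightarrow> (real^'n) set \<Rightarrow> bool" where
  "zariski_closed_in V Z \<longleftrightarrow> (\<exists>S \<subseteq> poly_fun. Z = V \<inter> zero_set S)"

definition zariski_open_in :: "(real^'n) set \<Rightarrow> (real^'n) set \<Rightarrow> bool" where
  "zariski_open_in V W \<longleftrightarrow> W \<subseteq> V \<and> zariski_closed_in V (V - W)"

definition irreducible_alg :: "(real^'n) set \<Rightarrow> bool" where
  "irreducible_alg V \<longleftrightarrow> algebraic_set V \<and> V \<noteq> {} \<and>
     (\<forall>Z1 Z2. algebraic_set Z1 \<and> algebraic_set Z2 \<and> V = Z1 \<union> Z2 \<longrightarrow> V = Z1 \<or> V = Z2)"

definition van_ideal :: "(real^'n) set \<Rightarrow> (real^'n \<Rightarrow> real) set" where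
  "van_ideal V = {p \<in> poly_fun. \<forall>x\<in>V. p x = 0}"

definition alg_dim :: "(real^'n) set \<Rightarrow> nat" where
  "alg_dim V = Sup {d. \<exists>C :: nat \<Rightarrow> (real^'n) set.
      (\<forall>i\<le>d. irreducible_alg (C i) \<and> C i \<subseteq> V) \<and> (\<forall>i<d. C i \<subset> C (Suc i))}"

definition grad :: "(real^'n \<Rightarrow> real) \<Rightarrow> real^'n \<Rightarrow> real^'n" where
  "grad f x = (\<chi> i. deriv (\<lambda>t. f (x + t *\<^sub>R axis i 1)) 0)"

text \<open>Non-singular: at every point the Jacobian of (generators of) I(V) has rank n - dim V.\<close>
definition nonsingular_alg :: "(real^'n) set \<Rightarrow> bool" where
  "nonsingular_alg V \<longleftrightarrow>
     (\<forall>x\<in>V. dim {grad p x | p. p \<in> van_ideal V} = CARD('n) - alg_dim V)"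

text \<open>Functions on V are represented as functions on R^n that vanish outside V.\<close>
definition restr :: "(real^'n) set \<Rightarrow> (real^'n \<Rightarrow> real) \<Rightarrow> (real^'n \<Rightarrow> real)" where
  "restr V f = (\<lambda>x. if x \<in> V then f x else 0)"

definition one_on :: "(real^'n) set \<Rightarrow> (real^'n \<Rightarrow> real)" where
  "one_on V = restr V (\<lambda>x. 1)"

definition coord_ring :: "(real^'n) set \<Rightarrow> (real^'n \<Rightarrow> real) set" where
  "coord_ring V = {restr V p | p. p \<in> poly_fun}"

definition regular_on :: "(real^'n) set \<Rightarrow> (real^'n) set \<Rightarrow> (real^'n \<Rightarrow> real) \<Rightarrow> bool" where
  "regular_on V W f \<longleftrightarrow> (\<forall>x\<in>W. \<exists>U p q. zariski_open_in V U \<and> x \<in> U \<and> U \<subseteq> W \<and>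
       p \<in> poly_fun \<and> q \<in> poly_fun \<and> (\<forall>y\<in>U. q y \<noteq> 0 \<and> f y = p y / q y))"

definition cont_rat :: "(real^'n) set \<Rightarrow> (real^'n \<Rightarrow> real) set" where
  "cont_rat V = {f. (\<forall>x. x \<notin> V \<longrightarrow> f x = 0) \<and> continuous_on V f \<and>
       (\<exists>W. zariski_open_in V W \<and> W \<noteq> {} \<and> regular_on V W f)}"

definition real_closed :: "'r::linordered_field itself \<Rightarrow> bool" where
  "real_closed _ \<longleftrightarrow> (\<forall>x::'r. x \<ge> 0 \<longrightarrow> (\<exists>y. y * y = x)) \<and>
     (\<forall>p::'r poly. odd (degree p) \<longrightarrow> (\<exists>x. poly p x = 0))"

definition ring_hom_on :: "(real^'n) set \<Rightarrow> (real^'n \<Rightarrow> real) set \<Rightarrow> ((real^'n \<Rightarrow> real) \<Rightarrow> 'r::field) \<Rightarrow> bool" where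
  "ring_hom_on V A \<phi> \<longleftrightarrow> \<phi> (one_on V) = 1 \<and>
     (\<forall>f\<in>A. \<forall>g\<in>A. \<phi> (\<lambda>x. f x + g x) = \<phi> f + \<phi> g \<and> \<phi> (\<lambda>x. f x * g x) = \<phi> f * \<phi> g)"

definition substitution_property :: "'r::linordered_field itself \<Rightarrow> (real^'n) set \<Rightarrow>
    (real^'n \<Rightarrow> real) set \<Rightarrow> (real^'n \<Rightarrow> real) set \<Rightarrow> bool" where
  "substitution_property R V A B \<longleftrightarrow> real_closed R \<longrightarrow>
     (\<forall>\<phi> :: (real^'n \<Rightarrow> real) \<Rightarrow> 'r. ring_hom_on V A \<phi> \<longrightarrow>
        (\<exists>\<psi>. ring_hom_on V B \<psi> \<and> (\<forall>f\<in>A. \<psi> f = \<phi> f) \<and>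
           (\<forall>\<psi>'. ring_hom_on V B \<psi>' \<and> (\<forall>f\<in>A. \<psi>' f = \<phi> f) \<longrightarrow> (\<forall>f\<in>B. \<psi>' f = \<psi> f))))"

definition prime_cone :: "(real^'n) set \<Rightarrow> (real^'n \<Rightarrow> real) set \<Rightarrow> (real^'n \<Rightarrow> real) set \<Rightarrow> bool" where
  "prime_cone V A P \<longleftrightarrow> P \<subseteq> A \<and>
     (\<forall>f\<in>P. \<forall>g\<in>P. (\<lambda>x. f x + g x) \<in> P \<and> (\<lambda>x. f x * g x) \<in> P) \<and>
     (\<forall>f\<in>A. f \<in> P \<or> (\<lambda>x. - f x) \<in> P) \<and>
     (\<lambda>x. - one_on V x) \<notin> P \<and>
     (\<forall>f\<in>A. \<forall>g\<in>A. (\<lambda>x. f x * g x) \<in> P \<and> (\<lambda>x. - (f x * g x)) \<in> P \<longrightarrow>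
        (f \<in> P \<and> (\<lambda>x. - f x) \<in> P) \<or> (g \<in> P \<and> (\<lambda>x. - g x) \<in> P))"

definition real_spectrum :: "(real^'n) set \<Rightarrow> (real^'n \<Rightarrow> real) set \<Rightarrow> (real^'n \<Rightarrow> real) set set" where
  "real_spectrum V A = {P. prime_cone V A P}"

text \<open>a(alpha) > 0 at the point alpha = P means -a is not in P.\<close>
definition pos_set :: "(real^'n) set \<Rightarrow> (real^'n \<Rightarrow> real) set \<Rightarrow> (real^'n \<Rightarrow> real) \<Rightarrow> (real^'n \<Rightarrow> real) set set" where
  "pos_set V A a = {P \<in> real_spectrum V A. (\<lambda>x. - a x) \<notin> P}"

text \<open>Constructible topology: generated by the sets {a > 0} and their complements
  (hence all boolean combinations of them are open).\<close>
definition constructible_topology :: "(real^'n) set \<Rightarrow> (real^'n \<Rightarrow> real) set \<Rightarrow> (real^'n \<Rightarrow> real) set topology" where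
  "constructible_topology V A = topology_generated_by
     ({pos_set V A a | a. a \<in> A} \<union> {real_spectrum V A - pos_set V A a | a. a \<in> A})"

end

theory Submission
  imports "HOL-Algebra.Algebraic_Closure_Type" Defs
begin

text \<open>A point of the real spectrum of the coordinate ring is a prime cone, whose support is the ideal of a
  subvariety Z of V. A continuous rational function f is a quotient of polynomials p / q on Z: as V is smooth,
  iterated derivatives of its denominator and numerator along tangent curves of V, evaluated by l'Hospital's
  rule, give p and q with q not identically zero on Z. Hence the cone and every homomorphism extend, f being sent
  to p / q. The extension is unique by Lojasiewicz's inequality: if g is an equation of Z in V, then q f - p
  vanishes on Z, so a power of it is a multiple of g with a continuous rational quotient, and therefore every
  extension kills q f - p. The extension depends on a cone only through polynomial signs on a constructible
  set, which makes the inverse of the restriction map continuous.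

  That a polynomial vanishing on Z lies in the support is the Artin--Lang theorem, obtained from
  Cohen--Hoermander elimination over the real closure of the residue field of the cone. This real closure is a
  maximal ordered subfield of the algebraic closure.\<close>

section \<open>Real closures\<close>

text \<open>Two facts of analytic flavour carry the smooth part, and neither comes from power
  series. A polynomial whose iterated derivatives vanish at the start of an integral curve vanishes
  on the whole curve: such polynomials form a finitely generated ideal stable under the derivation,
  so a linear differential equation applies. A polynomial vanishing on V near one point vanishes on
  V although V may have several connected components: an algebraic relation between the polynomial
  and the chart coordinates, obtained from elimination and a measure argument, replaces
  connectedness. All derivations are scaled by a Jacobian determinant so that they stay polynomial;
  primality of the ideals removes this factor in the end. The elimination theorem transfers signs
  from a real closed field to the reals. It serves three times: for the residue field of a cone, and
  over the reals themselves for the algebraic relation and for the inequality. Real closedness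
  enters elimination only as the intermediate value property of polynomials.\<close>

class poly_ivt_field = linordered_field +
  assumes poly_ivt_sum: "a < b \<Longrightarrow> (\<Sum>k\<le>n. f k * a ^ k) < 0 \<Longrightarrow> 0 < (\<Sum>k\<le>n. f k * b ^ k) \<Longrightarrow>
    \<exists>x. a < x \<and> x < b \<and> (\<Sum>k\<le>n. f k * x ^ k) = 0"

section \<open>Preorderings and orderings of subfields\<close>

definition subfield_set :: "'a::field set \<Rightarrow> bool" where
  "subfield_set M \<longleftrightarrow> 0 \<in> M \<and> 1 \<in> M \<and> (\<forall>x\<in>M. - x \<in> M \<and> inverse x \<in> M) \<and>
     (\<forall>x\<in>M. \<forall>y\<in>M. x + y \<in> M \<and> x * y \<in> M)"

definition precone :: "'a::field set \<Rightarrow> 'a set \<Rightarrow> bool" where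
  "precone M T \<longleftrightarrow> T \<subseteq> M \<and> (\<forall>x\<in>T. \<forall>y\<in>T. x + y \<in> T \<and> x * y \<in> T) \<and>
     (\<forall>x\<in>M. x * x \<in> T) \<and> - 1 \<notin> T"

text \<open>The nonnegative elements of an ordered subfield with carrier \<open>P\<close> together
  with \<open>- P\<close>. Leaving the subfield implicit makes inclusion of cones express extension
  of the field and of its order at once, so a single application of Zorn's lemma yields a maximal
  ordered subfield.\<close>

definition ordered_cone :: "'a::field set \<Rightarrow> bool" where
  "ordered_cone P \<longleftrightarrow> 1 \<in> P \<and> (\<forall>x\<in>P. \<forall>y\<in>P. x + y \<in> P \<and> x * y \<in> P) \<and>
     (\<forall>x\<in>P. \<forall>y\<in>P. x - y \<in> P \<or> y - x \<in> P) \<and> (\<forall>x\<in>P. inverse x \<in> P) \<and> (\<forall>x. x \<in> P \<and> - x \<in> P \<longleftrightarrow> x = 0)"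

text \<open>A preordering that is maximal for inclusion is total: if \<open>x\<close> is not in
  \<open>P\<close>, then \<open>P - x * P\<close> is again a preordering, since
  \<open>- 1 = s - x * t\<close> would exhibit \<open>x\<close> as \<open>(1 + s) / t\<close>, an
  element of \<open>P\<close>. Maximality then puts \<open>- x\<close> into
  \<open>P\<close>.\<close>

lemma precone_extend:
  assumes M: "subfield_set M" and T: "precone M T"
  obtains P where "ordered_cone P" "T \<subseteq> P" "P \<union> uminus ` P = M"
proof -
  let ?A = "{S. precone M S \<and> T \<subseteq> S}"
  have "\<exists>P\<in>?A. \<forall>Y\<in>?A. P \<subseteq> Y \<longrightarrow> Y = P"
  proof (rule subset_Zorn_nonempty)
    show "?A \<noteq> {}" using T by auto
    fix C assume C: "C \<noteq> {}" "subset.chain ?A C"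
    then have sub: "\<And>S. S \<in> C \<Longrightarrow> precone M S \<and> T \<subseteq> S"
      and chain: "\<And>S S'. S \<in> C \<Longrightarrow> S' \<in> C \<Longrightarrow> S \<subseteq> S' \<or> S' \<subseteq> S"
      by (auto simp: subset_chain_def)
    have "x + y \<in> \<Union>C \<and> x * y \<in> \<Union>C" if "x \<in> \<Union>C" "y \<in> \<Union>C" for x y
    proof -
      from that obtain S S' where "S \<in> C" "S' \<in> C" "x \<in> S" "y \<in> S'" by auto
      then obtain S'' where "S'' \<in> C" "x \<in> S''" "y \<in> S''" using chain by blast
      then show ?thesis using sub[of S''] by (auto simp: precone_def)
    qed
    moreover have "\<Union>C \<subseteq> M" "- 1 \<notin> \<Union>C" "T \<subseteq> \<Union>C" "\<forall>x\<in>M. x * x \<in> \<Union>C"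
      using sub C(1) unfolding precone_def by blast+
    ultimately show "\<Union>C \<in> ?A" by (auto simp: precone_def)
  qed
  then obtain P where P: "precone M P" "T \<subseteq> P"
    and max: "\<And>Y. precone M Y \<Longrightarrow> P \<subseteq> Y \<Longrightarrow> Y = P" by auto
  have cl: "\<And>x y. x \<in> P \<Longrightarrow> y \<in> P \<Longrightarrow> x + y \<in> P" "\<And>x y. x \<in> P \<Longrightarrow> y \<in> P \<Longrightarrow> x * y \<in> P"
    and sq: "\<And>x. x \<in> M \<Longrightarrow> x * x \<in> P" and m1: "- 1 \<notin> P" and PM: "\<And>x. x \<in> P \<Longrightarrow> x \<in> M"
    using P(1) by (auto simp: precone_def)
  have Mcl: "0 \<in> M" "1 \<in> M" "\<And>x. x \<in> M \<Longrightarrow> - x \<in> M" "\<And>x. x \<in> M \<Longrightarrow> inverse x \<in> M"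
    "\<And>x y. x \<in> M \<Longrightarrow> y \<in> M \<Longrightarrow> x + y \<in> M" "\<And>x y. x \<in> M \<Longrightarrow> y \<in> M \<Longrightarrow> x * y \<in> M"
    using M by (auto simp: subfield_set_def)
  have one: "1 \<in> P" and zero: "0 \<in> P" using sq[of 1] sq[of 0] Mcl by auto
  have inv: "inverse x \<in> P" if "x \<in> P" for x
  proof (cases "x = 0")
    case False
    then have "x * (inverse x * inverse x) = inverse x" by (simp add: field_simps)
    then show ?thesis using cl(2)[OF that sq[OF Mcl(4)[OF PM[OF that]]]] by (simp only:)
  qed (simp add: zero)
  have zz: "x = 0" if "x \<in> P" "- x \<in> P" for x
  proof (rule ccontr)
    assume "x \<noteq> 0"
    then have "- 1 = - x * inverse x" by simp
    then show False using m1 cl(2)[OF that(2) inv[OF that(1)]] by simp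
  qed
  have tot: "- x \<in> P" if x: "x \<in> M" "x \<notin> P" for x
  proof -
    define Y where "Y = {s - x * t |s t. s \<in> P \<and> t \<in> P}"
    have "precone M Y"
    proof -
      have "s - x * t + (s' - x * t') \<in> Y \<and> (s - x * t) * (s' - x * t') \<in> Y"
        if st: "s \<in> P" "t \<in> P" "s' \<in> P" "t' \<in> P" for s t s' t'
      proof -
        have "s - x * t + (s' - x * t') = (s + s') - x * (t + t')" by (simp add: algebra_simps)
        moreover have "(s - x * t) * (s' - x * t') = (s * s' + (x * x) * (t * t')) - x * (s * t' + s' * t)"
          by (simp add: algebra_simps)
        moreover have "s + s' \<in> P" "t + t' \<in> P" "s * s' + (x * x) * (t * t') \<in> P" "s * t' + s' * t \<in> P"
          using st cl sq[OF x(1)] by simp_all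
        ultimately show ?thesis unfolding Y_def by (intro conjI CollectI) metis+
      qed
      moreover have "- 1 \<noteq> s - x * t" if st: "s \<in> P" "t \<in> P" for s t
      proof
        assume "- 1 = s - x * t"
        then have e: "x * t = 1 + s" by (simp add: algebra_simps)
        show False
        proof (cases "t = 0")
          case True
          then have "- 1 = s" using e by (simp add: minus_unique)
          then show False using m1 st by simp
        next
          case False
          then have "x = (1 + s) * inverse t" using e by (simp add: field_simps)
          then show False using x(2) cl one st inv by simp
        qed
      qed
      moreover have "s - x * t \<in> M" if "s \<in> P" "t \<in> P" for s t
        using Mcl(5)[of s "- (x * t)"] Mcl PM that x(1) by auto
      moreover have "\<exists>s t. y * y = s - x * t \<and> s \<in> P \<and> t \<in> P" if "y \<in> M" for y
        using sq[OF that] zero by (intro exI[of _ "y * y"] exI[of _ 0]) simp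
      ultimately have "(\<forall>x\<in>Y. \<forall>y\<in>Y. x + y \<in> Y \<and> x * y \<in> Y)" "- 1 \<notin> Y" "Y \<subseteq> M" "\<forall>y\<in>M. y * y \<in> Y"
        unfolding Y_def by (clarsimp | fastforce)+
      then show ?thesis unfolding precone_def by blast
    qed
    moreover have "P \<subseteq> Y" unfolding Y_def using zero by (intro subsetI CollectI) (metis diff_zero mult_zero_right)
    moreover have "- x \<in> Y" unfolding Y_def using zero one by (intro CollectI) (metis diff_0 mult_1_right)
    ultimately show ?thesis using max by blast
  qed
  have "x - y \<in> P \<or> y - x \<in> P" if "x \<in> P" "y \<in> P" for x y
    using tot[of "x - y"] Mcl(5)[of x "- y"] Mcl(3) PM that by auto
  then have "ordered_cone P" unfolding ordered_cone_def using cl one zero inv zz by auto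
  moreover have "P \<union> uminus ` P = M"
    using tot PM Mcl(3) by (auto simp: image_iff) (metis minus_minus)
  ultimately show ?thesis using that P(2) by blast
qed

lemma ordered_cone_max:
  assumes "ordered_cone P"
  obtains R where "ordered_cone R" "P \<subseteq> R" "\<And>Y. ordered_cone Y \<Longrightarrow> R \<subseteq> Y \<Longrightarrow> Y = R"
proof -
  let ?A = "{S. ordered_cone S \<and> P \<subseteq> S}"
  have "\<exists>P\<in>?A. \<forall>Y\<in>?A. P \<subseteq> Y \<longrightarrow> Y = P"
  proof (rule subset_Zorn_nonempty)
    show "?A \<noteq> {}" using assms by auto
    fix C assume C: "C \<noteq> {}" "subset.chain ?A C"
    then have sub: "\<And>S. S \<in> C \<Longrightarrow> ordered_cone S \<and> P \<subseteq> S"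
      and chain: "\<And>S S'. S \<in> C \<Longrightarrow> S' \<in> C \<Longrightarrow> S \<subseteq> S' \<or> S' \<subseteq> S"
      by (auto simp: subset_chain_def)
    have two: "x + y \<in> \<Union>C \<and> x * y \<in> \<Union>C \<and> (x - y \<in> \<Union>C \<or> y - x \<in> \<Union>C) \<and> (y = - x \<longrightarrow> x = 0)" if "x \<in> \<Union>C" "y \<in> \<Union>C" for x y
    proof -
      from that obtain S S' where "S \<in> C" "S' \<in> C" "x \<in> S" "y \<in> S'" by auto
      then obtain S'' where "S'' \<in> C" "x \<in> S''" "y \<in> S''" using chain by blast
      then have "x + y \<in> S''" "x * y \<in> S''" "x - y \<in> S'' \<or> y - x \<in> S''" "y = - x \<longrightarrow> x = 0"
        using sub[of S''] by (auto simp: ordered_cone_def)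
      then show ?thesis using \<open>S'' \<in> C\<close> by blast
    qed
    obtain S where S: "S \<in> C" using C(1) by auto
    have "0 \<in> \<Union>C" "1 \<in> \<Union>C" "P \<subseteq> \<Union>C"
      using sub[OF S] S by (auto simp: ordered_cone_def)
    moreover have "\<forall>x\<in>\<Union>C. inverse x \<in> \<Union>C"
    proof
      fix x assume "x \<in> \<Union>C"
      then obtain S where S: "S \<in> C" "x \<in> S" by auto
      then have "inverse x \<in> S" using sub[of S] by (simp add: ordered_cone_def)
      then show "inverse x \<in> \<Union>C" using S by auto
    qed
    moreover have "\<forall>x. x \<in> \<Union>C \<and> - x \<in> \<Union>C \<longleftrightarrow> x = 0"
      using two \<open>0 \<in> \<Union>C\<close> by (metis minus_zero)
    ultimately show "\<Union>C \<in> ?A" using two unfolding ordered_cone_def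
      by (auto simp del: Union_iff)
  qed
  then show ?thesis using that by auto
qed

section \<open>The real closure and its intermediate value theorem\<close>

text \<open>A choice, so that the cone, and with it the type of the real closure, depends only on
  the type of the ordered field.\<close>

definition rcl_cone :: "'a::linordered_field alg_closure set" where
  "rcl_cone = (SOME R. ordered_cone R \<and> to_ac ` {x. 0 \<le> x} \<subseteq> R \<and>
     (\<forall>Y. ordered_cone Y \<longrightarrow> R \<subseteq> Y \<longrightarrow> Y = R))"

lemma rcl_cone:
  "ordered_cone (rcl_cone :: 'a::linordered_field alg_closure set)"
  "0 \<le> x \<Longrightarrow> to_ac x \<in> (rcl_cone :: 'a alg_closure set)"
  "ordered_cone Y \<Longrightarrow> (rcl_cone :: 'a alg_closure set) \<subseteq> Y \<Longrightarrow> Y = rcl_cone"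
proof -
  have "ordered_cone (to_ac ` {x::'a. 0 \<le> x})"
    unfolding ordered_cone_def
  proof (intro conjI ballI allI)
    show "1 \<in> to_ac ` {x::'a. 0 \<le> x}" by (rule image_eqI[of _ _ 1]) auto
    fix x y :: "'a alg_closure"
    assume "x \<in> to_ac ` {x::'a. 0 \<le> x}" "y \<in> to_ac ` {x::'a. 0 \<le> x}"
    then show "x + y \<in> to_ac ` {x::'a. 0 \<le> x}" "x * y \<in> to_ac ` {x::'a. 0 \<le> x}"
      by (auto simp flip: to_ac_add to_ac_mult)
  next
    fix x :: "'a alg_closure"
    show "x - y \<in> to_ac ` {x::'a. 0 \<le> x} \<or> y - x \<in> to_ac ` {x::'a. 0 \<le> x}"
      if xy: "x \<in> to_ac ` {x::'a. 0 \<le> x}" "y \<in> to_ac ` {x::'a. 0 \<le> x}" for y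
    proof -
      obtain a b :: 'a where "x = to_ac a" "y = to_ac b" using xy by auto
      then have "x - y = to_ac (a - b)" "y - x = to_ac (b - a)" by auto
      then show ?thesis using linear[of a b] by (metis diff_ge_0_iff_ge image_eqI mem_Collect_eq)
    qed
    show "inverse x \<in> to_ac ` {x::'a. 0 \<le> x}" if "x \<in> to_ac ` {x::'a. 0 \<le> x}"
      using that by (auto simp flip: to_ac_inverse)
    show "(x \<in> to_ac ` {x::'a. 0 \<le> x} \<and> - x \<in> to_ac ` {x::'a. 0 \<le> x}) = (x = 0)"
      by (auto simp flip: to_ac_minus)
  qed
  then obtain R where "ordered_cone R" "to_ac ` {x::'a. 0 \<le> x} \<subseteq> R"
      "\<And>Y. ordered_cone Y \<Longrightarrow> R \<subseteq> Y \<Longrightarrow> Y = R"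
    using ordered_cone_max by metis
  then have ex: "\<exists>R. ordered_cone R \<and> to_ac ` {x::'a. 0 \<le> x} \<subseteq> R \<and>
     (\<forall>Y. ordered_cone Y \<longrightarrow> R \<subseteq> Y \<longrightarrow> Y = R)" by blast
  note p = someI_ex[OF ex, folded rcl_cone_def]
  show "ordered_cone (rcl_cone :: 'a::linordered_field alg_closure set)"
  "0 \<le> x \<Longrightarrow> to_ac x \<in> (rcl_cone :: 'a alg_closure set)"
  "ordered_cone Y \<Longrightarrow> (rcl_cone :: 'a alg_closure set) \<subseteq> Y \<Longrightarrow> Y = rcl_cone"
    using p by auto
qed

lemma rcl_cone_simps:
  "0 \<in> rcl_cone" "1 \<in> rcl_cone" "x \<in> rcl_cone \<Longrightarrow> y \<in> rcl_cone \<Longrightarrow> x + y \<in> rcl_cone"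
  "x \<in> rcl_cone \<Longrightarrow> y \<in> rcl_cone \<Longrightarrow> x * y \<in> rcl_cone" "x \<in> rcl_cone \<Longrightarrow> inverse x \<in> rcl_cone"
  "x \<in> rcl_cone \<Longrightarrow> - x \<in> rcl_cone \<Longrightarrow> x = 0"
  using rcl_cone(1) by (auto simp: ordered_cone_def)

definition rcl_carrier :: "'a::linordered_field alg_closure set" where
  "rcl_carrier = {x. x \<in> rcl_cone \<or> - x \<in> rcl_cone}"

lemma rcl_carrier_minus: "x \<in> rcl_carrier \<Longrightarrow> - x \<in> rcl_carrier"
  by (auto simp: rcl_carrier_def)

lemma rcl_carrier_inverse: "x \<in> rcl_carrier \<Longrightarrow> inverse x \<in> rcl_carrier"
  by (auto simp: rcl_carrier_def rcl_cone_simps dest: rcl_cone_simps(5)[of "- x"])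

lemma rcl_carrier_mult: "x \<in> rcl_carrier \<Longrightarrow> y \<in> rcl_carrier \<Longrightarrow> x * y \<in> rcl_carrier"
  unfolding rcl_carrier_def using rcl_cone_simps(4)[of x y] rcl_cone_simps(4)[of "-x" y]
    rcl_cone_simps(4)[of x "- y"] rcl_cone_simps(4)[of "- x" "- y"] by auto

lemma rcl_carrier_add:
  assumes "x \<in> rcl_carrier" "y \<in> rcl_carrier" shows "x + y \<in> rcl_carrier"
proof -
  have key: "a - b \<in> rcl_carrier" "b - a \<in> rcl_carrier" if "a \<in> rcl_cone" "b \<in> rcl_cone" for a b :: "'a alg_closure"
    using rcl_cone(1) that unfolding ordered_cone_def rcl_carrier_def by auto
  show ?thesis using assms key(1)[of x "- y"] key(2)[of "- x" y] rcl_cone_simps(3)[of x y]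
      rcl_cone_simps(3)[of "- x" "- y"] unfolding rcl_carrier_def by (auto simp: add.commute)
qed

typedef (overloaded) 'a::linordered_field rclosure = "rcl_carrier :: 'a alg_closure set"
  by (rule exI[of _ 0]) (simp add: rcl_carrier_def rcl_cone_simps)

setup_lifting type_definition_rclosure

instantiation rclosure :: (linordered_field) linordered_field
begin

lift_definition zero_rclosure :: "'a rclosure" is 0
  by (simp add: rcl_carrier_def rcl_cone_simps)
lift_definition one_rclosure :: "'a rclosure" is 1
  by (simp add: rcl_carrier_def rcl_cone_simps)
lift_definition plus_rclosure :: "'a rclosure \<Rightarrow> 'a rclosure \<Rightarrow> 'a rclosure" is "(+)"
  by (rule rcl_carrier_add)
lift_definition uminus_rclosure :: "'a rclosure \<Rightarrow> 'a rclosure" is uminus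
  by (rule rcl_carrier_minus)
lift_definition minus_rclosure :: "'a rclosure \<Rightarrow> 'a rclosure \<Rightarrow> 'a rclosure" is "(-)"
  using rcl_carrier_add rcl_carrier_minus by (metis diff_conv_add_uminus)
lift_definition times_rclosure :: "'a rclosure \<Rightarrow> 'a rclosure \<Rightarrow> 'a rclosure" is "(*)"
  by (rule rcl_carrier_mult)
lift_definition inverse_rclosure :: "'a rclosure \<Rightarrow> 'a rclosure" is inverse
  by (rule rcl_carrier_inverse)
definition divide_rclosure :: "'a rclosure \<Rightarrow> 'a rclosure \<Rightarrow> 'a rclosure" where
  "divide_rclosure x y = x * inverse y"
lift_definition less_eq_rclosure :: "'a rclosure \<Rightarrow> 'a rclosure \<Rightarrow> bool" is "\<lambda>x y. y - x \<in> rcl_cone" .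
definition less_rclosure :: "'a rclosure \<Rightarrow> 'a rclosure \<Rightarrow> bool" where
  "less_rclosure x y \<longleftrightarrow> x \<le> y \<and> x \<noteq> y"
definition abs_rclosure :: "'a rclosure \<Rightarrow> 'a rclosure" where
  "abs_rclosure x = (if x < 0 then - x else x)"
definition sgn_rclosure :: "'a rclosure \<Rightarrow> 'a rclosure" where
  "sgn_rclosure x = (if x = 0 then 0 else if 0 < x then 1 else - 1)"

instance
proof
  fix x y z :: "'a rclosure"
  show "x + y - x = y" "x - y - z = x - (y + z)" "0 * x = 0" "x * 0 = 0"
    "x + y + z = x + (y + z)" "x + y = y + x" "0 + x = x" "- x + x = 0" "x - y = x + - y"
    "x * y * z = x * (y * z)" "x * y = y * x" "1 * x = x" "(x + y) * z = x * z + y * z"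
    "(0::'a rclosure) \<noteq> 1"
    by (transfer; simp add: algebra_simps)+
  show "x \<noteq> 0 \<Longrightarrow> inverse x * x = 1" "inverse (0::'a rclosure) = 0" by (transfer; simp)+
  show "x div y = x * inverse y" by (simp add: divide_rclosure_def)
  show anti: "x \<le> y \<Longrightarrow> y \<le> x \<Longrightarrow> x = y"
    by transfer (metis eq_iff_diff_eq_0 minus_diff_eq rcl_cone_simps(6))
  show "(x < y) = (x \<le> y \<and> \<not> y \<le> x)" using anti
    by (auto simp: less_rclosure_def)
  show "x \<le> x" by transfer (simp add: rcl_cone_simps)
  show "x \<le> y \<Longrightarrow> y \<le> z \<Longrightarrow> x \<le> z"
    by transfer (metis rcl_cone_simps(3) diff_add_cancel add_diff_eq)
  show "x \<le> y \<or> y \<le> x" 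
  proof transfer
    fix x y :: "'a alg_closure" assume "x \<in> rcl_carrier" "y \<in> rcl_carrier"
    then have "x + - y \<in> rcl_carrier" using rcl_carrier_add rcl_carrier_minus by blast
    then show "y - x \<in> rcl_cone \<or> x - y \<in> rcl_cone" by (auto simp: rcl_carrier_def)
  qed
  show "x \<le> y \<Longrightarrow> z + x \<le> z + y" by transfer simp
  show "x < y \<Longrightarrow> 0 < z \<Longrightarrow> z * x < z * y"
    unfolding less_rclosure_def
    by transfer (metis diff_zero mult_cancel_left rcl_cone_simps(4) right_diff_distrib)
  show "\<bar>x\<bar> = (if x < 0 then - x else x)" by (simp add: abs_rclosure_def)
  show "sgn x = (if x = 0 then 0 else if 0 < x then 1 else - 1)" by (simp add: sgn_rclosure_def)
qed

end

lift_definition to_rc :: "'a::linordered_field \<Rightarrow> 'a rclosure" is to_ac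
proof -
  show "to_ac a \<in> rcl_carrier" for a :: 'a
    using rcl_cone(2)[of a] rcl_cone(2)[of "- a"] linear[of 0 a] by (auto simp: rcl_carrier_def)
qed

lemma to_rc_hom [simp]: "to_rc (x + y) = to_rc x + to_rc y" "to_rc (x * y) = to_rc x * to_rc y"
  "to_rc 1 = 1" "to_rc 0 = 0"
  by (transfer; simp)+

lemma to_rc_nonneg: "0 \<le> x \<Longrightarrow> 0 \<le> to_rc x"
  by transfer (simp add: rcl_cone)

lemma to_rc_eq_0: "to_rc x = 0 \<longleftrightarrow> x = 0"
  by transfer simp

lemma Rep_rclosure_hom [simp]: "Rep_rclosure 0 = 0" "Rep_rclosure 1 = 1" 
  "Rep_rclosure (x + y) = Rep_rclosure x + Rep_rclosure y"
  "Rep_rclosure (x * y) = Rep_rclosure x * Rep_rclosure y" "Rep_rclosure (- x) = - Rep_rclosure x"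
  "Rep_rclosure x = 0 \<longleftrightarrow> x = 0"
  by (transfer; simp)+

text \<open>The range of \<open>ac_eval t\<close> is the ring generated by \<open>t\<close> over the
  real closure; for a root \<open>t\<close> of an irreducible polynomial it is the extension field
  to which maximality is applied.\<close>

definition ac_eval :: "'a::linordered_field alg_closure \<Rightarrow> 'a rclosure poly \<Rightarrow> 'a alg_closure" where
  "ac_eval t p = poly (map_poly Rep_rclosure p) t"

lemma ac_eval_simps [simp]: "ac_eval t 0 = 0" "ac_eval t 1 = 1" "ac_eval t (p + q) = ac_eval t p + ac_eval t q"
  "ac_eval t (pCons c p) = Rep_rclosure c + t * ac_eval t p"
  "ac_eval t (smult c p) = Rep_rclosure c * ac_eval t p"
  "ac_eval t (p * q) = ac_eval t p * ac_eval t q" "ac_eval t (- p) = - ac_eval t p"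
proof -
  show c: "ac_eval t (pCons c p) = Rep_rclosure c + t * ac_eval t p" for c p
    by (simp add: ac_eval_def map_poly_pCons)
  show z: "ac_eval t 0 = 0" by (simp add: ac_eval_def)
  show "ac_eval t 1 = 1" using c[of 1 0] z by (simp add: one_pCons)
  have a: "ac_eval t (p + q) = ac_eval t p + ac_eval t q" for p q
    by (induction p q rule: poly_induct2) (auto simp: c z algebra_simps)
  then show "ac_eval t (p + q) = ac_eval t p + ac_eval t q" .
  have s: "ac_eval t (smult c p) = Rep_rclosure c * ac_eval t p" for c p
    by (induction p) (auto simp: c z algebra_simps)
  then show "ac_eval t (smult c p) = Rep_rclosure c * ac_eval t p" .
  show "ac_eval t (p * q) = ac_eval t p * ac_eval t q"
    by (induction p) (auto simp: c z s a algebra_simps)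
  show "ac_eval t (- p) = - ac_eval t p"
    using s[of "- 1" p] by simp
qed

lemma pos_combination_nonneg:
  fixes c :: "'i \<Rightarrow> 'b::linordered_field"
  assumes "\<And>i. i \<in> A \<Longrightarrow> 0 \<le> c i"
  shows "0 \<le> (\<Sum>i\<in>A. c i * (s i * s i))"
  by (intro sum_nonneg mult_nonneg_nonneg[OF _ zero_le_square] assms)

lemma poly_decomp_sign_change:
  fixes u v :: "'b::linordered_field poly"
  assumes "poly (u * v) a < 0" "0 < poly (u * v) b"
  shows "(poly u a * poly u b < 0) \<or> (poly v a * poly v b < 0)"
  using assms by (auto simp: mult_less_0_iff zero_less_mult_iff)

text \<open>The generator is a nonzero element of least degree in the ideal of \<open>s\<close> and
  \<open>h\<close>: a nonzero remainder modulo it would lie in the ideal and have smaller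
  degree.\<close>

lemma bezout_poly:
  fixes s h :: "'b::field poly"
  assumes "h \<noteq> 0"
  obtains u a b where "u = a * s + b * h" "u dvd s" "u dvd h" "u \<noteq> 0"
proof -
  let ?I = "{u. u \<noteq> 0 \<and> (\<exists>a b. u = a * s + b * h)}"
  have "h \<in> ?I" using assms by (auto intro: exI[of _ 0] exI[of _ 1])
  then obtain u where u: "u \<in> ?I" and min: "\<And>v. v \<in> ?I \<Longrightarrow> degree u \<le> degree v"
    using ex_has_least_nat[of "\<lambda>u. u \<in> ?I" h degree] by blast
  from u obtain a b where ab: "u = a * s + b * h" "u \<noteq> 0" by auto
  have "u dvd c * s + d * h" for c d
  proof (rule ccontr)
    assume "\<not> u dvd c * s + d * h"
    then have nz: "(c * s + d * h) mod u \<noteq> 0" by (simp add: dvd_eq_mod_eq_0)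
    define q where "q = (c * s + d * h) div u"
    have "(c * s + d * h) mod u = (c * s + d * h) - q * u"
      by (simp add: q_def minus_div_mult_eq_mod)
    also have "\<dots> = (c - q * a) * s + (d - q * b) * h"
      by (simp add: ab(1) algebra_simps)
    finally have "(c * s + d * h) mod u \<in> ?I" using nz by blast
    then have "degree u \<le> degree ((c * s + d * h) mod u)" by (rule min)
    then show False using degree_mod_less'[OF ab(2), of "c * s + d * h"] nz by simp
  qed
  from this[of 1 0] this[of 0 1] show ?thesis using that ab by auto
qed

text \<open>By induction on the degree. A counterexample \<open>h\<close> is irreducible, since one
  of two proper factors would change sign. A root \<open>t\<close> of \<open>h\<close> in the
  algebraic closure generates an extension field that can be ordered, again by the induction
  hypothesis, and maximality forces \<open>t\<close> into the real closure. Then \<open>h\<close> is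
  linear, and its root lies between \<open>a\<close> and \<open>b\<close>.\<close>

theorem rclosure_poly_ivt:
  fixes h :: "'a::linordered_field rclosure poly"
  assumes "a < b" "poly h a < 0" "0 < poly h b"
  shows "\<exists>x. a < x \<and> x < b \<and> poly h x = 0"
  using assms
proof (induction "degree h" arbitrary: h a b rule: less_induct)
  case less
  have IH: "\<exists>x. a < x \<and> x < b \<and> poly k x = 0" if "degree k < degree h" "poly k a * poly k b < 0" for k
  proof (cases "poly k a < 0")
    case True
    then show ?thesis using less(1)[of k a b] less.prems(1) that by (auto simp: mult_less_0_iff)
  next
    case False
    then show ?thesis using less(1)[of "- k" a b] less.prems(1) that by (auto simp: mult_less_0_iff)
  qed
  show ?case
  proof (rule ccontr)
    assume "\<not> ?thesis"
    then have nr: "poly h x \<noteq> 0" if "a < x" "x < b" for x using that by blast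
    have h0: "h \<noteq> 0" using less.prems by auto
    have degh: "degree h > 0"
    proof (rule ccontr)
      assume "\<not> 0 < degree h"
      then obtain c where "h = [:c:]" by (metis degree_eq_zeroE neq0_conv)
      then show False using less.prems by simp
    qed
    have irr: "degree u = 0 \<or> degree v = 0" if uv: "h = u * v" for u v
    proof (rule ccontr)
      assume n: "\<not> ?thesis"
      have "u \<noteq> 0" "v \<noteq> 0" using uv h0 by auto
      then have "degree u < degree h" "degree v < degree h" using n uv by (auto simp: degree_mult_eq)
      then obtain x where "a < x" "x < b" "poly u x = 0 \<or> poly v x = 0"
        using poly_decomp_sign_change[of u v a b] IH[of u] IH[of v] less.prems uv by auto
      then show False using nr uv by auto
    qed
    have "degree (map_poly Rep_rclosure h) = degree h"
      by (rule degree_map_poly) auto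
    then obtain t where t: "poly (map_poly Rep_rclosure h) t = 0"
      using alg_closed_imp_poly_has_root[of "map_poly Rep_rclosure h"] degh by auto
    then have t: "ac_eval t h = 0" by (simp add: ac_eval_def)
    define M where "M = range (ac_eval t)"
    have inv: "\<exists>k. ac_eval t s * ac_eval t k = 1" if s: "ac_eval t s \<noteq> 0" for s
    proof -
      obtain u c d where u: "u = c * s + d * h" "u dvd s" "u dvd h" "u \<noteq> 0"
        using bezout_poly[OF h0] by metis
      from u(3) obtain v where v: "h = u * v" by (elim dvdE)
      have "degree v \<noteq> 0"
      proof
        assume "degree v = 0"
        then obtain e where "v = [:e:]" by (auto elim: degree_eq_zeroE)
        then have "h = smult e u" "e \<noteq> 0" using v h0 by auto
        then have "ac_eval t u = 0" using t by auto
        then show False using u(2) s by (auto elim!: dvdE)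
      qed
      then have "degree u = 0" using irr[OF v] by simp
      then obtain e where e: "u = [:e:]" "e \<noteq> 0" using u(4) by (metis degree_eq_zeroE pCons_0_0)
      have "Rep_rclosure e = ac_eval t u" using e by simp
      also have "\<dots> = ac_eval t s * ac_eval t c" by (simp add: u(1) t)
      finally have "ac_eval t s * ac_eval t (smult (inverse e) c) = Rep_rclosure (inverse e) * Rep_rclosure e"
        by simp
      also have "\<dots> = Rep_rclosure (inverse e * e)" by (simp only: Rep_rclosure_hom)
      also have "\<dots> = 1" using e(2) by simp
      finally show ?thesis by blast
    qed
    have M: "subfield_set M"
      unfolding subfield_set_def M_def
    proof (intro conjI ballI)
      show "0 \<in> range (ac_eval t)" "1 \<in> range (ac_eval t)" 
        by (metis ac_eval_simps(1) rangeI) (metis ac_eval_simps(2) rangeI)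
      fix x y assume "x \<in> range (ac_eval t)" "y \<in> range (ac_eval t)"
      then show "x + y \<in> range (ac_eval t)" "x * y \<in> range (ac_eval t)"
        by (auto simp flip: ac_eval_simps)
    next
      fix x assume x: "x \<in> range (ac_eval t)"
      then show "- x \<in> range (ac_eval t)" by (auto simp flip: ac_eval_simps)
      show "inverse x \<in> range (ac_eval t)"
      proof (cases "x = 0")
        case True then show ?thesis using x by simp
      next
        case False
        then obtain k where "x * ac_eval t k = 1" using x inv by auto
        then show ?thesis by (metis inverse_unique rangeI)
      qed
    qed
    \<comment> \<open>The squares are weighted by nonnegative elements, so that an ordering
      containing \<open>T\<close> contains \<open>rcl_cone\<close> and therefore extends the order
      of the real closure.\<close>
    define T where "T = {ac_eval t (\<Sum>i<n. smult (c i) (s i * s i)) |n (c :: nat \<Rightarrow> 'a rclosure) s. \<forall>i. 0 \<le> c i}"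
    have sumsq_add: "\<exists>(n::nat) c s. (\<forall>i. 0 \<le> c i) \<and> (\<Sum>i<m. smult (c1 i) (s1 i * s1 i)) + (\<Sum>i<m'. smult (c2 i) (s2 i * s2 i)) = (\<Sum>i<n. smult (c i) (s i * s i))"
      if "\<forall>i. 0 \<le> c1 i" "\<forall>i. 0 \<le> c2 i" for m m' :: nat and c1 c2 :: "nat \<Rightarrow> 'a rclosure" and s1 s2
    proof (rule exI[of _ "m + m'"], rule exI[of _ "\<lambda>i. if i < m then c1 i else c2 (i - m)"],
        rule exI[of _ "\<lambda>i. if i < m then s1 i else s2 (i - m)"], intro conjI)
      show "\<forall>i. 0 \<le> (if i < m then c1 i else c2 (i - m))" using that by auto
      have "(\<Sum>i<m+m'. smult (if i < m then c1 i else c2 (i - m)) ((if i < m then s1 i else s2 (i - m)) * (if i < m then s1 i else s2 (i - m))))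
        = (\<Sum>i<m. smult (c1 i) (s1 i * s1 i)) + (\<Sum>i<m'. smult (c2 i) (s2 i * s2 i))"
      proof (induction m')
        case 0 then show ?case by simp
      qed simp
      then show "(\<Sum>i<m. smult (c1 i) (s1 i * s1 i)) + (\<Sum>i<m'. smult (c2 i) (s2 i * s2 i)) =
        (\<Sum>i<m+m'. smult (if i < m then c1 i else c2 (i - m)) ((if i < m then s1 i else s2 (i - m)) * (if i < m then s1 i else s2 (i - m))))" by (rule sym)
    qed
    have Tadd: "x + y \<in> T" if xy: "x \<in> T" "y \<in> T" for x y
    proof -
      from xy obtain m m' :: nat and c1 c2 s1 s2 where *: "\<forall>i. 0 \<le> c1 i" "\<forall>i. 0 \<le> c2 i"
        and e: "x = ac_eval t (\<Sum>i<m. smult (c1 i) (s1 i * s1 i))" "y = ac_eval t (\<Sum>i<m'. smult (c2 i) (s2 i * s2 i))"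
        unfolding T_def by blast
      obtain n :: nat and c s where **: "\<forall>i. 0 \<le> c i" 
        and e': "(\<Sum>i<m. smult (c1 i) (s1 i * s1 i)) + (\<Sum>i<m'. smult (c2 i) (s2 i * s2 i)) = (\<Sum>i<n. smult (c i) (s i * s i))"
        using sumsq_add[OF *, where m=m and m'=m' and ?s1.0=s1 and ?s2.0=s2] by (elim exE conjE)
      have "x + y = ac_eval t (\<Sum>i<n. smult (c i) (s i * s i))"
        unfolding e e'[symmetric] by (rule ac_eval_simps(3)[symmetric])
      then show ?thesis unfolding T_def using ** by (intro CollectI exI conjI)
    qed
    have T0: "0 \<in> T" unfolding T_def
      by clarsimp (rule exI[of _ 0], rule exI[of _ "\<lambda>_. 0"], simp)
    have Tmon: "ac_eval t (smult c (s * s)) \<in> T" if "0 \<le> c" for c s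
      unfolding T_def using that
      by (intro CollectI exI[of _ "Suc 0"] exI[of _ "\<lambda>_. c"] exI[of _ "\<lambda>_. s"]) auto
    have Tsum: "ac_eval t (\<Sum>i<n. p i) \<in> T" if "\<And>i. ac_eval t (p i) \<in> T" for n :: nat and p
      by (induction n) (auto simp: T0 Tadd that)
    have Tmult: "x * y \<in> T" if xy: "x \<in> T" "y \<in> T" for x y
    proof -
      from xy obtain m m' :: nat and c1 c2 s1 s2 where *: "\<forall>i. 0 \<le> c1 i" "\<forall>i. 0 \<le> c2 i"
        "x = ac_eval t (\<Sum>i<m. smult (c1 i) (s1 i * s1 i))" "y = ac_eval t (\<Sum>i<m'. smult (c2 i) (s2 i * s2 i))"
        unfolding T_def by blast
      have "x * y = ac_eval t (\<Sum>i<m. \<Sum>j<m'. smult (c1 i * c2 j) ((s1 i * s2 j) * (s1 i * s2 j)))"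
        unfolding * ac_eval_simps(6)[symmetric] sum_product
        by (intro arg_cong[of _ _ "ac_eval t"] sum.cong refl) (simp add: algebra_simps)
      moreover have "ac_eval t (\<Sum>i<m. \<Sum>j<m'. smult (c1 i * c2 j) ((s1 i * s2 j) * (s1 i * s2 j))) \<in> T"
        by (intro Tsum Tmon) (use * in auto)
      ultimately show ?thesis by simp
    qed
    have reduce: "ac_eval t (s mod h) = ac_eval t s" for s
    proof -
      have "ac_eval t s = ac_eval t (s div h * h + s mod h)" by simp
      then show ?thesis by (simp only: ac_eval_simps t) simp
    qed
    \<comment> \<open>If \<open>- 1\<close> were such a sum, the polynomial \<open>w\<close> built
      from the reduced representatives would be a multiple \<open>h * k\<close> and positive
      everywhere. The reduced degrees bound the degree of \<open>w\<close> by
      \<open>2 * degree h - 2\<close>, so \<open>k\<close> has smaller degree than \<open>h\<close>,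
      yet it must change sign where \<open>h\<close> does.\<close>
    have Tm1: "- 1 \<notin> T"
    proof
      assume "- 1 \<in> T"
      then obtain n :: nat and c s where c: "\<forall>i. 0 \<le> c i" and e: "- 1 = ac_eval t (\<Sum>i<n. smult (c i) (s i * s i))"
        unfolding T_def by blast
      define r where "r i = s i mod h" for i
      have es: "ac_eval t (\<Sum>i<n. smult (c i) (r i * r i)) = ac_eval t (\<Sum>i<n. smult (c i) (s i * s i))"
        by (induction n) (auto simp: reduce r_def)
      define w where "w = 1 + (\<Sum>i<n. smult (c i) (r i * r i))"
      have w0: "ac_eval t w = 0" using e es by (simp add: w_def) (metis add.right_inverse)
      have "h dvd w"
      proof (rule ccontr)
        assume "\<not> h dvd w"
        obtain u a' b' where u: "u = a' * w + b' * h" "u dvd w" "u dvd h" "u \<noteq> 0"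
          using bezout_poly[OF h0] by metis
        have "ac_eval t u = 0" using u(1) w0 t by simp
        from u(3) obtain v where v: "h = u * v" by (elim dvdE)
        have "degree u \<noteq> 0"
        proof
          assume "degree u = 0"
          then obtain e where "u = [:e:]" by (auto elim: degree_eq_zeroE)
          then show False using \<open>ac_eval t u = 0\<close> u(4) by simp
        qed
        then have "degree v = 0" using irr[OF v] by simp
        then obtain e where "v = [:e:]" by (auto elim: degree_eq_zeroE)
        then have "h = smult e u" "e \<noteq> 0" using v h0 by auto
        then have "h dvd w" using u(2) by (simp add: smult_dvd_iff)
        then show False using \<open>\<not> h dvd w\<close> by simp
      qed
      then obtain k where k: "w = h * k" by (elim dvdE)
      have degr: "degree (r i) \<le> degree h - 1" for i
        using degree_mod_less'[OF h0, of "s i"] unfolding r_def by (cases "s i mod h = 0") auto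
      have "degree (smult (c i) (r i * r i)) \<le> 2 * degree h - 2" for i
        using degree_smult_le[of "c i" "r i * r i"] degree_mult_le[of "r i" "r i"] degr[of i] by simp
      then have "degree w \<le> 2 * degree h - 2" unfolding w_def
        by (intro degree_add_le degree_sum_le) auto
      moreover have wpos: "poly w x > 0" for x
      proof -
        have "0 \<le> (\<Sum>i<n. c i * (poly (r i) x * poly (r i) x))" by (rule pos_combination_nonneg) (use c in auto)
        then show ?thesis unfolding w_def by (simp add: poly_sum add_pos_nonneg)
      qed
      moreover have "w \<noteq> 0" using wpos[of 0] by auto
      ultimately have "degree k < degree h" using k degh by (auto simp: degree_mult_eq)
      moreover have "poly k a * poly k b < 0"
        using wpos[of a] wpos[of b] less.prems unfolding k by (auto simp: zero_less_mult_iff mult_less_0_iff)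
      ultimately obtain x where "poly k x = 0" using IH by blast
      then show False using wpos[of x] k by simp
    qed
    have "precone M T" unfolding precone_def
    proof (intro conjI ballI)
      show "T \<subseteq> M" by (auto simp: T_def M_def)
      show "- 1 \<notin> T" by (rule Tm1)
      fix x assume "x \<in> M"
      then obtain s where "x = ac_eval t s" by (auto simp: M_def)
      then show "x * x \<in> T" using Tmon[of 1 s] by simp
    qed (auto intro: Tadd Tmult)
    then obtain P where P: "ordered_cone P" "T \<subseteq> P" "P \<union> uminus ` P = M"
      using precone_extend[OF M] by metis
    have "rcl_cone \<subseteq> P"
    proof
      fix x :: "'a alg_closure" assume x: "x \<in> rcl_cone"
      then have "x \<in> rcl_carrier" by (simp add: rcl_carrier_def)
      then obtain y where y: "x = Rep_rclosure y" using Rep_rclosure_cases by blast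
      have "0 \<le> y" using x unfolding y by transfer simp
      then show "x \<in> P" using Tmon[of y 1] P(2) y by auto
    qed
    then have "P = rcl_cone" using rcl_cone(3)[OF P(1)] by simp
    moreover have "t \<in> M" unfolding M_def by (rule range_eqI[of _ _ "[:0, 1:]"]) simp
    ultimately have "t \<in> rcl_carrier" using P(3) by (auto simp: rcl_carrier_def)
    then obtain y where y: "t = Rep_rclosure y" using Rep_rclosure_cases by blast
    have "ac_eval t p = Rep_rclosure (poly p y)" for p
      by (induction p) (auto simp: y)
    then have "poly h y = 0" using t by simp
    then obtain k where k: "h = [:- y, 1:] * k" by (auto simp: poly_eq_0_iff_dvd)
    then have "degree k = 0" using irr[of "[:- y, 1:]" k] by simp
    then obtain e where "k = [:e:]" by (auto elim: degree_eq_zeroE)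
    then have ph: "poly h x = (x - y) * e" for x using k by (simp add: algebra_simps)
    then have "a < y \<and> y < b"
      using less.prems by (auto simp: mult_less_0_iff zero_less_mult_iff)
    then show False using nr ph by auto
  qed
qed

instance rclosure :: (linordered_field) poly_ivt_field
proof
  fix a b :: "'a rclosure" and n :: nat and f :: "nat \<Rightarrow> 'a rclosure"
  have e: "poly (\<Sum>k\<le>n. monom (f k) k) x = (\<Sum>k\<le>n. f k * x ^ k)" for x :: "'a rclosure"
    by (simp add: poly_sum Polynomial.poly_monom)
  show "a < b \<Longrightarrow> (\<Sum>k\<le>n. f k * a ^ k) < 0 \<Longrightarrow> 0 < (\<Sum>k\<le>n. f k * b ^ k) \<Longrightarrow>
    \<exists>x. a < x \<and> x < b \<and> (\<Sum>k\<le>n. f k * x ^ k) = 0"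
    unfolding e[symmetric] by (rule rclosure_poly_ivt)
qed

instance real :: poly_ivt_field
proof
  fix a b :: real and n :: nat and f :: "nat \<Rightarrow> real"
  assume *: "a < b" "(\<Sum>k\<le>n. f k * a ^ k) < 0" "0 < (\<Sum>k\<le>n. f k * b ^ k)"
  have "continuous_on {a..b} (\<lambda>x. \<Sum>k\<le>n. f k * x ^ k)" by (intro continuous_intros)
  then obtain x where "a \<le> x" "x \<le> b" "(\<Sum>k\<le>n. f k * x ^ k) = 0"
    using IVT'[of "\<lambda>x. \<Sum>k\<le>n. f k * x ^ k" a 0 b] * by auto
  moreover from this * have "x \<noteq> a" "x \<noteq> b" by auto
  ultimately show "\<exists>x. a < x \<and> x < b \<and> (\<Sum>k\<le>n. f k * x ^ k) = 0" by (metis order_less_le)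
qed

text \<open>The class axiom is phrased with power sums, so that it does not mention the type of
  polynomials over the type being axiomatised; this is its usual form.\<close>

lemma poly_ivt:
  fixes p :: "'b::poly_ivt_field poly"
  assumes "a < b" "poly p a < 0" "0 < poly p b"
  obtains x where "a < x" "x < b" "poly p x = 0"
  using poly_ivt_sum[of a b "coeff p" "degree p"] assms by (auto simp: poly_altdef)

section \<open>Sign tables\<close>

text \<open>The two values may live in different ordered fields: the transfer arguments compare
  signs across fields.\<close>

definition ssign :: "'a::linordered_field \<Rightarrow> 'b::linordered_field \<Rightarrow> bool" where
  "ssign a b \<longleftrightarrow> (a < 0 \<longleftrightarrow> b < 0) \<and> (0 < a \<longleftrightarrow> 0 < b)"

lemma ssign_zero: "ssign a b \<Longrightarrow> a = 0 \<longleftrightarrow> b = 0"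
  by (auto simp: ssign_def)

lemma ssign_mult: "ssign a b \<Longrightarrow> ssign c d \<Longrightarrow> ssign (a * c) (b * d)"
  by (auto simp: ssign_def mult_less_0_iff zero_less_mult_iff)

lemma ssign_power: "ssign a b \<Longrightarrow> ssign (a ^ k) (b ^ k)"
proof (induction k)
  case (Suc k)
  then show ?case unfolding power_Suc by (intro ssign_mult)
qed (simp add: ssign_def)

lemma ssign_cancel: "ssign (a * c) (b * d) \<Longrightarrow> ssign a b \<Longrightarrow> a \<noteq> 0 \<Longrightarrow> ssign c d"
  by (auto simp: ssign_def mult_less_0_iff zero_less_mult_iff)

section \<open>Rolle's theorem and growth of polynomials, proved algebraically\<close>

lemma poly_ivt_le:
  fixes p :: "'b::poly_ivt_field poly"
  assumes "a \<le> b" "poly p a * poly p b \<le> 0"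
  obtains x where "a \<le> x" "x \<le> b" "poly p x = 0"
proof -
  consider "poly p a = 0" | "poly p b = 0" | "poly p a < 0" "0 < poly p b" | "0 < poly p a" "poly p b < 0"
    using assms(2) unfolding mult_le_0_iff by (metis order_le_less)
  then show ?thesis
  proof cases
    case 3
    then have "a < b" using assms(1) by (metis order_less_asym order_less_le)
    then show ?thesis using poly_ivt[of a b p] 3 that by (metis less_imp_le)
  next
    case 4
    then have "a < b" using assms(1) by (metis order_less_asym order_less_le)
    then show ?thesis using poly_ivt[of a b "- p"] 4 that by (metis less_imp_le neg_0_less_iff_less neg_less_0_iff_less neg_equal_0_iff_equal poly_minus)
  qed (use assms that in auto)
qed

lemma poly_root_split:
  fixes p :: "'b::field poly"
  assumes "p \<noteq> 0" "poly p a = 0"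
  obtains m g where "p = [:- a, 1:] ^ Suc m * g" "poly g a \<noteq> 0"
proof -
  obtain g where g: "p = [:- a, 1:] ^ order a p * g" "\<not> [:- a, 1:] dvd g"
    using order_decomp[OF assms(1)] by blast
  have "order a p \<noteq> 0" using assms order_root by blast
  then obtain m where "order a p = Suc m" by (cases "order a p") auto
  then show ?thesis using that g by (metis poly_eq_0_iff_dvd)
qed

lemma pderiv_two_powers:
  fixes f g h :: "'b::{idom,semiring_char_0} poly"
  assumes "pderiv f = 1" "pderiv g = 1"
  shows "pderiv (f ^ Suc m * g ^ Suc n * h) = f ^ m * g ^ n *
    (smult (of_nat (Suc m)) (g * h) + smult (of_nat (Suc n)) (f * h) + f * g * pderiv h)"
  unfolding pderiv_mult pderiv_power_Suc assms
  by (simp add: algebra_simps del: of_nat_Suc)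

text \<open>An ordered field offers no compactness, so the extremum is replaced by algebra. Let
  \<open>b'\<close> be the next root after \<open>a\<close>, and split off the full powers of the
  linear factors at \<open>a\<close> and \<open>b'\<close>; the cofactor \<open>h\<close> keeps its
  sign between them. After removal of the common powers from \<open>pderiv p\<close>, the remaining
  factor \<open>k\<close> has opposite signs at \<open>a\<close> and \<open>b'\<close>.\<close>

lemma poly_rolle:
  fixes p :: "'b::poly_ivt_field poly"
  assumes "a < b" "poly p a = 0" "poly p b = 0"
  shows "\<exists>c. a < c \<and> c < b \<and> poly (pderiv p) c = 0"
proof (cases "p = 0")
  case True
  then show ?thesis using dense[OF assms(1)] by auto
next
  case False
  let ?B = "{x. a < x \<and> poly p x = 0}"
  have fin: "finite ?B" using poly_roots_finite[OF False] by (rule rev_finite_subset) auto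
  have "b \<in> ?B" using assms by auto
  define b' where "b' = Min ?B"
  have b': "b' \<in> ?B" unfolding b'_def using fin \<open>b \<in> ?B\<close> by (intro Min_in) auto
  have b'min: "b' \<le> x" if "a < x" "poly p x = 0" for x
    unfolding b'_def using fin that by (intro Min_le) auto
  have "b' \<le> b" using b'min assms by auto
  obtain m g where g: "p = [:- a, 1:] ^ Suc m * g" "poly g a \<noteq> 0"
    using poly_root_split[OF False assms(2)] .
  have "g \<noteq> 0" "poly g b' = 0" using g(2) b' unfolding g(1) by auto
  then obtain n h where h: "g = [:- b', 1:] ^ Suc n * h" "poly h b' \<noteq> 0"
    using poly_root_split by blast
  have ha: "poly h a \<noteq> 0" using g(2) unfolding h(1) by auto
  have pe: "p = [:- a, 1:] ^ Suc m * [:- b', 1:] ^ Suc n * h" unfolding g(1) h(1) by (simp add: mult.assoc)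
  have same: "poly h a * poly h b' > 0"
  proof (rule ccontr)
    assume "\<not> ?thesis"
    then obtain x where x: "a \<le> x" "x \<le> b'" "poly h x = 0"
      using poly_ivt_le[of a b' h] b' by auto
    then have "x \<noteq> a" "x \<noteq> b'" using ha h(2) by auto
    moreover have "poly p x = 0" using x(3) unfolding pe by simp
    ultimately show False using b'min[of x] x by auto
  qed
  define k where "k = smult (of_nat (Suc m)) ([:- b', 1:] * h) + smult (of_nat (Suc n)) ([:- a, 1:] * h) +
     [:- a, 1:] * [:- b', 1:] * pderiv h"
  have pd: "pderiv p = [:- a, 1:] ^ m * [:- b', 1:] ^ n * k"
    unfolding pe k_def by (rule pderiv_two_powers) (simp_all add: pderiv_pCons)
  have "poly k a = of_nat (Suc m) * ((a - b') * poly h a)" unfolding k_def by (simp add: algebra_simps)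
  moreover have "poly k b' = of_nat (Suc n) * ((b' - a) * poly h b')" unfolding k_def by (simp add: algebra_simps)
  ultimately have "poly k a * poly k b' = (of_nat (Suc m) * of_nat (Suc n) * ((a - b') * (b' - a))) * (poly h a * poly h b')"
    by (simp only: mult_ac)
  moreover have "of_nat (Suc m) * of_nat (Suc n) * ((a - b') * (b' - a)) < (0::'b)"
    using b' by (intro mult_pos_neg[OF mult_pos_pos mult_neg_pos]) (auto simp del: of_nat_Suc)
  ultimately have neg: "poly k a * poly k b' < 0" using same by (simp add: mult_neg_pos)
  then obtain c where c: "a \<le> c" "c \<le> b'" "poly k c = 0" using poly_ivt_le[of a b' k] b' by auto
  then have "c \<noteq> a" "c \<noteq> b'" using neg by auto
  then show ?thesis using c pd \<open>b' \<le> b\<close> by (intro exI[of _ c]) auto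
qed

lemma poly_mvt:
  fixes p :: "'b::poly_ivt_field poly"
  assumes "a < b"
  obtains c where "a < c" "c < b" "poly p b - poly p a = (b - a) * poly (pderiv p) c"
proof -
  define s where "s = (poly p b - poly p a) / (b - a)"
  have "s * (b - a) = poly p b - poly p a" using assms by (simp add: s_def)
  then have "poly (p - [:poly p a - s * a, s:]) a = 0" "poly (p - [:poly p a - s * a, s:]) b = 0"
    by (simp_all add: algebra_simps)
  from poly_rolle[OF assms this] obtain c where c: "a < c" "c < b" "poly (pderiv p) c = s"
    by (auto simp: pderiv_diff pderiv_pCons)
  then show ?thesis using that assms by (auto simp: s_def)
qed

text \<open>The bound is only some positive constant \<open>e\<close>, so that nonzero constant
  polynomials are included. In the induction the factor \<open>x\<close> outgrows any constant once
  it is multiplied by a value bounded away from zero.\<close>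

lemma poly_away_from_zero:
  fixes p :: "'b::linordered_field poly"
  assumes "p \<noteq> 0"
  shows "\<exists>N e. 0 < e \<and> (\<forall>x\<ge>N. e \<le> \<bar>poly p x\<bar>)"
  using assms
proof (induction p)
  case (pCons a p)
  show ?case
  proof (cases "p = 0")
    case True
    then show ?thesis using pCons by (intro exI[of _ 0] exI[of _ "\<bar>a\<bar>"]) auto
  next
    case False
    then obtain N e where e: "0 < e" "\<forall>x\<ge>N. e \<le> \<bar>poly p x\<bar>" using pCons by auto
    have "1 \<le> \<bar>poly (pCons a p) x\<bar>" if that: "x \<ge> max N (max 0 ((1 + \<bar>a\<bar>) / e))" for x
    proof -
      have x0: "0 \<le> x" using that by (meson max.boundedE)
      have "1 + \<bar>a\<bar> \<le> x * e" using that e by (simp add: divide_le_eq)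
      also have "\<dots> \<le> x * \<bar>poly p x\<bar>" using e that by (intro mult_left_mono x0) auto
      also have "\<dots> = \<bar>x * poly p x\<bar>" using x0 by (simp add: abs_mult)
      finally show ?thesis by (simp add: abs_if split: if_splits)
    qed
    then show ?thesis by (intro exI[of _ "max N (max 0 ((1 + \<bar>a\<bar>) / e))"] exI[of _ 1]) auto
  qed
qed simp

text \<open>The derivative is eventually at least a positive constant \<open>e\<close>, so the mean
  value theorem applies to a point \<open>t\<close> computed by division by \<open>e\<close>. This
  works in non-archimedean fields too.\<close>

lemma poly_increasing_unbounded:
  fixes p :: "'b::poly_ivt_field poly"
  assumes "\<And>t. x < t \<Longrightarrow> 0 < poly (pderiv p) t"
  shows "\<exists>t>x. 0 < poly p t"
proof -
  have "pderiv p \<noteq> 0" using assms[of "x + 1"] by auto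
  then obtain N e where e: "0 < e" "\<forall>x\<ge>N. e \<le> \<bar>poly (pderiv p) x\<bar>"
    using poly_away_from_zero by blast
  define a where "a = max N (x + 1)"
  define t where "t = a + (1 + \<bar>poly p a\<bar>) / e"
  have "a < t" unfolding t_def using e by (simp add: add_pos_nonneg)
  then obtain c where c: "a < c" "poly p t - poly p a = (t - a) * poly (pderiv p) c"
    using poly_mvt[of a t p] by metis
  have "e \<le> poly (pderiv p) c"
    using e(2)[rule_format, of c] assms[of c] c by (auto simp: a_def)
  then have "(t - a) * e \<le> poly p t - poly p a" unfolding c using \<open>a < t\<close> by (intro mult_left_mono) auto
  then have "1 + \<bar>poly p a\<bar> \<le> poly p t - poly p a" using e by (simp add: t_def)
  then have "0 < poly p t" by (simp add: abs_if split: if_splits)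
  moreover have "x < t" using \<open>a < t\<close> by (auto simp: a_def)
  ultimately show ?thesis by blast
qed

section \<open>Corresponding sample points on two ordered lines\<close>

definition matching :: "('a::linorder \<times> 'b::linorder) set \<Rightarrow> bool" where
  "matching M \<longleftrightarrow> finite M \<and> (\<forall>u v u' v'. (u, v) \<in> M \<longrightarrow> (u', v') \<in> M \<longrightarrow> (u < u' \<longleftrightarrow> v < v'))"

text \<open>The same position relative to the sample points: at corresponding points or in
  corresponding gaps, the unbounded gaps included.\<close>

definition corr :: "('a::linorder \<times> 'b::linorder) set \<Rightarrow> 'a \<Rightarrow> 'b \<Rightarrow> bool" where
  "corr M x y \<longleftrightarrow> (\<forall>u v. (u, v) \<in> M \<longrightarrow> (x < u \<longleftrightarrow> y < v) \<and> (u < x \<longleftrightarrow> v < y))"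

lemma matchingD: "matching M \<Longrightarrow> (u, v) \<in> M \<Longrightarrow> (u', v') \<in> M \<Longrightarrow> u < u' \<longleftrightarrow> v < v'"
  unfolding matching_def by blast

lemma corrD: "corr M x y \<Longrightarrow> (u, v) \<in> M \<Longrightarrow> (x < u \<longleftrightarrow> y < v) \<and> (u < x \<longleftrightarrow> v < y)"
  unfolding corr_def by blast

lemma corr_self: "matching M \<Longrightarrow> (u, v) \<in> M \<Longrightarrow> corr M u v"
  by (auto simp: matching_def corr_def)

lemma corr_between:
  assumes "corr M x y" "corr M x' y" "x \<le> c" "c \<le> x'" shows "corr M c y"
  unfolding corr_def
proof (intro allI impI)
  fix u v assume "(u, v) \<in> M"
  then have "(x < u) = (y < v) \<and> (u < x) = (v < y)" "(x' < u) = (y < v) \<and> (u < x') = (v < y)"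
    using assms(1,2) unfolding corr_def by blast+
  then show "(c < u) = (y < v) \<and> (u < c) = (v < y)" using assms(3,4) by (metis leD leI order_less_le_trans order_le_less_trans order_antisym)
qed

lemma matching_converse: "matching M \<Longrightarrow> matching (M\<inverse>)"
  by (auto simp: matching_def)

lemma corr_converse: "corr (M\<inverse>) y x \<longleftrightarrow> corr M x y"
  by (auto simp: corr_def)

lemma matching_corr_exists:
  fixes M :: "('a::linordered_field \<times> 'b::linordered_field) set"
  assumes "matching M" shows "\<exists>y. corr M x y"
proof (cases "x \<in> Domain M")
  case True
  then show ?thesis using corr_self[OF assms] by blast
next
  case False
  define A where "A = {v. \<exists>u. (u, v) \<in> M \<and> u < x}"
  define B where "B = {v. \<exists>u. (u, v) \<in> M \<and> x < u}"
  have fin: "finite A" "finite B"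
    using assms finite_Range[of M] unfolding matching_def A_def B_def by (auto intro: finite_subset[of _ "Range M"])
  have AB: "v < v'" if vv: "v \<in> A" "v' \<in> B" for v v'
  proof -
    obtain u u' where "(u, v) \<in> M" "u < x" "(u', v') \<in> M" "x < u'" using vv unfolding A_def B_def by blast
    then show ?thesis using matchingD[OF assms] by (meson order.strict_trans)
  qed
  obtain y where y: "\<forall>v\<in>A. v < y" "\<forall>v\<in>B. y < v"
  proof (cases "A = {} \<or> B = {}")
    case True
    then show ?thesis
    proof
      assume A: "A = {}"
      show ?thesis
      proof (rule that[of "Min (insert 0 B) - 1"])
        show "\<forall>v\<in>A. v < Min (insert 0 B) - 1" using A by simp
        show "\<forall>v\<in>B. Min (insert 0 B) - 1 < v"
          using fin Min_le[of "insert 0 B"] by (meson diff_less_eq finite.insertI insertI2 le_less_trans less_add_one order_le_less_trans)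
      qed
    next
      assume B: "B = {}"
      show ?thesis
      proof (rule that[of "Max (insert 0 A) + 1"])
        show "\<forall>v\<in>B. Max (insert 0 A) + 1 < v" using B by simp
        show "\<forall>v\<in>A. v < Max (insert 0 A) + 1"
          using fin Max_ge[of "insert 0 A"] by (meson finite.insertI insertI2 le_less_trans less_add_one)
      qed
    qed
  next
    case False
    then have "Max A < Min B" using AB[of "Max A" "Min B"] fin by auto
    then obtain y where "Max A < y" "y < Min B" using dense by blast
    then show ?thesis using that fin False by (metis Max_less_iff Min_gr_iff)
  qed
  have "corr M x y"
    unfolding corr_def
  proof clarify
    fix u v assume uv: "(u, v) \<in> M"
    then have "u \<noteq> x" using False by auto
    then consider "u < x" "v \<in> A" | "x < u" "v \<in> B" using uv unfolding A_def B_def by fastforce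
    then show "(x < u) = (y < v) \<and> (u < x) = (v < y)" using y by cases (auto dest: order.asym)
  qed
  then show ?thesis ..
qed

text \<open>The sign table of Cohen and Hoermander as a relation between two lines: no signs are
  stored, only their agreement at corresponding positions. The last clause makes every sample point
  a root of a nonzero member of the family, so that signs of a further polynomial at sample points
  can be read off from remainders.\<close>

definition tabled :: "('a::linordered_field poly \<times> 'b::linordered_field poly) set \<Rightarrow> ('a \<times> 'b) set \<Rightarrow> bool" where
  "tabled G M \<longleftrightarrow> matching M \<and>
     (\<forall>x y p q. corr M x y \<longrightarrow> (p, q) \<in> G \<longrightarrow> ssign (poly p x) (poly q y)) \<and>
     (\<forall>u v. (u, v) \<in> M \<longrightarrow> (\<exists>p q. (p, q) \<in> G \<and> p \<noteq> 0 \<and> q \<noteq> 0 \<and> poly p u = 0 \<and> poly q v = 0))"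

lemma right_gap:
  fixes x :: "'a::linordered_field" and M :: "('a \<times> 'b::linordered_field) set"
  assumes "finite M" "x \<notin> Domain M" "corr M x y"
  obtains m where "x < m" "\<And>c. x \<le> c \<Longrightarrow> c < m \<Longrightarrow> corr M c y"
proof -
  let ?U = "{u \<in> Domain M. x < u}"
  have "finite ?U" by (rule finite_subset[OF _ finite_Domain[OF assms(1)]]) auto
  then have fin: "finite (insert (x + 1) ?U)" by simp
  define m where "m = Min (insert (x + 1) ?U)"
  have "x < m" unfolding m_def using fin by (subst Min_gr_iff) auto
  moreover have "corr M c y" if c: "x \<le> c" "c < m" for c
    unfolding corr_def
  proof clarify
    fix u v assume uv: "(u, v) \<in> M"
    then have "u \<noteq> x" using assms(2) by auto
    have pos: "(x < u) = (y < v)" "(u < x) = (v < y)" using assms(3) uv by (auto simp: corr_def)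
    show "(c < u) = (y < v) \<and> (u < c) = (v < y)"
    proof (cases "x < u")
      case True
      then have "m \<le> u" unfolding m_def using fin uv by (intro Min_le) auto
      then show ?thesis using True pos c by auto
    next
      case False
      then show ?thesis using \<open>u \<noteq> x\<close> pos c by auto
    qed
  qed
  ultimately show ?thesis using that by blast
qed

text \<open>All points of a gap share a partner on the other line. A root off the sample points
  would therefore make \<open>g1\<close> vanish on a whole interval.\<close>

lemma root_in_Domain:
  fixes g1 :: "'a::linordered_field poly"
  assumes M: "matching M" and s: "\<And>x y. corr M x y \<Longrightarrow> ssign (poly g1 x) (poly g2 y)"
    and "g1 \<noteq> 0" "poly g1 x = 0"
  shows "x \<in> Domain M"
proof (rule ccontr)
  assume n: "x \<notin> Domain M"
  obtain y where y: "corr M x y" using matching_corr_exists[OF M] by blast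
  obtain m where m: "x < m" "\<And>c. x \<le> c \<Longrightarrow> c < m \<Longrightarrow> corr M c y"
    using right_gap[OF _ n y] M unfolding matching_def by blast
  have "poly g2 y = 0" using ssign_zero[OF s[OF y]] assms by simp
  then have "{x<..<m} \<subseteq> {c. poly g1 c = 0}" using ssign_zero[OF s[OF m(2)]] by auto
  then have "finite {x<..<m}" using poly_roots_finite[OF assms(3)] finite_subset by blast
  then show False using m(1) infinite_Ioo by blast
qed

section \<open>Signs of a polynomial between the roots of its derivative\<close>

text \<open>If no sample point lies to the right, \<open>q\<close> increases without bound there.
  Otherwise \<open>p\<close> is still positive at the next sample point \<open>u\<close>, agreement
  of signs makes \<open>q\<close> positive at its partner \<open>v\<close>, and an intermediate
  value gives a positive value before \<open>v\<close>.\<close>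

lemma positive_value_transfer:
  fixes p :: "'a::poly_ivt_field poly" and q :: "'b::poly_ivt_field poly"
  assumes M: "matching M" and d: "\<And>x y. corr M x y \<Longrightarrow> ssign (poly (pderiv p) x) (poly (pderiv q) y)"
    and pt: "\<And>u v. (u, v) \<in> M \<Longrightarrow> ssign (poly p u) (poly q v)"
    and xy: "corr M x y" "x \<notin> Domain M" and pos: "0 < poly (pderiv p) x" "0 < poly p x"
  shows "\<exists>y'. corr M x y' \<and> y \<le> y' \<and> 0 < poly q y'"
proof (cases "\<exists>u v. (u, v) \<in> M \<and> x < u")
  case False
  have c: "corr M x t" if "y < t" for t
    unfolding corr_def
  proof clarify
    fix u v assume uv: "(u, v) \<in> M"
    then have "u < x" using False xy(2) by (metis DomainI linorder_neqE)
    then show "(x < u) = (t < v) \<and> (u < x) = (v < t)" using corrD[OF xy(1) uv] that by auto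
  qed
  have "0 < poly (pderiv q) t" if "y < t" for t
    using d[OF c[OF that]] pos unfolding ssign_def by auto
  then obtain t where "t > y" "0 < poly q t" using poly_increasing_unbounded by blast
  then show ?thesis using c by (meson less_imp_le)
next
  case True
  let ?U = "{u \<in> Domain M. x < u}"
  have "finite M" using M by (simp add: matching_def)
  have fin: "finite ?U" by (rule finite_subset[OF _ finite_Domain[OF \<open>finite M\<close>]]) auto
  define u where "u = Min ?U"
  have "?U \<noteq> {}" using True by blast
  then have "u \<in> ?U" unfolding u_def by (rule Min_in[OF fin])
  then obtain v where uv: "(u, v) \<in> M" "x < u" by auto
  have umin: "u \<le> u'" if "(u', v') \<in> M" "x < u'" for u' v'
    unfolding u_def using that fin by (intro Min_le) auto
  have yv: "y < v" using xy(1) uv by (auto simp: corr_def)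
  have cy: "corr M c y" if "x \<le> c" "c < u" for c
    unfolding corr_def
  proof clarify
    fix u' v' assume m: "(u', v') \<in> M"
    then have pos': "(x < u') = (y < v')" "(u' < x) = (v' < y)" "u' \<noteq> x" using xy by (auto simp: corr_def)
    show "(c < u') = (y < v') \<and> (u' < c) = (v' < y)"
      using umin[OF m] pos' that by (cases "x < u'") auto
  qed
  have cx: "corr M x c" if "y \<le> c" "c < v" for c
    unfolding corr_def
  proof clarify
    fix u' v' assume m: "(u', v') \<in> M"
    then have pos': "(x < u') = (y < v')" "(u' < x) = (v' < y)" "u' \<noteq> x" using xy by (auto simp: corr_def)
    have "v \<le> v'" if "x < u'"
      using umin[OF m that] matchingD[OF M m uv(1)] by (simp add: not_less[symmetric])
    then show "(x < u') = (c < v') \<and> (u' < x) = (v' < c)"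
      using pos' that by (cases "x < u'") auto
  qed
  obtain c where c: "x < c" "c < u" "poly p u - poly p x = (u - x) * poly (pderiv p) c"
    using poly_mvt[OF uv(2)] by metis
  have "0 < poly (pderiv p) c"
    using d[OF cy[of c]] d[OF xy(1)] pos c unfolding ssign_def by auto
  then have "0 < (u - x) * poly (pderiv p) c" using uv(2) by simp
  then have "0 < poly p u" using c(3) pos by linarith
  then have qv: "0 < poly q v" using pt[OF uv(1)] by (simp add: ssign_def)
  show ?thesis
  proof (cases "0 < poly q y")
    case True
    then show ?thesis using xy by auto
  next
    case False
    \<comment> \<open>Half of the value at \<open>v\<close> is attained strictly before
      \<open>v\<close>, hence still inside the gap.\<close>
    then have "poly (q - [:poly q v / 2:]) y < 0" "0 < poly (q - [:poly q v / 2:]) v" using qv by auto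
    then obtain y' where "y < y'" "y' < v" "poly (q - [:poly q v / 2:]) y' = 0" using poly_ivt yv by blast
    then show ?thesis using cx[of y'] qv by auto
  qed
qed

definition refl_pairs :: "('a::linordered_field \<times> 'b::linordered_field) set \<Rightarrow> ('a \<times> 'b) set" where
  "refl_pairs M = (\<lambda>(u, v). (- u, - v)) ` M"

lemma refl_pairs_iff [simp]: "(u, v) \<in> refl_pairs M \<longleftrightarrow> (- u, - v) \<in> M"
  by (force simp: refl_pairs_def image_iff)

lemma matching_refl: "matching M \<Longrightarrow> matching (refl_pairs M)"
  unfolding matching_def by (auto simp: refl_pairs_def)

lemma corr_refl: "corr (refl_pairs M) x y \<longleftrightarrow> corr M (- x) (- y)"
  unfolding corr_def by (auto, (metis minus_less_iff less_minus_iff minus_minus)+)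

text \<open>Reflecting the argument and the value together keeps the sign of the derivative. It
  turns statements on positive values to the right into statements on negative values to the
  left.\<close>

definition refl_poly :: "'a::linordered_field poly \<Rightarrow> 'a poly" where
  "refl_poly p = - pcompose p [:0, - 1:]"

lemma poly_refl_poly [simp]: "poly (refl_poly p) x = - poly p (- x)"
  by (simp add: refl_poly_def poly_pcompose)

lemma poly_pderiv_refl_poly [simp]: "poly (pderiv (refl_poly p)) x = poly (pderiv p) (- x)"
  by (simp add: refl_poly_def pderiv_minus pderiv_pcompose pderiv_pCons poly_pcompose)

lemma negative_value_transfer:
  fixes p :: "'a::poly_ivt_field poly" and q :: "'b::poly_ivt_field poly"
  assumes M: "matching M" and d: "\<And>x y. corr M x y \<Longrightarrow> ssign (poly (pderiv p) x) (poly (pderiv q) y)"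
    and pt: "\<And>u v. (u, v) \<in> M \<Longrightarrow> ssign (poly p u) (poly q v)"
    and xy: "corr M x y" "x \<notin> Domain M" and pos: "0 < poly (pderiv p) x" "poly p x < 0"
  shows "\<exists>y'. corr M x y' \<and> y' \<le> y \<and> poly q y' < 0"
proof -
  have "\<exists>y'. corr (refl_pairs M) (- x) y' \<and> - y \<le> y' \<and> 0 < poly (refl_poly q) y'"
  proof (rule positive_value_transfer[where p = "refl_poly p"])
    show "matching (refl_pairs M)" by (rule matching_refl[OF M])
    show "corr (refl_pairs M) x y \<Longrightarrow> ssign (poly (pderiv (refl_poly p)) x) (poly (pderiv (refl_poly q)) y)" for x y
      using d by (simp add: corr_refl)
    show "(u, v) \<in> refl_pairs M \<Longrightarrow> ssign (poly (refl_poly p) u) (poly (refl_poly q) v)" for u v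
      using pt[of "- u" "- v"] by (simp add: ssign_def) 
    show "corr (refl_pairs M) (- x) (- y)" using xy by (simp add: corr_refl)
    show "- x \<notin> Domain (refl_pairs M)" using xy(2) by (auto simp: Domain_iff)
  qed (use pos in auto)
  then obtain y' where "corr M x (- y')" "- y \<le> y'" "poly q (- y') < 0" by (auto simp: corr_refl)
  then show ?thesis by (intro exI[of _ "- y'"]) (auto simp: minus_le_iff)
qed

lemma left_gap:
  fixes x :: "'a::linordered_field" and M :: "('a \<times> 'b::linordered_field) set"
  assumes "finite M" "x \<notin> Domain M" "corr M x y"
  obtains m where "m < x" "\<And>c. m < c \<Longrightarrow> c \<le> x \<Longrightarrow> corr M c y"
proof -
  have "finite (refl_pairs M)" "- x \<notin> Domain (refl_pairs M)" "corr (refl_pairs M) (- x) (- y)"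
    using assms by (auto simp: corr_refl Domain_iff) (auto simp: refl_pairs_def)
  then obtain m where m: "- x < m" "\<And>c. - x \<le> c \<Longrightarrow> c < m \<Longrightarrow> corr (refl_pairs M) c (- y)"
    using right_gap by metis
  have "corr M c y" if "- m < c" "c \<le> x" for c using m(2)[of "- c"] that by (simp add: corr_refl)
  then show ?thesis using that[of "- m"] m(1) by simp
qed

lemma Domain_corr: "matching M \<Longrightarrow> corr M x y \<Longrightarrow> x \<in> Domain M \<longleftrightarrow> y \<in> Range M"
  by (auto simp: Domain_iff Range_iff) (metis corrD linorder_neq_iff)+

text \<open>If \<open>q\<close> were not positive at \<open>y\<close>, it would have a root
  \<open>v\<close> in the gap at or beyond \<open>y\<close>, and a negative value of
  \<open>q\<close> transferred back would give a root \<open>u\<close> of \<open>p\<close> in the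
  gap strictly before \<open>x\<close>. These roots correspond, so \<open>new\<close> demands
  \<open>v < y\<close>, a contradiction.\<close>

lemma sign_transfer_pos:
  fixes p :: "'a::poly_ivt_field poly" and q :: "'b::poly_ivt_field poly"
  assumes M: "matching M" and d: "\<And>x y. corr M x y \<Longrightarrow> ssign (poly (pderiv p) x) (poly (pderiv q) y)"
    and pt: "\<And>u v. (u, v) \<in> M \<Longrightarrow> ssign (poly p u) (poly q v)"
    and xy: "corr M x y" "x \<notin> Domain M"
    and new: "\<And>u v. poly p u = 0 \<Longrightarrow> poly q v = 0 \<Longrightarrow> corr M u v \<Longrightarrow> (x < u \<longleftrightarrow> y < v) \<and> (u < x \<longleftrightarrow> v < y)"
    and pos: "0 < poly (pderiv p) x" "0 < poly p x"
  shows "0 < poly q y"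
proof (rule ccontr)
  assume "\<not> 0 < poly q y"
  then have qy: "poly q y \<le> 0" by simp
  have finM: "finite M" using M by (simp add: matching_def)
  have yR: "y \<notin> Range M" using Domain_corr[OF M xy(1)] xy(2) by simp
  have q'pos: "0 < poly (pderiv q) c" if "corr M x c" for c using d[OF that] pos by (simp add: ssign_def)
  obtain y' where y': "corr M x y'" "y \<le> y'" "0 < poly q y'"
    using positive_value_transfer[of M p q x y] M d pt xy pos by blast
  then obtain v where v: "y \<le> v" "v \<le> y'" "poly q v = 0"
    using poly_ivt_le[of y y' q] qy by (metis mult_nonpos_nonneg order_less_imp_le)
  have xv: "corr M x v"
    using corr_between[of "M\<inverse>" y x y' v] xy(1) y'(1) v by (simp add: corr_converse)
  \<comment> \<open>The transfer back needs a strictly negative value. If \<open>q\<close> vanishes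
    at \<open>y\<close>, it is negative slightly to the left, because it increases there.\<close>
  obtain y0 where y0: "corr M x y0" "poly q y0 < 0" "y0 \<le> y"
  proof (cases "poly q y < 0")
    case True
    then show ?thesis using that xy by blast
  next
    case False
    then have qy0: "poly q y = 0" using qy by simp
    obtain m where m: "m < y" "\<And>c. m < c \<Longrightarrow> c \<le> y \<Longrightarrow> corr (M\<inverse>) c x"
      using left_gap[of "M\<inverse>" y x] finM yR xy(1) by (auto simp: corr_converse)
    obtain c where c: "m < c" "c < y" using dense[OF m(1)] by blast
    obtain e where e: "c < e" "e < y" "poly q y - poly q c = (y - c) * poly (pderiv q) e"
      using poly_mvt[OF c(2)] by metis
    have "corr M x e" "corr M x c" using m(2)[of e] m(2)[of c] c e by (auto simp: corr_converse)
    then have "0 < (y - c) * poly (pderiv q) e" using q'pos c by simp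
    then have "poly q c < 0" using e qy0 by simp
    then show ?thesis using that \<open>corr M x c\<close> c by auto
  qed
  have "\<exists>x''. corr (M\<inverse>) y0 x'' \<and> x'' \<le> x \<and> poly p x'' < 0"
  proof (rule negative_value_transfer[where p = q])
    show "matching (M\<inverse>)" by (rule matching_converse[OF M])
    show "corr (M\<inverse>) a b \<Longrightarrow> ssign (poly (pderiv q) a) (poly (pderiv p) b)" for a b
      using d[of b a] by (simp add: corr_converse ssign_def)
    show "(u, v) \<in> M\<inverse> \<Longrightarrow> ssign (poly q u) (poly p v)" for u v using pt[of v u] by (simp add: ssign_def)
    show "corr (M\<inverse>) y0 x" using y0 by (simp add: corr_converse)
    show "y0 \<notin> Domain (M\<inverse>)" using Domain_corr[OF M y0(1)] xy(2) by simp
  qed (use q'pos[OF y0(1)] y0 in auto)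
  then obtain x'' where x'': "corr M x'' y0" "x'' \<le> x" "poly p x'' < 0" by (auto simp: corr_converse)
  then have "x'' < x" using pos by (metis order.asym order_le_less)
  then obtain u where u: "x'' < u" "u < x" "poly p u = 0" using poly_ivt pos(2) x''(3) by blast
  have "corr M u y0" using corr_between[OF x''(1) y0(1)] u by simp
  then have "corr M u v" using y0(1) xv unfolding corr_def by simp
  then show False using new[OF u(3) v(3)] u v by auto
qed

lemma sign_transfer_incr:
  fixes p :: "'a::poly_ivt_field poly" and q :: "'b::poly_ivt_field poly"
  assumes M: "matching M" and d: "\<And>x y. corr M x y \<Longrightarrow> ssign (poly (pderiv p) x) (poly (pderiv q) y)"
    and pt: "\<And>u v. (u, v) \<in> M \<Longrightarrow> ssign (poly p u) (poly q v)"
    and xy: "corr M x y" "x \<notin> Domain M"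
    and new: "\<And>u v. poly p u = 0 \<Longrightarrow> poly q v = 0 \<Longrightarrow> corr M u v \<Longrightarrow> (x < u \<longleftrightarrow> y < v) \<and> (u < x \<longleftrightarrow> v < y)"
    and pos: "0 < poly (pderiv p) x"
  shows "0 < poly p x \<longleftrightarrow> 0 < poly q y"
proof
  assume "0 < poly p x"
  show "0 < poly q y" by (rule sign_transfer_pos[of M p q x y]; fact)
next
  assume q: "0 < poly q y"
  show "0 < poly p x"
  proof (rule sign_transfer_pos[where p = q and M = "M\<inverse>" and x = y])
    show "matching (M\<inverse>)" by (rule matching_converse[OF M])
    show "corr (M\<inverse>) a b \<Longrightarrow> ssign (poly (pderiv q) a) (poly (pderiv p) b)" for a b
      using d[of b a] by (simp add: corr_converse ssign_def)
    show "(u, v) \<in> M\<inverse> \<Longrightarrow> ssign (poly q u) (poly p v)" for u v using pt[of v u] by (simp add: ssign_def)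
    show "corr (M\<inverse>) y x" using xy by (simp add: corr_converse)
    show "y \<notin> Domain (M\<inverse>)" using Domain_corr[OF M xy(1)] xy(2) by simp
    show "(y < u) = (x < v) \<and> (u < y) = (v < x)" if "poly q u = 0" "poly p v = 0" "corr (M\<inverse>) u v" for u v
      using new[OF that(2,1)] that(3) by (simp add: corr_converse)
  qed (use d[OF xy(1)] pos q in \<open>auto simp: ssign_def\<close>)
qed

lemma sign_transfer:
  fixes p :: "'a::poly_ivt_field poly" and q :: "'b::poly_ivt_field poly"
  assumes M: "matching M" and d: "\<And>x y. corr M x y \<Longrightarrow> ssign (poly (pderiv p) x) (poly (pderiv q) y)"
    and pt: "\<And>u v. (u, v) \<in> M \<Longrightarrow> ssign (poly p u) (poly q v)"
    and xy: "corr M x y" "x \<notin> Domain M"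
    and new: "\<And>u v. poly p u = 0 \<Longrightarrow> poly q v = 0 \<Longrightarrow> corr M u v \<Longrightarrow> (x < u \<longleftrightarrow> y < v) \<and> (u < x \<longleftrightarrow> v < y)"
    and nz: "poly (pderiv p) x \<noteq> 0"
  shows "ssign (poly p x) (poly q y)"
proof -
  have incr: "ssign (poly p x) (poly q y)" 
    if d: "\<And>x y. corr M x y \<Longrightarrow> ssign (poly (pderiv p) x) (poly (pderiv q) y)"
      and pt: "\<And>u v. (u, v) \<in> M \<Longrightarrow> ssign (poly p u) (poly q v)"
      and new: "\<And>u v. poly p u = 0 \<Longrightarrow> poly q v = 0 \<Longrightarrow> corr M u v \<Longrightarrow> (x < u \<longleftrightarrow> y < v) \<and> (u < x \<longleftrightarrow> v < y)"
      and pos: "0 < poly (pderiv p) x" for p :: "'a poly" and q :: "'b poly"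
  proof -
    have "0 < poly (refl_poly p) (- x) \<longleftrightarrow> 0 < poly (refl_poly q) (- y)"
    proof (rule sign_transfer_incr[where M = "refl_pairs M"])
      show "matching (refl_pairs M)" by (rule matching_refl[OF M])
      show "corr (refl_pairs M) x y \<Longrightarrow> ssign (poly (pderiv (refl_poly p)) x) (poly (pderiv (refl_poly q)) y)" for x y
        using d by (simp add: corr_refl)
      show "(u, v) \<in> refl_pairs M \<Longrightarrow> ssign (poly (refl_poly p) u) (poly (refl_poly q) v)" for u v
        using pt[of "- u" "- v"] by (simp add: ssign_def) 
      show "corr (refl_pairs M) (- x) (- y)" using xy by (simp add: corr_refl)
      show "- x \<notin> Domain (refl_pairs M)" using xy(2) by (auto simp: Domain_iff)
      show "(- x < u) = (- y < v) \<and> (u < - x) = (v < - y)"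
        if "poly (refl_poly p) u = 0" "poly (refl_poly q) v = 0" "corr (refl_pairs M) u v" for u v
        using new[of "- u" "- v"] that by (auto simp: corr_refl minus_less_iff less_minus_iff)
    qed (use pos in auto)
    moreover have "0 < poly p x \<longleftrightarrow> 0 < poly q y" by (rule sign_transfer_incr[of M p q x y]; fact)
    ultimately show ?thesis by (simp add: ssign_def)
  qed
  show ?thesis
  proof (cases "0 < poly (pderiv p) x")
    case True
    show ?thesis by (rule incr; fact)
  next
    case False
    have "ssign (poly (- p) x) (poly (- q) y)"
    proof (rule incr)
      show "corr M x y \<Longrightarrow> ssign (poly (pderiv (- p)) x) (poly (pderiv (- q)) y)" for x y
        using d[of x y] by (simp add: pderiv_minus ssign_def)
      show "(u, v) \<in> M \<Longrightarrow> ssign (poly (- p) u) (poly (- q) v)" for u v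
        using pt[of u v] by (simp add: ssign_def)
      show "poly (- p) u = 0 \<Longrightarrow> poly (- q) v = 0 \<Longrightarrow> corr M u v \<Longrightarrow> (x < u) = (y < v) \<and> (u < x) = (v < y)" for u v
        using new by simp
      show "0 < poly (pderiv (- p)) x" using False nz by (simp add: pderiv_minus)
    qed
    then show ?thesis by (simp add: ssign_def)
  qed
qed

text \<open>The roots of the derivative are sample points, so by Rolle's theorem a gap contains at
  most one root of \<open>p\<close>, and likewise of \<open>q\<close>. The pairs \<open>N\<close> of
  roots in corresponding positions become the new sample points.\<close>

lemma tabled_extend:
  fixes p :: "'a::poly_ivt_field poly" and q :: "'b::poly_ivt_field poly"
  assumes t: "tabled G M" and dG: "(pderiv p, pderiv q) \<in> G" and nz: "pderiv p \<noteq> 0" "pderiv q \<noteq> 0"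
    and pt: "\<And>u v. (u, v) \<in> M \<Longrightarrow> ssign (poly p u) (poly q v)"
  shows "\<exists>M'. tabled (insert (p, q) G) M'"
proof -
  have M: "matching M" and s: "\<And>x y f g. corr M x y \<Longrightarrow> (f, g) \<in> G \<Longrightarrow> ssign (poly f x) (poly g y)"
    and rt: "\<And>u v. (u, v) \<in> M \<Longrightarrow> \<exists>p q. (p, q) \<in> G \<and> p \<noteq> 0 \<and> q \<noteq> 0 \<and> poly p u = 0 \<and> poly q v = 0"
    using t unfolding tabled_def by simp_all
  note d = s[OF _ dG]
  have p0: "p \<noteq> 0" "q \<noteq> 0" using nz by auto
  define N where "N = {(u, v). poly p u = 0 \<and> poly q v = 0 \<and> corr M u v}"
  have "N \<subseteq> {u. poly p u = 0} \<times> {v. poly q v = 0}" by (auto simp: N_def)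
  then have finN: "finite N" by (rule finite_subset) (intro finite_cartesian_product poly_roots_finite p0)
  have inj: "u = u'" if h: "poly p u = 0" "poly p u' = 0" "corr M u v" "corr M u' v" "u \<le> u'" for u u' v
  proof (rule ccontr)
    assume "u \<noteq> u'"
    then have "u < u'" using that by simp
    then obtain c where c: "u < c" "c < u'" "poly (pderiv p) c = 0" using poly_rolle h(1,2) by blast
    then obtain b where "(c, b) \<in> M" using root_in_Domain[OF M d nz(1)] by blast
    then show False using corrD[OF h(3)] corrD[OF h(4)] c by (metis order.asym)
  qed
  have inj': "u = u'" if "poly p u = 0" "poly p u' = 0" "corr M u v" "corr M u' v" for u u' v
    using inj[of u u' v] inj[of u' u v] that by (metis linear)
  have sep: "v < v'" if uv: "corr M u v" "corr M u' v'" "u < u'" "\<not> corr M u v'" for u u' v v'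
  proof -
    obtain a b where ab: "(a, b) \<in> M" "\<not> ((u < a) = (v' < b) \<and> (a < u) = (b < v'))"
      using uv(4) unfolding corr_def by auto
    then have "(u < a) = (v < b) \<and> (a < u) = (b < v)" "(u' < a) = (v' < b) \<and> (a < u') = (b < v')"
      using uv(1,2) unfolding corr_def by auto
    then show ?thesis using ab(2) uv(3) by (metis linorder_neqE order.strict_trans)
  qed
  have NN: "(u < u') = (v < v')" if "(u, v) \<in> N" "(u', v') \<in> N" for u v u' v'
  proof -
    have *: "v < v'" if "(u, v) \<in> N" "(u', v') \<in> N" "u < u'" for u v u' v'
    proof (rule sep)
      show "\<not> corr M u v'" using inj'[of u u' v'] that by (auto simp: N_def)
    qed (use that in \<open>auto simp: N_def\<close>)
    have e: "v = v'" if h: "(u, v) \<in> N" "(u, v') \<in> N" for u v v'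
    proof (rule ccontr)
      assume "v \<noteq> v'"
      then obtain w w' where w: "w < w'" "(u, w) \<in> N" "(u, w') \<in> N" using h by (metis linorder_neqE)
      then obtain c where c: "w < c" "c < w'" "poly (pderiv q) c = 0" using poly_rolle[of w w' q] by (auto simp: N_def)
      have "corr (M\<inverse>) a b \<Longrightarrow> ssign (poly (pderiv q) a) (poly (pderiv p) b)" for a b
        using d[of b a] by (simp add: corr_converse ssign_def)
      then have "c \<in> Domain (M\<inverse>)" using root_in_Domain[OF matching_converse[OF M] _ nz(2) c(3)] by blast
      then obtain b where "(b, c) \<in> M" by auto
      moreover have "corr M u w" "corr M u w'" using w(2,3) by (auto simp: N_def)
      ultimately show False using corrD[of M u w b c] corrD[of M u w' b c] c by auto
    qed
    show ?thesis
    proof (cases rule: linorder_cases[of u u'])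
      case equal
      then show ?thesis using e that by auto
    qed (use *[OF that] *[OF that(2,1)] in auto)
  qed
  define M' where "M' = M \<union> N"
  have M': "matching M'"
    unfolding matching_def
  proof (intro conjI allI impI)
    show "finite M'" using M finN by (simp add: M'_def matching_def)
    fix u v u' v' assume "(u, v) \<in> M'" "(u', v') \<in> M'"
    then consider "(u, v) \<in> M" "(u', v') \<in> M" | "(u, v) \<in> N" "(u', v') \<in> N"
      | "(u, v) \<in> M" "corr M u' v'" | "corr M u v" "(u', v') \<in> M"
      unfolding M'_def N_def by blast
    then show "(u < u') = (v < v')"
      by cases (use M NN in \<open>auto simp: matching_def corr_def\<close>)
  qed
  have "tabled (insert (p, q) G) M'"
    unfolding tabled_def
  proof (intro conjI allI impI M')
    fix x y f g assume xy': "corr M' x y" and fg: "(f, g) \<in> insert (p, q) G"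
    then have xy: "corr M x y" by (auto simp: corr_def M'_def)
    have "ssign (poly p x) (poly q y)"
    proof (cases "x \<in> Domain M")
      case True
      then obtain v where "(x, v) \<in> M" by auto
      moreover from this have "v = y" using corrD[OF xy] by (metis linorder_neq_iff)
      ultimately show ?thesis using pt by blast
    next
      case False
      show ?thesis
      proof (rule sign_transfer[of M p q x y])
        show "matching M" "corr M x y" "x \<notin> Domain M" by fact+
        show "corr M x y \<Longrightarrow> ssign (poly (pderiv p) x) (poly (pderiv q) y)" for x y by (rule d)
        show "(u, v) \<in> M \<Longrightarrow> ssign (poly p u) (poly q v)" for u v by (rule pt)
        show "(x < u) = (y < v) \<and> (u < x) = (v < y)" if "poly p u = 0" "poly q v = 0" "corr M u v" for u v
          using xy' that unfolding corr_def M'_def N_def by auto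
        show "poly (pderiv p) x \<noteq> 0" using root_in_Domain[OF M d nz(1)] False by blast
      qed
    qed
    then show "ssign (poly f x) (poly g y)" using s[OF xy] fg by auto
  next
    fix u v assume "(u, v) \<in> M'"
    then show "\<exists>f g. (f, g) \<in> insert (p, q) G \<and> f \<noteq> 0 \<and> g \<noteq> 0 \<and> poly f u = 0 \<and> poly g v = 0"
      using rt[of u v] p0 unfolding M'_def N_def by auto
  qed
  then show ?thesis ..
qed

section \<open>Elimination of one variable\<close>

definition ring_map :: "('c::comm_ring_1 \<Rightarrow> 'r::comm_ring_1) \<Rightarrow> bool" where
  "ring_map h \<longleftrightarrow> h 1 = 1 \<and> (\<forall>x y. h (x + y) = h x + h y \<and> h (x * y) = h x * h y)"

lemma ring_map_simps:
  assumes "ring_map h"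
  shows "h 1 = 1" "h (x + y) = h x + h y" "h (x * y) = h x * h y" "h 0 = 0" "h (- x) = - h x"
    "h (x - y) = h x - h y" "h (x ^ n) = h x ^ n" "h (of_nat n) = of_nat n"
proof -
  show a: "h 1 = 1" "h (x + y) = h x + h y" "h (x * y) = h x * h y" for x y
    using assms by (auto simp: ring_map_def)
  show z: "h 0 = 0" using a(2)[of 0 0] by simp
  show m: "h (- x) = - h x" for x using a(2)[of x "- x"] z by (simp add: eq_neg_iff_add_eq_0 add.commute)
  show "h (x - y) = h x - h y" using a(2)[of x "- y"] m by simp
  show "h (x ^ n) = h x ^ n" by (induction n) (auto simp: a)
  show "h (of_nat n) = of_nat n" by (induction n) (auto simp: a z)
qed

lemma ring_map_sum: "ring_map h \<Longrightarrow> h (\<Sum>i\<in>A. f i) = (\<Sum>i\<in>A. h (f i))"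
  by (induction A rule: infinite_finite_induct) (auto simp: ring_map_simps)

lemma map_poly_ring_map:
  assumes "ring_map h"
  shows "map_poly h (p + q) = map_poly h p + map_poly h q" "map_poly h (p - q) = map_poly h p - map_poly h q"
    "map_poly h (p * q) = map_poly h p * map_poly h q" "map_poly h (smult c p) = smult (h c) (map_poly h p)"
    "map_poly h (Polynomial.monom c n) = Polynomial.monom (h c) n"
  by (intro poly_eqI; simp add: coeff_map_poly ring_map_simps[OF assms] coeff_mult ring_map_sum[OF assms])+

definition subring_set :: "'c::comm_ring_1 set \<Rightarrow> bool" where
  "subring_set K \<longleftrightarrow> 1 \<in> K \<and> (\<forall>x\<in>K. - x \<in> K) \<and> (\<forall>x\<in>K. \<forall>y\<in>K. x + y \<in> K \<and> x * y \<in> K)"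

lemma subring_setD:
  assumes "subring_set K"
  shows "0 \<in> K" "1 \<in> K" "x \<in> K \<Longrightarrow> - x \<in> K" "x \<in> K \<Longrightarrow> y \<in> K \<Longrightarrow> x + y \<in> K"
    "x \<in> K \<Longrightarrow> y \<in> K \<Longrightarrow> x * y \<in> K" "x \<in> K \<Longrightarrow> y \<in> K \<Longrightarrow> x - y \<in> K" "of_nat n \<in> K"
proof -
  show a: "1 \<in> K" "x \<in> K \<Longrightarrow> - x \<in> K" "x \<in> K \<Longrightarrow> y \<in> K \<Longrightarrow> x + y \<in> K"
    "x \<in> K \<Longrightarrow> y \<in> K \<Longrightarrow> x * y \<in> K" for x y
    using assms by (auto simp: subring_set_def)
  show z: "0 \<in> K" using a(3)[OF a(1) a(2)[OF a(1)]] by simp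
  show "x \<in> K \<Longrightarrow> y \<in> K \<Longrightarrow> x - y \<in> K" using a(3)[of x "- y"] a(2) by simp
  show "of_nat n \<in> K" by (induction n) (auto simp: a z)
qed

definition coeffs_in :: "'c::comm_ring_1 set \<Rightarrow> 'c poly \<Rightarrow> bool" where
  "coeffs_in K p \<longleftrightarrow> (\<forall>i. coeff p i \<in> K)"

lemma subring_set_sum: "subring_set K \<Longrightarrow> (\<And>i. i \<in> A \<Longrightarrow> f i \<in> K) \<Longrightarrow> (\<Sum>i\<in>A. f i) \<in> K"
  by (induction A rule: infinite_finite_induct) (auto simp: subring_setD)

lemma coeffs_in_ring:
  assumes "subring_set K"
  shows "coeffs_in K p \<Longrightarrow> coeffs_in K q \<Longrightarrow> coeffs_in K (p + q)"
    "coeffs_in K p \<Longrightarrow> coeffs_in K q \<Longrightarrow> coeffs_in K (p - q)"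
    "coeffs_in K p \<Longrightarrow> coeffs_in K q \<Longrightarrow> coeffs_in K (p * q)"
    "c \<in> K \<Longrightarrow> coeffs_in K p \<Longrightarrow> coeffs_in K (smult c p)" "c \<in> K \<Longrightarrow> coeffs_in K (Polynomial.monom c n)"
    "coeffs_in K 0"
  unfolding coeffs_in_def by (auto simp: subring_setD[OF assms] coeff_mult intro!: subring_set_sum[OF assms])

lemma degree_less_if_lead_cancels:
  assumes "degree f \<le> n" "coeff f n = 0" "0 < n" shows "degree f < n"
  using assms by (metis degree_0 leading_coeff_0_iff order_le_less)

section \<open>Operations that lower the degree, and families closed under them\<close>

text \<open>The replacement for \<open>f\<close> when a ring map sends its leading coefficient to
  zero.\<close>

definition truncated :: "'c::comm_ring_1 poly \<Rightarrow> 'c poly" where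
  "truncated f = f - Polynomial.monom (coeff f (degree f)) (degree f)"

lemma truncated_degree: "0 < degree f \<Longrightarrow> degree (truncated f) < degree f"
  unfolding truncated_def by (rule degree_less_if_lead_cancels) (auto intro: degree_diff_le simp: degree_monom_le)

text \<open>The derivative over a commutative ring that may have zero divisors; a ring map into a
  domain of characteristic zero carries it to \<open>pderiv\<close>.\<close>

definition formal_deriv :: "'c::comm_ring_1 poly \<Rightarrow> 'c poly" where
  "formal_deriv f = (\<Sum>i<degree f. Polynomial.monom (of_nat (Suc i) * coeff f (Suc i)) i)"

lemma formal_deriv_degree: "0 < degree f \<Longrightarrow> degree (formal_deriv f) < degree f"
proof -
  assume "0 < degree f"
  have "degree (formal_deriv f) \<le> degree f - 1" unfolding formal_deriv_def
    by (rule degree_sum_le) (auto intro: order_trans[OF degree_monom_le])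
  then show ?thesis using \<open>0 < degree f\<close> by simp
qed

lemma coeff_formal_deriv: "coeff (formal_deriv f) i = of_nat (Suc i) * coeff f (Suc i)"
proof -
  have "coeff (formal_deriv f) i = (\<Sum>j<degree f. if j = i then of_nat (Suc i) * coeff f (Suc i) else 0)"
    unfolding formal_deriv_def by (simp add: coeff_sum if_distrib cong: if_cong)
  then show ?thesis by (auto simp: coeff_eq_0)
qed

lemma map_poly_formal_deriv:
  fixes h :: "'c::comm_ring_1 \<Rightarrow> 'r::{idom,semiring_char_0}"
  assumes "ring_map h" shows "map_poly h (formal_deriv f) = pderiv (map_poly h f)"
  by (rule poly_eqI) (simp add: coeff_map_poly coeff_formal_deriv coeff_pderiv ring_map_simps[OF assms] del: of_nat_Suc)

text \<open>Each step of the division multiplies by the leading coefficient of \<open>g\<close>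
  instead of dividing by it. The remainder is the part that enters the closed family, so its
  coefficients are kept in \<open>K\<close>.\<close>

lemma pseudo_remainder_exists:
  fixes f g :: "'c::comm_ring_1 poly"
  assumes K: "subring_set K" and g: "coeffs_in K g" "0 < degree g" and f: "coeffs_in K f"
  shows "\<exists>k q r. coeffs_in K r \<and> degree r < degree g \<and> smult (lead_coeff g ^ k) f = q * g + r"
  using f
proof (induction "degree f" arbitrary: f rule: less_induct)
  case less
  show ?case
  proof (cases "degree f < degree g")
    case True
    then show ?thesis using less.prems by (intro exI[of _ 0] exI[of _ 0] exI[of _ f]) auto
  next
    case False
    define m where "m = Polynomial.monom (lead_coeff f) (degree f - degree g)"
    define f1 where "f1 = smult (lead_coeff g) f - m * g"
    have lf: "lead_coeff f \<in> K" "lead_coeff g \<in> K" using less.prems g by (auto simp: coeffs_in_def)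
    have "coeffs_in K f1" unfolding f1_def m_def
      by (intro coeffs_in_ring[OF K] lf less.prems g)
    moreover have "degree f1 < degree f"
    proof (rule degree_less_if_lead_cancels)
      have "degree (m * g) \<le> degree f"
        using degree_mult_le[of m g] degree_monom_le[of "lead_coeff f" "degree f - degree g"] False by (simp add: m_def)
      then show "degree f1 \<le> degree f" unfolding f1_def by (intro degree_diff_le degree_smult_le)
      show "coeff f1 (degree f) = 0" using False by (simp add: f1_def m_def coeff_monom_mult)
    qed (use False g in auto)
    ultimately obtain k q r where r: "coeffs_in K r" "degree r < degree g" "smult (lead_coeff g ^ k) f1 = q * g + r"
      using less.hyps by blast
    have "smult (lead_coeff g ^ Suc k) f = smult (lead_coeff g ^ k) f1 + smult (lead_coeff g ^ k) (m * g)"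
      by (simp add: f1_def smult_diff_right mult.commute)
    also have "\<dots> = (q + smult (lead_coeff g ^ k) m) * g + r" by (simp add: r(3) algebra_simps)
    finally show ?thesis using r by blast
  qed
qed

text \<open>Every operation drops the degree below that of both arguments. An element first
  appearing at stage \<open>k + 1\<close> with \<open>k > 0\<close> has an argument that was new one
  stage earlier, so its degree is at most \<open>d - k\<close>. Beyond stage \<open>d + 1\<close>
  nothing new can appear.\<close>

lemma finite_closure:
  fixes deg :: "'a \<Rightarrow> nat" and ops :: "('a \<Rightarrow> 'a \<Rightarrow> 'a) set"
  assumes F: "finite F" "F \<subseteq> K" and ops: "finite ops"
    and K: "\<And>r f g. r \<in> ops \<Longrightarrow> f \<in> K \<Longrightarrow> g \<in> K \<Longrightarrow> 0 < deg f \<Longrightarrow> 0 < deg g \<Longrightarrow> r f g \<in> K"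
    and deg: "\<And>r f g. r \<in> ops \<Longrightarrow> f \<in> K \<Longrightarrow> g \<in> K \<Longrightarrow> 0 < deg f \<Longrightarrow> 0 < deg g \<Longrightarrow> deg (r f g) < deg f \<and> deg (r f g) < deg g"
  shows "\<exists>H. finite H \<and> F \<subseteq> H \<and> H \<subseteq> K \<and> (\<forall>r\<in>ops. \<forall>f\<in>H. \<forall>g\<in>H. 0 < deg f \<longrightarrow> 0 < deg g \<longrightarrow> r f g \<in> H)"
proof -
  define news where "news Y = (\<lambda>(r, f, g). r f g) ` {(r, f, g). r \<in> ops \<and> f \<in> Y \<and> g \<in> Y \<and> 0 < deg f \<and> 0 < deg g}" for Y
  define step where "step Y = Y \<union> news Y" for Y
  define H where "H k = (step ^^ k) F" for k
  have HS: "H (Suc k) = H k \<union> news (H k)" for k by (simp add: H_def step_def)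
  have news: "x \<in> news Y \<longleftrightarrow> (\<exists>r f g. x = r f g \<and> r \<in> ops \<and> f \<in> Y \<and> g \<in> Y \<and> 0 < deg f \<and> 0 < deg g)" for x Y
    by (auto simp: news_def image_iff)
  have H: "finite (H k) \<and> H k \<subseteq> K \<and> F \<subseteq> H k" for k
  proof (induction k)
    case 0
    then show ?case using F by (simp add: H_def)
  next
    case (Suc k)
    have "{(r, f, g). r \<in> ops \<and> f \<in> H k \<and> g \<in> H k \<and> 0 < deg f \<and> 0 < deg g} \<subseteq> ops \<times> H k \<times> H k" by auto
    then have "finite (news (H k))" unfolding news_def using Suc ops
      by (meson finite_SigmaI finite_imageI finite_subset)
    moreover have "news (H k) \<subseteq> K"
    proof
      fix x assume "x \<in> news (H k)"
      then obtain r f g where "x = r f g" "r \<in> ops" "f \<in> H k" "g \<in> H k" "0 < deg f" "0 < deg g"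
        using news by blast
      then show "x \<in> K" using K[of r f g] Suc by blast
    qed
    ultimately show ?case using Suc by (auto simp: HS)
  qed
  obtain d where d: "\<And>f. f \<in> F \<Longrightarrow> deg f \<le> d"
    using F(1) finite_nat_set_iff_bounded_le[of "deg ` F"] by auto
  have new: "deg x + k \<le> d" if "x \<in> H (Suc k)" "x \<notin> H k" for x k
    using that
  proof (induction k arbitrary: x)
    case 0
    then obtain r f g where "x = r f g" "r \<in> ops" "f \<in> F" "g \<in> F" "0 < deg f" "0 < deg g"
      by (auto simp: HS news) (auto simp: H_def)
    moreover from this have "deg (r f g) < deg f" using deg[of r f g] F(2) by blast
    ultimately show ?case using d[of f] by auto
  next
    case (Suc k)
    then obtain r f g where x: "x = r f g" "r \<in> ops" "f \<in> H (Suc k)" "g \<in> H (Suc k)" "0 < deg f" "0 < deg g"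
      using HS[of "Suc k"] news by auto
    have "x \<in> news (H k)" if "f \<in> H k" "g \<in> H k" unfolding news using that x by blast
    then have "\<not> (f \<in> H k \<and> g \<in> H k)" using Suc.prems(2) HS[of k] by blast
    then have "deg f + k \<le> d \<or> deg g + k \<le> d" using Suc.IH x by blast
    moreover have "deg x < deg f \<and> deg x < deg g" unfolding x(1) using x H by (intro deg) auto
    ultimately show ?case by auto
  qed
  have "news (H (Suc d)) \<subseteq> H (Suc d)" using new[of _ "Suc d"] HS[of "Suc d"] by fastforce
  then have "r f g \<in> H (Suc d)" if "r \<in> ops" "f \<in> H (Suc d)" "g \<in> H (Suc d)" "0 < deg f" "0 < deg g" for r f g
    using news[of "r f g" "H (Suc d)"] that by blast
  then show ?thesis using H[of "Suc d"] by (intro exI[of _ "H (Suc d)"]) simp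
qed

text \<open>At a root of \<open>g\<close> the pseudo-division says that the remainder is
  \<open>f\<close> times a power of the leading coefficient, which has the same nonzero sign on both
  sides.\<close>

lemma root_reduction_sign:
  fixes a :: "'c::comm_ring_1 \<Rightarrow> 'a::linordered_field" and b :: "'c \<Rightarrow> 'b::linordered_field"
  assumes ab: "ring_map a" "ring_map b" and r: "smult (lead_coeff g ^ k) f = q * g + r"
    and lc: "ssign (a (lead_coeff g)) (b (lead_coeff g))" "a (lead_coeff g) \<noteq> 0"
    and z: "poly (map_poly a g) u = 0" "poly (map_poly b g) v = 0"
    and s: "ssign (poly (map_poly a r) u) (poly (map_poly b r) v)"
  shows "ssign (poly (map_poly a f) u) (poly (map_poly b f) v)"
proof -
  have "a (lead_coeff g) ^ k * poly (map_poly a f) u = poly (map_poly a r) u"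
    using arg_cong[OF r, of "\<lambda>p. poly (map_poly a p) u"] z by (simp add: map_poly_ring_map[OF ab(1)] ring_map_simps[OF ab(1)])
  moreover have "b (lead_coeff g) ^ k * poly (map_poly b f) v = poly (map_poly b r) v"
    using arg_cong[OF r, of "\<lambda>p. poly (map_poly b p) v"] z by (simp add: map_poly_ring_map[OF ab(2)] ring_map_simps[OF ab(2)])
  ultimately have "ssign (a (lead_coeff g) ^ k * poly (map_poly a f) u) (b (lead_coeff g) ^ k * poly (map_poly b f) v)"
    using s by simp
  then show ?thesis by (rule ssign_cancel[OF _ ssign_power[OF lc(1)]]) (use lc in simp)
qed

text \<open>The family is built up by degree: when a member \<open>f\<close> of top degree is added,
  its derivative, its truncation and its remainders are already in the table. Sample points are
  roots of earlier members, and the remainders modulo these give the signs of \<open>f\<close>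
  there.\<close>

lemma tabled_closed_family:
  fixes a :: "'c::comm_ring_1 \<Rightarrow> 'a::poly_ivt_field" and b :: "'c \<Rightarrow> 'b::poly_ivt_field"
  assumes ab: "ring_map a" "ring_map b" and H: "finite H"
    and tr: "\<And>f. f \<in> H \<Longrightarrow> 0 < degree f \<Longrightarrow> truncated f \<in> H"
    and de: "\<And>f. f \<in> H \<Longrightarrow> 0 < degree f \<Longrightarrow> formal_deriv f \<in> H"
    and re: "\<And>f g. f \<in> H \<Longrightarrow> g \<in> H \<Longrightarrow> 0 < degree f \<Longrightarrow> 0 < degree g \<Longrightarrow> degree g \<le> degree f \<Longrightarrow>
      \<exists>k q r. r \<in> H \<and> degree r < degree g \<and> smult (lead_coeff g ^ k) f = q * g + r"
    and sg: "\<And>f. f \<in> H \<Longrightarrow> ssign (a (lead_coeff f)) (b (lead_coeff f))"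
  shows "\<exists>M. tabled ((\<lambda>f. (map_poly a f, map_poly b f)) ` H) M"
proof -
  let ?pr = "\<lambda>f. (map_poly a f, map_poly b f)"
  have trunc_eq: "map_poly a (truncated f) = map_poly a f" "map_poly b (truncated f) = map_poly b f"
    if "f \<in> H" "a (lead_coeff f) = 0" for f
    using that ssign_zero[OF sg[OF that(1)]]
    by (simp_all add: truncated_def map_poly_ring_map[OF ab(1)] map_poly_ring_map[OF ab(2)])
  \<comment> \<open>Repeated truncation leads to a member with the same images whose leading
    coefficient survives, as pseudo-division requires. A constant cannot be reached, because the
    image of \<open>g\<close> is nonzero and has a root.\<close>
  have norm: "\<exists>g'\<in>G. 0 < degree g' \<and> ?pr g' = ?pr g \<and> a (lead_coeff g') \<noteq> 0"
    if G: "G \<subseteq> H" "\<And>f. f \<in> G \<Longrightarrow> 0 < degree f \<Longrightarrow> truncated f \<in> G"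
      and g: "g \<in> G" "map_poly a g \<noteq> 0" "poly (map_poly a g) u = 0" for G g u
    using g
  proof (induction "degree g" arbitrary: g rule: less_induct)
    case less
    have "0 < degree g"
    proof (rule ccontr)
      assume "\<not> 0 < degree g"
      then obtain c where "g = [:c:]" by (auto elim: degree_eq_zeroE)
      then show False using less.prems by (auto simp: map_poly_pCons ring_map_simps[OF ab(1)])
    qed
    show ?case
    proof (cases "a (lead_coeff g) = 0")
      case False
      then show ?thesis using less.prems \<open>0 < degree g\<close> by blast
    next
      case True
      then have e: "?pr (truncated g) = ?pr g" using trunc_eq[of g] less.prems G by auto
      then have "map_poly a (truncated g) \<noteq> 0" "poly (map_poly a (truncated g)) u = 0" using less.prems by auto
      then show ?thesis using less.hyps[OF truncated_degree[OF \<open>0 < degree g\<close>] G(2)[OF less.prems(1) \<open>0 < degree g\<close>]] e by simp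
    qed
  qed
  have main: "\<exists>M. tabled (?pr ` G) M" if "G \<subseteq> H" "\<And>f g. f \<in> G \<Longrightarrow> g \<in> H \<Longrightarrow> degree g < degree f \<Longrightarrow> g \<in> G" for G
    using finite_subset[OF that(1) H] that
  proof (induction "card G" arbitrary: G)
    case 0
    then have "G = {}" by simp
    then show ?case by (intro exI[of _ "{}"]) (auto simp: tabled_def matching_def)
  next
    case (Suc n)
    then have "G \<noteq> {}" by auto
    then have "Max (degree ` G) \<in> degree ` G" using Suc.prems(1) by (intro Max_in) auto
    then obtain f where f0: "f \<in> G" "degree f = Max (degree ` G)" by auto
    have f: "f \<in> G" "\<And>g. g \<in> G \<Longrightarrow> degree g \<le> degree f"
      using f0 Suc.prems(1) by (auto intro!: Max_ge)
    define G' where "G' = G - {f}"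
    have G': "G = insert f G'" using f by (auto simp: G'_def)
    have low: "g \<in> G'" if "g \<in> H" "degree g < degree f" for g
      using Suc.prems(3)[OF f(1) that] that by (auto simp: G'_def)
    have "\<exists>M. tabled (?pr ` G') M"
    proof (rule Suc.hyps(1))
      show "n = card G'" using Suc.hyps(2) Suc.prems(1) f by (simp add: G'_def)
      show "g \<in> G'" if "h \<in> G'" "g \<in> H" "degree g < degree h" for h g
        using low[of g] f(2)[of h] that by (simp add: G'_def)
    qed (use Suc.prems in \<open>auto simp: G'_def\<close>)
    then obtain M where M: "tabled (?pr ` G') M" ..
    have M': "matching M" "\<And>x y p q. corr M x y \<Longrightarrow> (p, q) \<in> ?pr ` G' \<Longrightarrow> ssign (poly p x) (poly q y)"
      "\<And>u v. (u, v) \<in> M \<Longrightarrow> \<exists>p q. (p, q) \<in> ?pr ` G' \<and> p \<noteq> 0 \<and> q \<noteq> 0 \<and> poly p u = 0 \<and> poly q v = 0"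
      using M unfolding tabled_def by simp_all
    have fH: "f \<in> H" using f Suc.prems by auto
    have G'H: "G' \<subseteq> H" using Suc.prems(2) by (auto simp: G'_def)
    show ?case
    proof (cases "degree f = 0")
      case True
      then obtain c where c: "f = [:c:]" by (auto elim: degree_eq_zeroE)
      then have "ssign (a c) (b c)" using sg[OF fH] by simp
      then have cs: "ssign (poly (map_poly a f) x) (poly (map_poly b f) y)" for x y
        by (simp add: c map_poly_pCons ring_map_simps[OF ab(1)] ring_map_simps[OF ab(2)])
      have "tabled (?pr ` G) M" unfolding tabled_def
      proof (intro conjI allI impI M'(1))
        fix x y p q assume "corr M x y" "(p, q) \<in> ?pr ` G"
        then show "ssign (poly p x) (poly q y)" using M'(2)[of x y p q] cs[of x y] unfolding G' by auto
      next
        fix u v assume "(u, v) \<in> M"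
        then obtain p q where "(p, q) \<in> ?pr ` G'" "p \<noteq> 0 \<and> q \<noteq> 0 \<and> poly p u = 0 \<and> poly q v = 0" using M'(3) by blast
        then show "\<exists>p q. (p, q) \<in> ?pr ` G \<and> p \<noteq> 0 \<and> q \<noteq> 0 \<and> poly p u = 0 \<and> poly q v = 0" unfolding G' by blast
      qed
      then show ?thesis ..
    next
      case False
      then have d: "0 < degree f" by simp
      show ?thesis
      proof (cases "a (lead_coeff f) = 0")
        case True
        have "truncated f \<in> G'" by (rule low[OF tr[OF fH d] truncated_degree[OF d]])
        then have "?pr (truncated f) \<in> ?pr ` G'" by (rule imageI)
        then have "?pr f \<in> ?pr ` G'" using trunc_eq[OF fH True] by simp
        then have "?pr ` G = ?pr ` G'" unfolding G' by auto
        then show ?thesis using M by auto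
      next
        case nz: False
        then have nz': "b (lead_coeff f) \<noteq> 0" using ssign_zero[OF sg[OF fH]] by simp
        have "coeff (map_poly a f) (degree f) \<noteq> 0" "coeff (map_poly b f) (degree f) \<noteq> 0"
          using nz nz' by (simp_all add: coeff_map_poly ring_map_simps[OF ab(1)] ring_map_simps[OF ab(2)])
        then have dm: "0 < degree (map_poly a f)" "0 < degree (map_poly b f)"
          by (auto intro!: order_less_le_trans[OF d le_degree])
        have "\<exists>M'. tabled (insert (?pr f) (?pr ` G')) M'"
        proof (rule tabled_extend[OF M])
          have "formal_deriv f \<in> G'" by (rule low[OF de[OF fH d] formal_deriv_degree[OF d]])
          then show "(pderiv (map_poly a f), pderiv (map_poly b f)) \<in> ?pr ` G'"
            by (auto simp flip: map_poly_formal_deriv[OF ab(1)] map_poly_formal_deriv[OF ab(2)])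
          show "pderiv (map_poly a f) \<noteq> 0" "pderiv (map_poly b f) \<noteq> 0"
            using dm by (auto simp: pderiv_eq_0_iff)
          fix u v assume uv: "(u, v) \<in> M"
          then obtain g where g: "g \<in> G'" "map_poly a g \<noteq> 0" "map_poly b g \<noteq> 0"
            "poly (map_poly a g) u = 0" "poly (map_poly b g) v = 0"
            using M'(3)[OF uv] by (elim exE conjE imageE) auto
          have "\<exists>g'\<in>G'. 0 < degree g' \<and> ?pr g' = ?pr g \<and> a (lead_coeff g') \<noteq> 0"
          proof (rule norm[OF G'H _ g(1,2,4)])
            show "truncated h \<in> G'" if "h \<in> G'" "0 < degree h" for h
            proof (rule low)
              show "truncated h \<in> H" using tr[of h] that G'H by auto
              show "degree (truncated h) < degree f"
                using truncated_degree[OF that(2)] f(2)[of h] that by (auto simp: G'_def)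
            qed
          qed
          then obtain g' where g': "g' \<in> G'" "0 < degree g'" "?pr g' = ?pr g" "a (lead_coeff g') \<noteq> 0" by blast
          have "degree g' \<le> degree f" using f(2) g'(1) by (auto simp: G'_def)
          then obtain k q r where r: "r \<in> H" "degree r < degree g'" "smult (lead_coeff g' ^ k) f = q * g' + r"
            using re[OF fH _ d g'(2)] g'(1) G'H by blast
          have "r \<in> G'" using low[OF r(1)] r(2) \<open>degree g' \<le> degree f\<close> by simp
          moreover have "corr M u v" by (rule corr_self[OF M'(1) uv])
          ultimately have rs: "ssign (poly (map_poly a r) u) (poly (map_poly b r) v)"
            by (intro M'(2)) auto
          show "ssign (poly (map_poly a f) u) (poly (map_poly b f) v)"
          proof (rule root_reduction_sign[OF ab r(3) _ g'(4) _ _ rs])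
            show "ssign (a (lead_coeff g')) (b (lead_coeff g'))" using sg g'(1) G'H by blast
          qed (use g'(3) g in auto)
        qed
        then show ?thesis by (simp add: G')
      qed
    qed
  qed
  show ?thesis by (rule main) auto
qed

text \<open>The conditions are the leading coefficients of the closure of \<open>F\<close> under
  truncation, derivative and pseudo-remainder. The closure is formed before any specialisation, so
  one set \<open>S\<close> serves all pairs of ring maps.\<close>

theorem one_variable_elimination:
  fixes F :: "'c::comm_ring_1 poly set"
  assumes K: "subring_set K" and F: "finite F" "\<And>f. f \<in> F \<Longrightarrow> coeffs_in K f"
  shows "\<exists>S. finite S \<and> S \<subseteq> K \<and>
    (\<forall>(a :: 'c \<Rightarrow> 'a::poly_ivt_field) (b :: 'c \<Rightarrow> 'b::poly_ivt_field). ring_map a \<longrightarrow> ring_map b \<longrightarrow>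
      (\<forall>s\<in>S. ssign (a s) (b s)) \<longrightarrow>
      (\<forall>y. \<exists>x. \<forall>f\<in>F. ssign (poly (map_poly a f) x) (poly (map_poly b f) y)))"
proof -
  define rm where "rm f g = (if degree g \<le> degree f then
      (SOME r. \<exists>k q. coeffs_in K r \<and> degree r < degree g \<and> smult (lead_coeff g ^ k) f = q * g + r) else 0)" for f g :: "'c poly"
  have rm: "\<exists>k q. coeffs_in K (rm f g) \<and> degree (rm f g) < degree g \<and> smult (lead_coeff g ^ k) f = q * g + rm f g"
    if "coeffs_in K f" "coeffs_in K g" "0 < degree g" "degree g \<le> degree f" for f g
  proof -
    have "\<exists>r k q. coeffs_in K r \<and> degree r < degree g \<and> smult (lead_coeff g ^ k) f = q * g + r"
      using pseudo_remainder_exists[OF K that(2,3,1)] by blast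
    from someI_ex[OF this] show ?thesis using that(4) unfolding rm_def by auto
  qed
  have dv: "coeffs_in K (formal_deriv f)" if "coeffs_in K f" for f
    using that unfolding coeffs_in_def by (simp add: coeff_formal_deriv subring_setD[OF K] del: of_nat_Suc)
  have tv: "coeffs_in K (truncated f)" if "coeffs_in K f" for f
    unfolding truncated_def using that by (intro coeffs_in_ring[OF K]) (auto simp: coeffs_in_def)
  \<comment> \<open>Unary operations are made binary by acting on the diagonal. Elsewhere, and in
    \<open>rm\<close> when the degrees are in the wrong order, the value is 0, whose degree is below
    that of both arguments as \<open>finite_closure\<close> demands.\<close>
  define ops where "ops = {rm, \<lambda>f g. if f = g then truncated f else 0, \<lambda>f g. if f = g then formal_deriv f else 0}"
  have "\<exists>H. finite H \<and> F \<subseteq> H \<and> H \<subseteq> {p. coeffs_in K p} \<and> (\<forall>r\<in>ops. \<forall>f\<in>H. \<forall>g\<in>H. 0 < degree f \<longrightarrow> 0 < degree g \<longrightarrow> r f g \<in> H)"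
  proof (rule finite_closure)
    show "finite F" "F \<subseteq> {p. coeffs_in K p}" "finite ops" using F by (auto simp: ops_def)
    fix r f g assume *: "r \<in> ops" "f \<in> {p. coeffs_in K p}" "g \<in> {p. coeffs_in K p}" "0 < degree f" "0 < degree g"
    show "r f g \<in> {p. coeffs_in K p}"
      using * rm[of f g] dv[of f] tv[of f] coeffs_in_ring(6)[OF K] unfolding ops_def
      by (auto simp: rm_def[of f g] split: if_splits)
    show "degree (r f g) < degree f \<and> degree (r f g) < degree g"
    proof (cases "r = rm")
      case True
      then show ?thesis using * rm[of f g] by (cases "degree g \<le> degree f") (auto simp: rm_def[of f g])
    next
      case False
      then show ?thesis using * truncated_degree[of f] formal_deriv_degree[of f] unfolding ops_def by auto
    qed
  qed
  then obtain H where H: "finite H" "F \<subseteq> H" "\<And>p. p \<in> H \<Longrightarrow> coeffs_in K p"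
    and cl: "\<And>r f g. r \<in> ops \<Longrightarrow> f \<in> H \<Longrightarrow> g \<in> H \<Longrightarrow> 0 < degree f \<Longrightarrow> 0 < degree g \<Longrightarrow> r f g \<in> H" by blast
  show ?thesis
  proof (rule exI[of _ "lead_coeff ` H"], intro conjI allI impI)
    show "finite (lead_coeff ` H)" using H by simp
    show "lead_coeff ` H \<subseteq> K" using H(3) by (auto simp: coeffs_in_def)
    fix a :: "'c \<Rightarrow> 'a" and b :: "'c \<Rightarrow> 'b" and y :: 'b
    assume ab: "ring_map a" "ring_map b" and s: "\<forall>s\<in>lead_coeff ` H. ssign (a s) (b s)"
    have "\<exists>M. tabled ((\<lambda>f. (map_poly a f, map_poly b f)) ` H) M"
    proof (rule tabled_closed_family[OF ab H(1)])
      show "truncated f \<in> H" if "f \<in> H" "0 < degree f" for f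
        using cl[of "\<lambda>f g. if f = g then truncated f else 0" f f] that by (simp add: ops_def)
      show "formal_deriv f \<in> H" if "f \<in> H" "0 < degree f" for f
        using cl[of "\<lambda>f g. if f = g then formal_deriv f else 0" f f] that by (simp add: ops_def)
      show "\<exists>k q r. r \<in> H \<and> degree r < degree g \<and> smult (lead_coeff g ^ k) f = q * g + r"
        if "f \<in> H" "g \<in> H" "0 < degree f" "0 < degree g" "degree g \<le> degree f" for f g
        using cl[of rm f g] rm[of f g] that H(3) by (auto simp: ops_def)
      show "ssign (a (lead_coeff f)) (b (lead_coeff f))" if "f \<in> H" for f using s that by auto
    qed
    then obtain M where M: "tabled ((\<lambda>f. (map_poly a f, map_poly b f)) ` H) M" ..
    then have M': "matching M" "\<And>x y p q. corr M x y \<Longrightarrow> (p, q) \<in> (\<lambda>f. (map_poly a f, map_poly b f)) ` H \<Longrightarrow> ssign (poly p x) (poly q y)"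
      unfolding tabled_def by simp_all
    then have "matching (M\<inverse>)" using matching_converse by blast
    then obtain x where "corr M x y" using matching_corr_exists[of "M\<inverse>" y] by (auto simp: corr_converse)
    then have "\<forall>f\<in>F. ssign (poly (map_poly a f) x) (poly (map_poly b f) y)"
      using M'(2) H(2) by auto
    then show "\<exists>x. \<forall>f\<in>F. ssign (poly (map_poly a f) x) (poly (map_poly b f) y)" ..
  qed
qed

section \<open>Polynomial functions and elimination\<close>

no_notation fps_nth (infixl \<open>$\<close> 75)

text \<open>The functions in \<open>poly_fun\<close> as a ring type, so that matrices, determinants
  and univariate polynomials over them can be formed.\<close>

typedef (overloaded) ('n::finite) pfun = "poly_fun :: (real^'n \<Rightarrow> real) set" morphisms peval Pfun
  using poly_fun.pf_const by blast

setup_lifting type_definition_pfun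

lift_definition pconst :: "real \<Rightarrow> 'n::finite pfun" is "\<lambda>c x. c" by (rule poly_fun.pf_const)
lift_definition pcoord :: "'n::finite \<Rightarrow> 'n pfun" is "\<lambda>i x. x $ i" by (rule poly_fun.pf_coord)

instantiation pfun :: (finite) comm_ring_1
begin

lift_definition zero_pfun :: "'a pfun" is "\<lambda>x. 0" by (rule poly_fun.pf_const)
lift_definition one_pfun :: "'a pfun" is "\<lambda>x. 1" by (rule poly_fun.pf_const)
lift_definition plus_pfun :: "'a pfun \<Rightarrow> 'a pfun \<Rightarrow> 'a pfun" is "\<lambda>p q x. p x + q x"
  by (rule poly_fun.pf_add)
lift_definition times_pfun :: "'a pfun \<Rightarrow> 'a pfun \<Rightarrow> 'a pfun" is "\<lambda>p q x. p x * q x"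
  by (rule poly_fun.pf_mult)
lift_definition uminus_pfun :: "'a pfun \<Rightarrow> 'a pfun" is "\<lambda>p x. - p x"
proof -
  fix p :: "real^'a \<Rightarrow> real" assume "p \<in> poly_fun"
  from poly_fun.pf_mult[OF poly_fun.pf_const[of "- 1"] this] show "(\<lambda>x. - p x) \<in> poly_fun" by simp
qed
definition minus_pfun :: "'a pfun \<Rightarrow> 'a pfun \<Rightarrow> 'a pfun" where "minus_pfun p q = p + - q"

instance
proof
  fix p q r :: "'a pfun"
  show "p + q + r = p + (q + r)" "p + q = q + p" "0 + p = p" "- p + p = 0"
    "p * q * r = p * (q * r)" "p * q = q * p" "1 * p = p" "(p + q) * r = p * r + q * r"
    by (transfer; simp add: algebra_simps fun_eq_iff)+
  show "p - q = p + - q" by (simp add: minus_pfun_def)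
  have "peval 0 (0 :: real^'a) \<noteq> peval 1 0" by (simp add: zero_pfun.rep_eq one_pfun.rep_eq)
  then show "(0 :: 'a pfun) \<noteq> 1" by auto
qed

end

lemma peval_simps [simp]: "peval 0 x = 0" "peval 1 x = 1" "peval (p + q) x = peval p x + peval q x"
  "peval (p * q) x = peval p x * peval q x" "peval (- p) x = - peval p x"
  "peval (pconst c) x = c" "peval (pcoord i) x = x $ i"
  by (simp_all add: zero_pfun.rep_eq one_pfun.rep_eq plus_pfun.rep_eq times_pfun.rep_eq
      uminus_pfun.rep_eq pconst.rep_eq pcoord.rep_eq)

lemma peval_diff [simp]: "peval (p - q) x = peval p x - peval q x"
  by (simp only: diff_conv_add_uminus peval_simps)

lemma peval_power [simp]: "peval (p ^ n) x = peval p x ^ n"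
  by (induction n) auto

lemma peval_sum [simp]: "peval (\<Sum>i\<in>A. f i) x = (\<Sum>i\<in>A. peval (f i) x)"
  by (induction A rule: infinite_finite_induct) auto

lemma peval_prod [simp]: "peval (\<Prod>i\<in>A. f i) x = (\<Prod>i\<in>A. peval (f i) x)"
  by (induction A rule: infinite_finite_induct) auto

lemma pfun_eqI: "(\<And>x. peval p x = peval q x) \<Longrightarrow> p = q"
  by (metis peval_inject ext)

lemma ring_map_peval: "ring_map (\<lambda>p. peval p x)"
  by (simp add: ring_map_def)

lemma pconst_simps: "pconst 0 = 0" "pconst 1 = 1" "pconst (a + b) = pconst a + pconst b" 
  "pconst (a * b) = pconst a * pconst b" "pconst (- a) = - pconst a"
  by (rule pfun_eqI; simp)+

inductive_set pvars :: "'n set \<Rightarrow> 'n::finite pfun set" for I :: "'n set" where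
  const: "pconst c \<in> pvars I"
| coord: "i \<in> I \<Longrightarrow> pcoord i \<in> pvars I"
| add: "p \<in> pvars I \<Longrightarrow> q \<in> pvars I \<Longrightarrow> p + q \<in> pvars I"
| mult: "p \<in> pvars I \<Longrightarrow> q \<in> pvars I \<Longrightarrow> p * q \<in> pvars I"

lemma subring_pvars: "subring_set (pvars I)"
proof -
  have "- p \<in> pvars I" if "p \<in> pvars I" for p
    using pvars.mult[OF pvars.const[of "- 1"] that] by (simp add: pconst_simps)
  then show ?thesis unfolding subring_set_def
    using pvars.const[of 1 I] by (auto simp: pconst_simps pvars.add pvars.mult)
qed

lemma pvars_UNIV: "p \<in> pvars UNIV"
proof -
  have "f \<in> poly_fun \<Longrightarrow> Pfun f \<in> pvars UNIV" for f :: "real^'a \<Rightarrow> real"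
  proof (induction rule: poly_fun.induct)
    case (pf_const c)
    have "Pfun (\<lambda>x. c) = pconst c" by (simp add: pconst_def)
    then show ?case using pvars.const by metis
  next
    case (pf_coord i)
    have "Pfun (\<lambda>x. x $ i) = pcoord i" by (simp add: pcoord_def)
    then show ?case using pvars.coord by (metis UNIV_I)
  next
    case (pf_add p q)
    have "Pfun (\<lambda>x. p x + q x) = Pfun p + Pfun q"
      by (rule pfun_eqI) (simp add: Pfun_inverse pf_add poly_fun.pf_add)
    then show ?case using pvars.add pf_add by metis
  next
    case (pf_mult p q)
    have "Pfun (\<lambda>x. p x * q x) = Pfun p * Pfun q"
      by (rule pfun_eqI) (simp add: Pfun_inverse pf_mult poly_fun.pf_mult)
    then show ?case using pvars.mult pf_mult by metis
  qed
  from this[OF peval[of p]] show ?thesis by (simp add: peval_inverse)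
qed

lemma pfun_induct [case_names const coord add mult]:
  assumes "\<And>c. P (pconst c)" "\<And>i. P (pcoord i)" "\<And>p q. P p \<Longrightarrow> P q \<Longrightarrow> P (p + q)" "\<And>p q. P p \<Longrightarrow> P q \<Longrightarrow> P (p * q)"
  shows "P p"
  using pvars_UNIV[of p] by (induction rule: pvars.induct) (auto intro: assms)

lemma pvars_local: "p \<in> pvars I \<Longrightarrow> (\<And>i. i \<in> I \<Longrightarrow> x $ i = y $ i) \<Longrightarrow> peval p x = peval p y"
  by (induction rule: pvars.induct) auto

lemma pvars_empty: "p \<in> pvars {} \<Longrightarrow> \<exists>c. p = pconst c"
  by (induction rule: pvars.induct) (auto simp flip: pconst_simps)

lemma ring_map_poly: "ring_map h \<Longrightarrow> h (poly p x) = poly (map_poly h p) (h x)"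
  by (induction p) (auto simp: map_poly_pCons ring_map_simps)

lemma pvars_as_poly:
  assumes "p \<in> pvars (insert i I)"
  shows "\<exists>P. coeffs_in (pvars I) P \<and> p = poly P (pcoord i)"
  using assms
proof (induction rule: pvars.induct)
  case (const c)
  show ?case by (rule exI[of _ "[:pconst c:]"]) (auto simp: coeffs_in_def coeff_pCons pvars.const subring_setD[OF subring_pvars] split: nat.split)
next
  case (coord j)
  show ?case
  proof (cases "j = i")
    case True
    then show ?thesis
      by (intro exI[of _ "[:0, 1:]"]) (auto simp: coeffs_in_def coeff_pCons pvars.const subring_setD[OF subring_pvars] split: nat.split)
  next
    case False
    then show ?thesis using coord
      by (intro exI[of _ "[:pcoord j:]"]) (auto simp: coeffs_in_def coeff_pCons pvars.coord subring_setD[OF subring_pvars] split: nat.split)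
  qed
next
  case (add p q)
  then show ?case by (metis coeffs_in_ring(1)[OF subring_pvars] poly_add)
next
  case (mult p q)
  then show ?case by (metis coeffs_in_ring(3)[OF subring_pvars] poly_mult)
qed

text \<open>Tarski's transfer in the form used here: \<open>b\<close> is a point over any field with
  intermediate values, \<open>a\<close> a real point. If they agree in sign on conditions that
  involve only the variables in \<open>I\<close>, the other coordinates of \<open>a\<close> can be
  changed to match \<open>b\<close> on \<open>F\<close>. The variables outside \<open>I\<close> are
  eliminated one at a time.\<close>

theorem elimination:
  fixes F :: "'n::finite pfun set"
  assumes "finite F"
  shows "\<exists>S. finite S \<and> S \<subseteq> pvars I \<and>
    (\<forall>a (b :: 'n pfun \<Rightarrow> 'r::poly_ivt_field). ring_map b \<longrightarrow> (\<forall>s\<in>S. ssign (peval s a) (b s)) \<longrightarrow>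
      (\<exists>a'. (\<forall>i\<in>I. a' $ i = a $ i) \<and> (\<forall>f\<in>F. ssign (peval f a') (b f))))"
proof -
  have "finite (- I)" by simp
  then show ?thesis
  proof (induction "- I" arbitrary: I rule: finite_induct)
    case empty
    then have "I = UNIV" by auto
    then show ?case using assms pvars_UNIV by (intro exI[of _ F]) auto
  next
    case (insert i J)
    have J: "J = - insert i I" using insert by auto
    have iI: "i \<notin> I" using insert by auto
    obtain T where T: "finite T" "T \<subseteq> pvars (insert i I)"
      and T': "\<And>a (b :: 'n pfun \<Rightarrow> 'r). ring_map b \<Longrightarrow> \<forall>s\<in>T. ssign (peval s a) (b s) \<Longrightarrow>
         \<exists>a'. (\<forall>j\<in>insert i I. a' $ j = a $ j) \<and> (\<forall>f\<in>F. ssign (peval f a') (b f))"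
      using insert(3)[OF J] by (elim exE conjE) simp
    have "\<forall>t\<in>T. \<exists>P. coeffs_in (pvars I) P \<and> t = poly P (pcoord i)" using T(2) pvars_as_poly by blast
    then obtain P where P: "\<And>t. t \<in> T \<Longrightarrow> coeffs_in (pvars I) (P t)" "\<And>t. t \<in> T \<Longrightarrow> t = poly (P t) (pcoord i)"
      by metis
    have PT: "coeffs_in (pvars I) f" if "f \<in> P ` T" for f using that P(1) by blast
    have "\<exists>S. finite S \<and> S \<subseteq> pvars I \<and> (\<forall>(a :: 'n pfun \<Rightarrow> real) (b :: 'n pfun \<Rightarrow> 'r). ring_map a \<longrightarrow> ring_map b \<longrightarrow>
      (\<forall>s\<in>S. ssign (a s) (b s)) \<longrightarrow> (\<forall>y. \<exists>x. \<forall>f\<in>P ` T. ssign (poly (map_poly a f) x) (poly (map_poly b f) y)))"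
      by (rule one_variable_elimination[OF subring_pvars finite_imageI[OF T(1)]]) (rule PT)
    then obtain S where S: "finite S" "S \<subseteq> pvars I" and
      S': "\<And>(a :: 'n pfun \<Rightarrow> real) (b :: 'n pfun \<Rightarrow> 'r) y. ring_map a \<Longrightarrow> ring_map b \<Longrightarrow> \<forall>s\<in>S. ssign (a s) (b s) \<Longrightarrow>
          \<exists>x. \<forall>f\<in>P ` T. ssign (poly (map_poly a f) x) (poly (map_poly b f) y)"
      by (elim exE conjE) simp
    show ?case
    proof (intro exI[of _ S] conjI S allI impI)
      fix a and b :: "'n pfun \<Rightarrow> 'r" assume b: "ring_map b" and s: "\<forall>s\<in>S. ssign (peval s a) (b s)"
      obtain x where x: "\<And>t. t \<in> T \<Longrightarrow> ssign (poly (map_poly (\<lambda>p. peval p a) (P t)) x) (poly (map_poly b (P t)) (b (pcoord i)))"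
        using S'[OF ring_map_peval b s, of "b (pcoord i)"] by blast
      \<comment> \<open>Only the coordinate \<open>i\<close> changes, and the coefficients of
        \<open>P t\<close> do not depend on it.\<close>
      define a1 where "a1 = (\<chi> j. if j = i then x else a $ j)"
      have "ssign (peval t a1) (b t)" if t: "t \<in> T" for t
      proof -
        have "map_poly (\<lambda>p. peval p a1) (P t) = map_poly (\<lambda>p. peval p a) (P t)"
        proof (rule poly_eqI)
          fix k
          have "coeff (P t) k \<in> pvars I" using P(1)[OF t] by (simp add: coeffs_in_def)
          then have "peval (coeff (P t) k) a1 = peval (coeff (P t) k) a"
            by (rule pvars_local) (use iI in \<open>auto simp: a1_def\<close>)
          then show "coeff (map_poly (\<lambda>p. peval p a1) (P t)) k = coeff (map_poly (\<lambda>p. peval p a) (P t)) k"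
            by (simp add: coeff_map_poly)
        qed
        then have "peval t a1 = poly (map_poly (\<lambda>p. peval p a) (P t)) x"
          using ring_map_poly[OF ring_map_peval[of a1], of "P t" "pcoord i"] P(2)[OF t] by (simp add: a1_def)
        moreover have "b t = poly (map_poly b (P t)) (b (pcoord i))"
          using ring_map_poly[OF b, of "P t" "pcoord i"] P(2)[OF t] by simp
        ultimately show ?thesis using x[OF t] by simp
      qed
      then obtain a' where a': "\<forall>j\<in>insert i I. a' $ j = a1 $ j" "\<forall>f\<in>F. ssign (peval f a') (b f)"
        using T'[OF b] by blast
      have "\<forall>j\<in>I. a' $ j = a $ j" using a'(1) iI by (auto simp: a1_def)
      then show "\<exists>a'. (\<forall>i\<in>I. a' $ i = a $ i) \<and> (\<forall>f\<in>F. ssign (peval f a') (b f))" using a'(2) by blast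
    qed
  qed
qed

section \<open>Prime cones and the Artin--Lang theorem\<close>

definition rcone :: "'a::comm_ring_1 set \<Rightarrow> bool" where
  "rcone P \<longleftrightarrow> (\<forall>x\<in>P. \<forall>y\<in>P. x + y \<in> P \<and> x * y \<in> P) \<and> (\<forall>x. x \<in> P \<or> - x \<in> P) \<and> - 1 \<notin> P \<and>
     (\<forall>x y. x * y \<in> P \<and> - (x * y) \<in> P \<longrightarrow> (x \<in> P \<and> - x \<in> P) \<or> (y \<in> P \<and> - y \<in> P))"

definition csupp :: "'a::comm_ring_1 set \<Rightarrow> 'a set" where
  "csupp P = {x. x \<in> P \<and> - x \<in> P}"

lemma rconeD:
  assumes "rcone P"
  shows "x \<in> P \<Longrightarrow> y \<in> P \<Longrightarrow> x + y \<in> P" "x \<in> P \<Longrightarrow> y \<in> P \<Longrightarrow> x * y \<in> P" "x \<in> P \<or> - x \<in> P"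
    "- 1 \<notin> P" "0 \<in> P" "1 \<in> P" "x * x \<in> P"
    "x * y \<in> csupp P \<Longrightarrow> x \<in> csupp P \<or> y \<in> csupp P"
    "0 \<in> csupp P" "1 \<notin> csupp P" "x \<in> csupp P \<Longrightarrow> y \<in> csupp P \<Longrightarrow> x + y \<in> csupp P"
    "x \<in> csupp P \<Longrightarrow> y * x \<in> csupp P" "x \<in> csupp P \<Longrightarrow> - x \<in> csupp P"
proof -
  show a: "x \<in> P \<Longrightarrow> y \<in> P \<Longrightarrow> x + y \<in> P" "x \<in> P \<Longrightarrow> y \<in> P \<Longrightarrow> x * y \<in> P" "x \<in> P \<or> - x \<in> P" "- 1 \<notin> P" for x y
    using assms by (auto simp: rcone_def)
  show z: "0 \<in> P" using a(3)[of 0] by simp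
  show "1 \<in> P" using a(3)[of 1] a(4) by simp
  show "x * x \<in> P" using a(3)[of x] a(2)[of x x] a(2)[of "- x" "- x"] by auto
  show "x * y \<in> csupp P \<Longrightarrow> x \<in> csupp P \<or> y \<in> csupp P"
    using assms unfolding rcone_def csupp_def by blast
  show "0 \<in> csupp P" "1 \<notin> csupp P" using z a(4) by (auto simp: csupp_def)
  show "x \<in> csupp P \<Longrightarrow> y \<in> csupp P \<Longrightarrow> x + y \<in> csupp P"
    using a(1)[of x y] a(1)[of "- x" "- y"] by (auto simp: csupp_def)
  show "x \<in> csupp P \<Longrightarrow> y * x \<in> csupp P"
    using a(3)[of y] a(2)[of y x] a(2)[of y "- x"] a(2)[of "- y" x] a(2)[of "- y" "- x"] by (auto simp: csupp_def)
  show "x \<in> csupp P \<Longrightarrow> - x \<in> csupp P" by (simp add: csupp_def)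
qed

lemma rcone_square_cancel:
  assumes P: "rcone P" and x: "x \<notin> csupp P" shows "x * x * y \<in> P \<longleftrightarrow> y \<in> P"
proof
  assume l: "x * x * y \<in> P"
  show "y \<in> P"
  proof (rule ccontr)
    assume n: "y \<notin> P"
    then have m: "- y \<in> P" using rconeD(3)[OF P] by blast
    then have "- (x * x * y) \<in> P" using rconeD(2)[OF P rconeD(7)[OF P, of x] m] by simp
    then have "x * x * y \<in> csupp P" using l by (simp add: csupp_def)
    then have "y \<in> csupp P" using rconeD(8)[OF P] x by blast
    then show False using n by (simp add: csupp_def)
  qed
qed (intro rconeD(2,7)[OF P])

text \<open>The conclusion of the Artin--Lang theorem for a single cone, isolated as a predicate
  because it enters the choice of \<open>test_cone\<close>.\<close>

definition sign_realized :: "'n::finite pfun set \<Rightarrow> bool" where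
  "sign_realized P \<longleftrightarrow> (\<forall>S. finite S \<longrightarrow> (\<exists>a. \<forall>s\<in>S. (0 < peval s a \<longleftrightarrow> - s \<notin> P) \<and> (peval s a < 0 \<longleftrightarrow> s \<notin> P)))"

text \<open>Types cannot depend on a cone. Fixing one cone by choice, a counterexample to the theorem if there
  is any, makes its residue ring a type; once the theorem holds for this cone there is no counterexample.\<close>

definition test_cone :: "'n::finite pfun set" where
  "test_cone = (SOME P. rcone P \<and> (sign_realized P \<longrightarrow> (\<forall>Q :: 'n pfun set. rcone Q \<longrightarrow> sign_realized Q)))"

lemma rcone_at_point: "rcone {p. 0 \<le> peval p (x :: real^'n::finite)}"
  unfolding rcone_def by auto

lemma test_cone: "rcone (test_cone :: 'n::finite pfun set)"
  "sign_realized (test_cone :: 'n pfun set) \<Longrightarrow> rcone Q \<Longrightarrow> sign_realized (Q :: 'n pfun set)"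
proof -
  have ex: "\<exists>P :: 'n pfun set. rcone P \<and> (sign_realized P \<longrightarrow> (\<forall>Q :: 'n pfun set. rcone Q \<longrightarrow> sign_realized Q))"
    using rcone_at_point[of "0 :: real^'n"]
    by (cases "\<forall>Q :: 'n pfun set. rcone Q \<longrightarrow> sign_realized Q") blast+
  note t = someI_ex[OF ex, folded test_cone_def]
  show "rcone (test_cone :: 'n pfun set)"
    "sign_realized (test_cone :: 'n pfun set) \<Longrightarrow> rcone Q \<Longrightarrow> sign_realized (Q :: 'n pfun set)"
    using t by blast+
qed

section \<open>The ordered residue ring and its generic point\<close>

text \<open>Congruence modulo the support. As the support is prime, the quotient is a domain, and
  the cone is the set of its nonnegative elements.\<close>

definition res_rel :: "'n::finite pfun \<Rightarrow> 'n pfun \<Rightarrow> bool" where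
  "res_rel p q \<longleftrightarrow> p - q \<in> csupp test_cone"

lemma equivp_res_rel: "equivp res_rel"
proof (rule equivpI)
  note t = rconeD[OF test_cone(1)]
  show "reflp res_rel" by (auto simp: reflp_def res_rel_def t)
  show "symp res_rel" unfolding symp_def res_rel_def using t(13) by (metis minus_diff_eq)
  show "transp res_rel" unfolding transp_def res_rel_def using t(11) by (metis diff_add_cancel add_diff_eq)
qed

quotient_type (overloaded) 'n residue_ring = "'n::finite pfun" / res_rel
  morphisms res_rep res
  by (rule equivp_res_rel)

lemma res_rel_refl: "res_rel p p" by (simp add: res_rel_def rconeD(9)[OF test_cone(1)])

lemma test_cone_cong:
  assumes "res_rel p q" shows "p \<in> test_cone \<longleftrightarrow> q \<in> test_cone"
proof -
  have *: "p - q \<in> test_cone" "q - p \<in> test_cone" using assms by (auto simp: res_rel_def csupp_def)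
  then show ?thesis using rconeD(1)[OF test_cone(1), of "q - p" p] rconeD(1)[OF test_cone(1), of "p - q" q] by auto
qed

lemma res_rel_add: "res_rel p p' \<Longrightarrow> res_rel q q' \<Longrightarrow> res_rel (p + q) (p' + q')"
  unfolding res_rel_def using rconeD(11)[OF test_cone(1), of "p - p'" "q - q'"] by (simp add: algebra_simps)

lemma res_rel_minus: "res_rel p p' \<Longrightarrow> res_rel (- p) (- p')"
  unfolding res_rel_def using rconeD(13)[OF test_cone(1), of "p - p'"] by simp

lemma res_rel_mult: "res_rel p p' \<Longrightarrow> res_rel q q' \<Longrightarrow> res_rel (p * q) (p' * q')"
proof -
  assume "res_rel p p'" "res_rel q q'"
  then have "q * (p - p') + p' * (q - q') \<in> csupp test_cone"
    unfolding res_rel_def using rconeD(11,12)[OF test_cone(1)] by blast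
  then show ?thesis unfolding res_rel_def by (simp add: algebra_simps)
qed

instantiation residue_ring :: (finite) linordered_idom
begin

lift_definition zero_residue_ring :: "'a residue_ring" is 0 .
lift_definition one_residue_ring :: "'a residue_ring" is 1 .
lift_definition plus_residue_ring :: "'a residue_ring \<Rightarrow> 'a residue_ring \<Rightarrow> 'a residue_ring" is "(+)"
  by (rule res_rel_add)
lift_definition times_residue_ring :: "'a residue_ring \<Rightarrow> 'a residue_ring \<Rightarrow> 'a residue_ring" is "(*)"
  by (rule res_rel_mult)
lift_definition uminus_residue_ring :: "'a residue_ring \<Rightarrow> 'a residue_ring" is uminus
  by (rule res_rel_minus)
definition minus_residue_ring :: "'a residue_ring \<Rightarrow> 'a residue_ring \<Rightarrow> 'a residue_ring" where
  "minus_residue_ring x y = x + - y"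
lift_definition less_eq_residue_ring :: "'a residue_ring \<Rightarrow> 'a residue_ring \<Rightarrow> bool" is "\<lambda>x y. y - x \<in> test_cone"
proof -
  fix p p' q q' :: "'a pfun" assume "res_rel p p'" "res_rel q q'"
  then have "res_rel (q + - p) (q' + - p')" by (intro res_rel_add res_rel_minus)
  then show "(q - p \<in> test_cone) = (q' - p' \<in> test_cone)" using test_cone_cong by simp
qed
definition less_residue_ring :: "'a residue_ring \<Rightarrow> 'a residue_ring \<Rightarrow> bool" where
  "less_residue_ring x y \<longleftrightarrow> x \<le> y \<and> x \<noteq> y"
definition abs_residue_ring :: "'a residue_ring \<Rightarrow> 'a residue_ring" where
  "abs_residue_ring x = (if x < 0 then - x else x)"
definition sgn_residue_ring :: "'a residue_ring \<Rightarrow> 'a residue_ring" where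
  "sgn_residue_ring x = (if x = 0 then 0 else if 0 < x then 1 else - 1)"

instance
proof
  note t = rconeD[OF test_cone(1)]
  fix x y z :: "'a residue_ring"
  show r1: "x + y + z = x + (y + z)" "x + y = y + x" "0 + x = x" "- x + x = 0"
    "x * y * z = x * (y * z)" "x * y = y * x" "1 * x = x" "(x + y) * z = x * z + y * z"
    for x y z :: "'a residue_ring"
    by (transfer; simp add: algebra_simps res_rel_refl)+
  show m: "x - y = x + - y" for x y :: "'a residue_ring" by (simp add: minus_residue_ring_def)
  show "x + y - x = y" using r1 m by (metis)
  show "x - y - z = x - (y + z)" unfolding m by transfer (simp add: algebra_simps res_rel_refl)
  show "0 * x = 0" "x * 0 = 0" by (transfer; simp add: res_rel_refl)+
  show "(0::'a residue_ring) \<noteq> 1" by transfer (auto simp: res_rel_def dest: t(13) simp: t)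
  show anti: "x \<le> y \<Longrightarrow> y \<le> x \<Longrightarrow> x = y" by transfer (auto simp: res_rel_def csupp_def)
  show "(x < y) = (x \<le> y \<and> \<not> y \<le> x)" using anti by (auto simp: less_residue_ring_def)
  show "x \<le> x" by transfer (simp add: t)
  show "x \<le> y \<Longrightarrow> y \<le> z \<Longrightarrow> x \<le> z" by transfer (use t(1) in \<open>metis diff_add_cancel add_diff_eq\<close>)
  show "x \<le> y \<or> y \<le> x" by transfer (use t(3) in \<open>metis minus_diff_eq\<close>)
  show "x \<le> y \<Longrightarrow> z + x \<le> z + y" by transfer simp
  show "x < y \<Longrightarrow> 0 < z \<Longrightarrow> z * x < z * y"
    unfolding less_residue_ring_def
  proof (transfer, elim conjE, intro conjI)
    fix x y z :: "'a pfun"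
    assume *: "y - x \<in> test_cone" "\<not> res_rel x y" "z - 0 \<in> test_cone" "\<not> res_rel 0 z"
    show "z * y - z * x \<in> test_cone" using t(2)[of z "y - x"] * by (simp add: algebra_simps)
    have "z \<notin> csupp test_cone" using *(4) t(13) by (auto simp: res_rel_def)
    then show "\<not> res_rel (z * x) (z * y)"
      using *(2) t(8)[of z "x - y"] by (auto simp: res_rel_def algebra_simps)
  qed
  show "\<bar>x\<bar> = (if x < 0 then - x else x)" by (simp add: abs_residue_ring_def)
  show "sgn x = (if x = 0 then 0 else if 0 < x then 1 else - 1)" by (simp add: sgn_residue_ring_def)
qed

end

text \<open>The tautological point of the cone: a polynomial goes to its class in the real closure
  of the residue field, where its sign is the one prescribed by the cone.\<close>

definition generic_point :: "'n::finite pfun \<Rightarrow> 'n residue_ring fract rclosure" where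
  "generic_point p = to_rc (Fract (res p) 1)"

lemma generic_point_hom: "ring_map (generic_point :: 'n::finite pfun \<Rightarrow> _)"
  unfolding ring_map_def generic_point_def
proof (intro conjI allI)
  have "res (1 :: 'n pfun) = 1" by (simp add: one_residue_ring_def)
  then show "to_rc (Fract (res (1 :: 'n pfun)) 1) = 1" by (simp flip: One_fract_def)
  fix p q :: "'n pfun"
  have "res (p + q) = res p + res q"
    "res (p * q) = res p * res q"
    by (simp_all add: plus_residue_ring.abs_eq times_residue_ring.abs_eq)
  then show "to_rc (Fract (res (p + q)) 1) = to_rc (Fract (res p) 1) + to_rc (Fract (res q) 1)"
    "to_rc (Fract (res (p * q)) 1) = to_rc (Fract (res p) 1) * to_rc (Fract (res q) 1)"
    by (simp_all flip: to_rc_hom)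
qed

lemma generic_point_nonneg: "p \<in> test_cone \<Longrightarrow> 0 \<le> generic_point p"
proof -
  assume "p \<in> test_cone"
  then have "0 \<le> res p" by transfer simp
  then show ?thesis unfolding generic_point_def by (intro to_rc_nonneg) (simp add: zero_le_Fract_iff)
qed

lemma generic_point_eq_0: "generic_point p = 0 \<Longrightarrow> p \<in> csupp test_cone"
proof -
  assume "generic_point p = 0"
  then have "res p = 0" unfolding generic_point_def
    by (simp add: to_rc_eq_0 Zero_fract_def eq_fract)
  then show ?thesis by transfer (simp add: res_rel_def)
qed

lemma generic_point_sign: "0 < generic_point p \<longleftrightarrow> - p \<notin> test_cone" "generic_point p < 0 \<longleftrightarrow> p \<notin> test_cone"
proof -
  note h = ring_map_simps[OF generic_point_hom]
  have pos: "0 < generic_point p \<longleftrightarrow> - p \<notin> test_cone" for p :: "'a pfun"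
  proof
    assume "0 < generic_point p"
    then show "- p \<notin> test_cone" using generic_point_nonneg[of "- p"] by (auto simp: h)
  next
    assume n: "- p \<notin> test_cone"
    then have "p \<in> test_cone" using rconeD(3)[OF test_cone(1)] by blast
    then have "0 \<le> generic_point p" by (rule generic_point_nonneg)
    moreover have "generic_point p \<noteq> 0" using generic_point_eq_0[of p] n by (auto simp: csupp_def)
    ultimately show "0 < generic_point p" by simp
  qed
  show "0 < generic_point p \<longleftrightarrow> - p \<notin> test_cone" "generic_point p < 0 \<longleftrightarrow> p \<notin> test_cone"
    using pos[of p] pos[of "- p"] by (auto simp: h)
qed

text \<open>A positive real is the square of an invertible element, so its image in an ordered field
  is a nonzero square.\<close>

lemma ring_map_real_sign:
  fixes h :: "real \<Rightarrow> 'r::linordered_field"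
  assumes "ring_map h" shows "ssign c (h c)"
proof -
  note h = ring_map_simps[OF assms]
  have pos: "0 < h c" if "0 < c" for c
  proof -
    have "h c = h (sqrt c) * h (sqrt c)" using that by (simp flip: h)
    moreover have "h c * h (inverse c) = 1" using that by (simp flip: h)
    ultimately show ?thesis by (metis mult_zero_left zero_le_square zero_neq_one order_le_less)
  qed
  show ?thesis
    using pos[of c] pos[of "- c"] h(4) unfolding ssign_def
    by (cases c "0 :: real" rule: linorder_cases) (auto simp: h)
qed

text \<open>Eliminating all variables leaves conditions on real constants, and these hold for every
  ring map. So a real point can take the place of the generic point of \<open>test_cone\<close>, and
  the choice of \<open>test_cone\<close> carries the result to every cone.\<close>

theorem artin_lang:
  fixes P :: "'n::finite pfun set"
  assumes "rcone P" "finite S"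
  obtains a where "\<And>s. s \<in> S \<Longrightarrow> 0 < peval s a \<longleftrightarrow> - s \<notin> P" "\<And>s. s \<in> S \<Longrightarrow> peval s a < 0 \<longleftrightarrow> s \<notin> P"
proof -
  have "sign_realized (test_cone :: 'n pfun set)"
    unfolding sign_realized_def
  proof (intro allI impI)
    fix S :: "'n pfun set" assume "finite S"
    from elimination[OF this, of "{}", where 'r = "'n residue_ring fract rclosure"]
    obtain T where T: "T \<subseteq> pvars {}" and
      T': "\<And>a (b :: 'n pfun \<Rightarrow> 'n residue_ring fract rclosure). ring_map b \<Longrightarrow> \<forall>s\<in>T. ssign (peval s a) (b s) \<Longrightarrow>
        \<exists>a'. \<forall>f\<in>S. ssign (peval f a') (b f)" by (elim exE conjE) simp
    have "ring_map (\<lambda>c. generic_point (pconst c :: 'n pfun))"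
      using ring_map_simps[OF generic_point_hom[where 'n = 'n]] by (simp add: ring_map_def pconst_simps)
    then have "\<forall>s\<in>T. ssign (peval s 0) (generic_point s)"
      using T ring_map_real_sign by (force dest!: pvars_empty subsetD)
    then obtain a where "\<forall>f\<in>S. ssign (peval f a) (generic_point f)" using T'[OF generic_point_hom] by blast
    then have "\<forall>s\<in>S. (0 < peval s a \<longleftrightarrow> - s \<notin> test_cone) \<and> (peval s a < 0 \<longleftrightarrow> s \<notin> test_cone)"
      by (simp add: ssign_def generic_point_sign)
    then show "\<exists>a. \<forall>s\<in>S. (0 < peval s a \<longleftrightarrow> - s \<notin> test_cone) \<and> (peval s a < 0 \<longleftrightarrow> s \<notin> test_cone)" ..
  qed
  then have "sign_realized P" using test_cone(2) assms(1) by blast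
  then show ?thesis using that assms(2) unfolding sign_realized_def by blast
qed

section \<open>Ideals of polynomial functions\<close>

inductive_set ideal_span :: "'a::comm_ring_1 set \<Rightarrow> 'a set \<Rightarrow> 'a set" for K B where
  zero: "0 \<in> ideal_span K B"
| step: "x \<in> ideal_span K B \<Longrightarrow> k \<in> K \<Longrightarrow> b \<in> B \<Longrightarrow> x + k * b \<in> ideal_span K B"

definition ideal_in :: "'a::comm_ring_1 set \<Rightarrow> 'a set \<Rightarrow> bool" where
  "ideal_in K J \<longleftrightarrow> J \<subseteq> K \<and> 0 \<in> J \<and> (\<forall>x\<in>J. \<forall>y\<in>J. x + y \<in> J) \<and> (\<forall>k\<in>K. \<forall>x\<in>J. k * x \<in> J)"

definition noetherian_set :: "'a::comm_ring_1 set \<Rightarrow> bool" where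
  "noetherian_set K \<longleftrightarrow> (\<forall>J. ideal_in K J \<longrightarrow> (\<exists>B. finite B \<and> B \<subseteq> J \<and> J \<subseteq> ideal_span K B))"

lemma ideal_span_add:
  assumes "y \<in> ideal_span K B" "x \<in> ideal_span K B" shows "x + y \<in> ideal_span K B"
  using assms
proof (induction arbitrary: x rule: ideal_span.induct)
  case (step y k b)
  then show ?case using ideal_span.step[of "x + y" K B k b] by (simp add: add.assoc)
qed simp

lemma ideal_span_mult:
  assumes K: "subring_set K" and "x \<in> ideal_span K B" "c \<in> K" shows "c * x \<in> ideal_span K B"
  using assms(2)
proof (induction rule: ideal_span.induct)
  case (step x k b)
  then show ?case using ideal_span.step[of "c * x" K B "c * k" b] assms(3) subring_setD(5)[OF K]
    by (simp add: algebra_simps)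
qed (simp add: ideal_span.zero)

lemma ideal_span_vanish: "x \<in> ideal_span K B \<Longrightarrow> ring_map h \<Longrightarrow> (\<And>b. b \<in> B \<Longrightarrow> h b = 0) \<Longrightarrow> h x = 0"
  by (induction rule: ideal_span.induct) (auto simp: ring_map_simps)

definition adjoin :: "'a::comm_ring_1 set \<Rightarrow> 'a \<Rightarrow> 'a set" where
  "adjoin K t = {poly P t |P. coeffs_in K P}"

lemma adjoin_ring:
  assumes "subring_set K" shows "subring_set (adjoin K t)" "K \<subseteq> adjoin K t" "t ^ n \<in> adjoin K t"
proof -
  note K = subring_setD[OF assms]
  have in_adj: "poly P t \<in> adjoin K t" if "coeffs_in K P" for P using that by (auto simp: adjoin_def)
  have c: "coeffs_in K [:k:]" if "k \<in> K" for k using that by (auto simp: coeffs_in_def coeff_pCons K split: nat.split)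
  show sub: "K \<subseteq> adjoin K t" using in_adj[OF c] by auto
  show "t ^ n \<in> adjoin K t"
    using in_adj[OF coeffs_in_ring(5)[OF assms, of 1 n]] K by (simp add: Polynomial.poly_monom)
  show "subring_set (adjoin K t)" unfolding subring_set_def
  proof (intro conjI ballI)
    show "1 \<in> adjoin K t" using sub K by auto
    fix x assume "x \<in> adjoin K t"
    then obtain P where P: "x = poly P t" "coeffs_in K P" by (auto simp: adjoin_def)
    show "- x \<in> adjoin K t" using in_adj[OF coeffs_in_ring(2)[OF assms coeffs_in_ring(6)[OF assms] P(2)]] P by simp
    fix y assume "y \<in> adjoin K t"
    then obtain Q where Q: "y = poly Q t" "coeffs_in K Q" by (auto simp: adjoin_def)
    show "x + y \<in> adjoin K t" "x * y \<in> adjoin K t"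
      using in_adj[OF coeffs_in_ring(1)[OF assms P(2) Q(2)]] in_adj[OF coeffs_in_ring(3)[OF assms P(2) Q(2)]] P Q by simp_all
  qed
qed

text \<open>Hilbert's argument for the set \<open>PP\<close> of polynomials whose value at
  \<open>t\<close> lies in \<open>J\<close>. Their coefficients in degree \<open>d\<close> form an
  ideal of \<open>K\<close> that grows with \<open>d\<close>. Finitely many generators of the union
  occur by some degree \<open>D\<close>; lifts of these, and of generators for each degree up to
  \<open>D\<close>, suffice. Relations satisfied by \<open>t\<close> do no harm, as degrees are
  compared before evaluation.\<close>

theorem hilbert_basis_adjoin:
  assumes K: "subring_set K" and N: "noetherian_set K"
  shows "noetherian_set (adjoin K t)"
  unfolding noetherian_set_def
proof (intro allI impI)
  fix J assume J: "ideal_in (adjoin K t) J"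
  define PP where "PP = {P. coeffs_in K P \<and> poly P t \<in> J}"
  define LC where "LC d = {c. \<exists>P\<in>PP. degree P \<le> d \<and> coeff P d = c}" for d
  have J0: "0 \<in> J" and Ja: "\<And>x y. x \<in> J \<Longrightarrow> y \<in> J \<Longrightarrow> x + y \<in> J"
    and Jm: "\<And>k x. k \<in> adjoin K t \<Longrightarrow> x \<in> J \<Longrightarrow> k * x \<in> J" and JL: "J \<subseteq> adjoin K t"
    using J by (auto simp: ideal_in_def)
  note Kc = coeffs_in_ring[OF K]
  note A = adjoin_ring[OF K, of t]
  have PPa: "P + Q \<in> PP" if "P \<in> PP" "Q \<in> PP" for P Q using that Kc Ja by (auto simp: PP_def)
  have PPs: "smult k P \<in> PP" if "P \<in> PP" "k \<in> K" for P k using that Kc Jm A(2) by (auto simp: PP_def)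
  have PPt: "Polynomial.monom 1 n * P \<in> PP" if "P \<in> PP" for P n
    using that Kc(3)[OF Kc(5)[OF subring_setD(2)[OF K]]] Jm[OF A(3)] by (auto simp: PP_def Polynomial.poly_monom)
  have deg_shift: "degree (Polynomial.monom 1 n * P) \<le> n + d" if "degree P \<le> d" for n d and P :: "'a poly"
    using degree_mult_le[of "Polynomial.monom 1 n" P] degree_monom_le[of "1::'a" n] that by linarith
  have PP0: "0 \<in> PP" using Kc J0 by (auto simp: PP_def)
  have LCmono: "LC d \<subseteq> LC (n + d)" for d n
  proof
    fix c assume "c \<in> LC d"
    then obtain P where P: "P \<in> PP" "degree P \<le> d" "coeff P d = c" by (auto simp: LC_def)
    then show "c \<in> LC (n + d)" unfolding LC_def using PPt[OF P(1), of n] deg_shift[OF P(2), of n]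
      by (auto intro!: bexI[of _ "Polynomial.monom 1 n * P"] simp: coeff_monom_mult)
  qed
  have LCmono': "LC d \<subseteq> LC e" if "d \<le> e" for d e using LCmono[of d "e - d"] that by simp
  have LCideal: "ideal_in K (LC d)" for d
    unfolding ideal_in_def
  proof (intro conjI ballI subsetI)
    show "c \<in> K" if "c \<in> LC d" for c using that by (auto simp: LC_def PP_def coeffs_in_def)
    show "0 \<in> LC d" unfolding LC_def using PP0 by (auto intro!: bexI[of _ 0])
    fix c assume "c \<in> LC d"
    then obtain P where P: "P \<in> PP" "degree P \<le> d" "coeff P d = c" by (auto simp: LC_def)
    show "c + c' \<in> LC d" if c': "c' \<in> LC d" for c'
    proof -
      obtain Q where Q: "Q \<in> PP" "degree Q \<le> d" "coeff Q d = c'" using c' by (auto simp: LC_def)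
      show ?thesis unfolding LC_def using PPa[OF P(1) Q(1)] P Q
        by (auto intro!: bexI[of _ "P + Q"] degree_add_le)
    qed
    show "k * c \<in> LC d" if "k \<in> K" for k
      unfolding LC_def using PPs[OF P(1) that] P order_trans[OF degree_smult_le]
      by (auto intro!: bexI[of _ "smult k P"])
  qed
  have "ideal_in K (\<Union>d. LC d)"
    unfolding ideal_in_def
  proof (intro conjI ballI subsetI)
    show "c \<in> K" if "c \<in> (\<Union>d. LC d)" for c
    proof -
      obtain d where "c \<in> LC d" using \<open>c \<in> (\<Union>d. LC d)\<close> by auto
      then show ?thesis using LCideal[of d] by (auto simp: ideal_in_def)
    qed
    show "0 \<in> (\<Union>d. LC d)" using LCideal[of 0] by (auto simp: ideal_in_def)
    show "c + c' \<in> (\<Union>d. LC d)" if cc: "c \<in> (\<Union>d. LC d)" "c' \<in> (\<Union>d. LC d)" for c c'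
    proof -
      obtain d d' where "c \<in> LC d" "c' \<in> LC d'" using cc by auto
      then have "c \<in> LC (max d d')" "c' \<in> LC (max d d')" using LCmono' by (meson max.cobounded1 max.cobounded2 subsetD)+
      then show ?thesis using LCideal[of "max d d'"] unfolding ideal_in_def by blast
    qed
    show "k * c \<in> (\<Union>d. LC d)" if kc: "k \<in> K" "c \<in> (\<Union>d. LC d)" for k c
    proof -
      obtain d where "c \<in> LC d" using kc by auto
      then have "k * c \<in> LC d" using LCideal[of d] kc by (simp add: ideal_in_def)
      then show ?thesis by blast
    qed
  qed
  then obtain C where C: "finite C" "C \<subseteq> (\<Union>d. LC d)" "(\<Union>d. LC d) \<subseteq> ideal_span K C"
    using N unfolding noetherian_set_def by blast
  have "\<exists>D. C \<subseteq> LC D" using C(1,2)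
  proof (induction rule: finite_induct)
    case (insert c C)
    then obtain D d where "C \<subseteq> LC D" "c \<in> LC d" by auto
    then have "insert c C \<subseteq> LC (max D d)" using LCmono'[of D "max D d"] LCmono'[of d "max D d"] by auto
    then show ?case ..
  qed auto
  then obtain D where D: "C \<subseteq> LC D" ..
  have "\<forall>d. \<exists>B. finite B \<and> B \<subseteq> LC d \<and> LC d \<subseteq> ideal_span K B"
    using N LCideal unfolding noetherian_set_def by blast
  then obtain B0 where B0: "\<And>d. finite (B0 d)" "\<And>d. B0 d \<subseteq> LC d" "\<And>d. LC d \<subseteq> ideal_span K (B0 d)" by metis
  have "\<forall>d c. \<exists>P. c \<in> LC d \<longrightarrow> P \<in> PP \<and> degree P \<le> d \<and> coeff P d = c" by (auto simp: LC_def)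
  then obtain W where W: "\<And>d c. c \<in> LC d \<Longrightarrow> W d c \<in> PP \<and> degree (W d c) \<le> d \<and> coeff (W d c) d = c" by metis
  define BB where "BB = (\<Union>d\<le>D. (\<lambda>c. poly (W d c) t) ` B0 d) \<union> (\<lambda>c. poly (W D c) t) ` C"
  have BBfin: "finite BB" unfolding BB_def using B0(1) C(1) by auto
  have BBJ: "BB \<subseteq> J" unfolding BB_def using W B0(2) D by (fastforce simp: PP_def)
  let ?L = "adjoin K t"
  have lift: "\<exists>Q\<in>PP. degree Q \<le> e \<and> coeff Q e = c \<and> poly Q t \<in> ideal_span ?L BB"
    if c: "c \<in> ideal_span K S" and S: "S \<subseteq> LC e" "\<And>s. s \<in> S \<Longrightarrow> poly (W e s) t \<in> BB" for c S e
    using c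
  proof (induction rule: ideal_span.induct)
    case zero
    show ?case using PP0 by (auto intro!: bexI[of _ 0] ideal_span.zero)
  next
    case (step c k b)
    then obtain Q where Q: "Q \<in> PP" "degree Q \<le> e" "coeff Q e = c" "poly Q t \<in> ideal_span ?L BB" by auto
    have w: "W e b \<in> PP" "degree (W e b) \<le> e" "coeff (W e b) e = b" using W S step by auto
    show ?case
    proof (intro bexI[of _ "Q + smult k (W e b)"] conjI PPa Q PPs w step)
      show "degree (Q + smult k (W e b)) \<le> e" using Q w order_trans[OF degree_smult_le] by (intro degree_add_le) auto
      show "coeff (Q + smult k (W e b)) e = c + k * b" using Q w by simp
      have "k \<in> ?L" using A(2) step by auto
      then show "poly (Q + smult k (W e b)) t \<in> ideal_span ?L BB"
        using ideal_span.step[OF Q(4) _ S(2)[OF step(3)]] by simp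
    qed
  qed
  have gen: "poly P t \<in> ideal_span ?L BB" if "P \<in> PP" "degree P \<le> n" for P n
    using that
  proof (induction n arbitrary: P rule: less_induct)
    case (less n)
    \<comment> \<open>Above degree \<open>D\<close> the top coefficient is matched in degree
      \<open>D\<close>, and the lift is shifted by a power of \<open>t\<close>.\<close>
    define e where "e = min n D"
    have "coeff P n \<in> LC n" using less.prems by (auto simp: LC_def)
    then have "\<exists>Q\<in>PP. degree Q \<le> e \<and> coeff Q e = coeff P n \<and> poly Q t \<in> ideal_span ?L BB"
    proof (cases "n \<le> D")
      case True
      then have e: "e = n" by (simp add: e_def)
      show ?thesis unfolding e
        by (rule lift[OF subsetD[OF B0(3) \<open>coeff P n \<in> LC n\<close>] B0(2)]) (use True in \<open>auto simp: BB_def\<close>)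
    next
      case False
      then have e: "e = D" by (simp add: e_def)
      show ?thesis unfolding e
        by (rule lift[of _ C]) (use \<open>coeff P n \<in> LC n\<close> C(3) D in \<open>auto simp: BB_def\<close>)
    qed
    then obtain Q where Q: "Q \<in> PP" "degree Q \<le> e" "coeff Q e = coeff P n" "poly Q t \<in> ideal_span ?L BB" by blast
    define R where "R = Polynomial.monom 1 (n - e) * Q"
    have en: "n - e + e = n" by (simp add: e_def)
    have R: "R \<in> PP" "degree R \<le> n" "coeff R n = coeff P n"
      using PPt[OF Q(1)] deg_shift[OF Q(2), of "n - e"] Q(3) en unfolding R_def
      by (auto simp: coeff_monom_mult e_def)
    have Rs: "poly R t \<in> ideal_span ?L BB"
      using ideal_span_mult[OF A(1) Q(4) A(3)[of "n - e"]] by (simp add: R_def Polynomial.poly_monom)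
    define P' where "P' = P + smult (- 1) R"
    have P': "P' \<in> PP" unfolding P'_def by (intro PPa PPs less.prems R subring_setD(3)[OF K] subring_setD(2)[OF K])
    have dP': "degree P' \<le> n" "coeff P' n = 0" using less.prems R unfolding P'_def by (auto intro!: degree_add_le degree_diff_le)
    have "poly P' t \<in> ideal_span ?L BB"
    proof (cases "n = 0")
      case True
      then have "P' = 0" using dP' by (auto elim: degree_eq_zeroE)
      then show ?thesis by (simp add: ideal_span.zero)
    next
      case False
      then have "degree P' < n" using degree_less_if_lead_cancels[OF dP'] by simp
      then show ?thesis using less.IH[of "degree P'" P'] P' by auto
    qed
    then have "poly R t + poly P' t \<in> ideal_span ?L BB" by (rule ideal_span_add[OF _ Rs])
    then show ?case by (simp add: P'_def)
  qed
  have "J \<subseteq> ideal_span ?L BB"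
  proof
    fix x assume "x \<in> J"
    then obtain P where "x = poly P t" "P \<in> PP" using JL by (auto simp: adjoin_def PP_def)
    then show "x \<in> ideal_span ?L BB" using gen by blast
  qed
  then show "\<exists>B. finite B \<and> B \<subseteq> J \<and> J \<subseteq> ideal_span ?L B" using BBfin BBJ by blast
qed

lemma pvars_adjoin: "pvars (insert i I) = adjoin (pvars I) (pcoord i)"
proof
  show "pvars (insert i I) \<subseteq> adjoin (pvars I) (pcoord i)" using pvars_as_poly by (fastforce simp: adjoin_def)
  have mono: "p \<in> pvars I \<Longrightarrow> p \<in> pvars (insert i I)" for p
    by (induction rule: pvars.induct) (auto intro: pvars.intros)
  have "coeffs_in (pvars I) P \<Longrightarrow> poly P (pcoord i) \<in> pvars (insert i I)" for P
  proof (induction P)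
    case 0
    then show ?case using pvars.const[of 0] by (simp add: pconst_simps)
  next
    case (pCons a P)
    have "a \<in> pvars I" "coeffs_in (pvars I) P" using pCons(3) unfolding coeffs_in_def
      by (metis coeff_pCons_0, metis coeff_pCons_Suc)
    then show ?case using pCons.IH mono by (auto intro: pvars.intros)
  qed
  then show "adjoin (pvars I) (pcoord i) \<subseteq> pvars (insert i I)" by (auto simp: adjoin_def)
qed

lemma noetherian_pvars: "noetherian_set (pvars (I :: 'n::finite set))"
proof (induction I rule: finite_induct[OF finite])
  case 1
  show ?case unfolding noetherian_set_def
  proof (intro allI impI)
    fix J :: "'n pfun set" assume J: "ideal_in (pvars {}) J"
    show "\<exists>B. finite B \<and> B \<subseteq> J \<and> J \<subseteq> ideal_span (pvars {}) B"
    proof (cases "J \<subseteq> {0}")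
      case True
      then show ?thesis by (intro exI[of _ "{}"]) (auto intro: ideal_span.zero)
    next
      case False
      then obtain c where c: "pconst c \<in> J" "c \<noteq> 0"
        using J pvars_empty unfolding ideal_in_def by (metis insertCI pconst_simps(1) subset_iff)
      have "x \<in> ideal_span (pvars {}) {pconst c}" if xJ: "x \<in> J" for x
      proof -
        obtain d where d: "x = pconst d" using J pvars_empty xJ unfolding ideal_in_def by blast
        have "0 + pconst (d / c) * pconst c \<in> ideal_span (pvars {}) {pconst c}"
          by (intro ideal_span.intros pvars.const) simp
        then show ?thesis using c(2) by (simp add: d flip: pconst_simps)
      qed
      then show ?thesis using c by (intro exI[of _ "{pconst c}"]) auto
    qed
  qed
next
  case (2 i I)
  then show ?case unfolding pvars_adjoin by (intro hilbert_basis_adjoin subring_pvars)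
qed

lemma pfun_ideal_generators:
  fixes J :: "'n::finite pfun set"
  assumes "0 \<in> J" "\<And>x y. x \<in> J \<Longrightarrow> y \<in> J \<Longrightarrow> x + y \<in> J" "\<And>k x. x \<in> J \<Longrightarrow> k * x \<in> J"
  obtains B where "finite B" "B \<subseteq> J" "J \<subseteq> ideal_span UNIV B"
proof -
  have U: "pvars UNIV = (UNIV :: 'n pfun set)" using pvars_UNIV by auto
  have "ideal_in UNIV J" using assms by (auto simp: ideal_in_def)
  then show ?thesis using noetherian_pvars[of "UNIV :: 'n set"] that unfolding U noetherian_set_def by blast
qed

text \<open>Over the reals the sum of the squares of finitely many generators vanishes exactly at
  the common zeros.\<close>

lemma ideal_single_equation:
  fixes J :: "'n::finite pfun set"
  assumes "0 \<in> J" "\<And>x y. x \<in> J \<Longrightarrow> y \<in> J \<Longrightarrow> x + y \<in> J" "\<And>k x. x \<in> J \<Longrightarrow> k * x \<in> J"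
  obtains g where "g \<in> J" "\<And>x. peval g x = 0 \<longleftrightarrow> (\<forall>p\<in>J. peval p x = 0)"
proof -
  obtain B where B: "finite B" "B \<subseteq> J" "J \<subseteq> ideal_span UNIV B" using pfun_ideal_generators[OF assms] .
  have sums: "finite A \<Longrightarrow> A \<subseteq> J \<Longrightarrow> (\<Sum>b\<in>A. b * b) \<in> J" for A
    by (induction A rule: finite_induct) (auto intro: assms)
  show ?thesis
  proof (rule that[of "\<Sum>b\<in>B. b * b"])
    show "(\<Sum>b\<in>B. b * b) \<in> J" by (rule sums[OF B(1,2)])
    fix x
    have "peval (\<Sum>b\<in>B. b * b) x = 0 \<longleftrightarrow> (\<forall>b\<in>B. peval b x = 0)"
      using B(1) by (simp add: sum_nonneg_eq_0_iff)
    also have "\<dots> \<longleftrightarrow> (\<forall>p\<in>J. peval p x = 0)"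
      using B ideal_span_vanish[OF _ ring_map_peval] by blast
    finally show "peval (\<Sum>b\<in>B. b * b) x = 0 \<longleftrightarrow> (\<forall>p\<in>J. peval p x = 0)" .
  qed
qed

section \<open>Derivations and curves\<close>

lemma pfun_derivative_exists:
  "\<exists>D. \<forall>x. (peval p has_derivative (\<lambda>v. \<Sum>i\<in>UNIV. peval (D i) x * v $ i)) (at x)"
proof (induction p rule: pfun_induct)
  case (const c)
  have "peval (pconst c) = (\<lambda>x. c)" by auto
  then show ?case by (intro exI[of _ "\<lambda>_. 0"]) simp
next
  case (coord j)
  have "peval (pcoord j) = (\<lambda>x. x $ j)" by auto
  moreover have "(\<Sum>i\<in>UNIV. peval (if i = j then 1 else 0) x * v $ i) = v $ j" for x v :: "real^'a"
    by (simp add: if_distrib[of "\<lambda>p. peval p x"] if_distrib[of "\<lambda>c. c * _"] cong: if_cong)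
  ultimately show ?case
    by (intro exI[of _ "\<lambda>i. if i = j then 1 else 0"])
      (simp add: bounded_linear_imp_has_derivative[OF bounded_linear_vec_nth])
next
  case (add p q)
  then obtain D E where "\<And>x. (peval p has_derivative (\<lambda>v. \<Sum>i\<in>UNIV. peval (D i) x * v $ i)) (at x)"
    "\<And>x. (peval q has_derivative (\<lambda>v. \<Sum>i\<in>UNIV. peval (E i) x * v $ i)) (at x)" by blast
  from has_derivative_add[OF this] have "((\<lambda>x. peval p x + peval q x) has_derivative
     (\<lambda>v. \<Sum>i\<in>UNIV. peval (D i + E i) x * v $ i)) (at x)" for x
    by (simp add: sum.distrib algebra_simps)
  moreover have "peval (p + q) = (\<lambda>x. peval p x + peval q x)" by auto
  ultimately show ?case by (intro exI[of _ "\<lambda>i. D i + E i"]) simp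
next
  case (mult p q)
  then obtain D E where "\<And>x. (peval p has_derivative (\<lambda>v. \<Sum>i\<in>UNIV. peval (D i) x * v $ i)) (at x)"
    "\<And>x. (peval q has_derivative (\<lambda>v. \<Sum>i\<in>UNIV. peval (E i) x * v $ i)) (at x)" by blast
  from has_derivative_mult[OF this] have "((\<lambda>x. peval p x * peval q x) has_derivative
     (\<lambda>v. \<Sum>i\<in>UNIV. peval (p * E i + D i * q) x * v $ i)) (at x)" for x
    by (simp add: sum.distrib algebra_simps sum_distrib_left)
  moreover have "peval (p * q) = (\<lambda>x. peval p x * peval q x)" by auto
  ultimately show ?case by (intro exI[of _ "\<lambda>i. p * E i + D i * q"]) simp
qed

text \<open>Taken by choice from the existence statement. The algebraic rules then follow from
  uniqueness of the derivative instead of a recursion on polynomials.\<close>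

definition pdiff :: "'n::finite pfun \<Rightarrow> 'n \<Rightarrow> 'n pfun" where
  "pdiff p = (SOME D. \<forall>x. (peval p has_derivative (\<lambda>v. \<Sum>i\<in>UNIV. peval (D i) x * v $ i)) (at x))"

lemma has_derivative_peval: "(peval p has_derivative (\<lambda>v. \<Sum>i\<in>UNIV. peval (pdiff p i) x * v $ i)) (at x)"
  using someI_ex[OF pfun_derivative_exists[of p]] unfolding pdiff_def by blast

lemma continuous_on_peval [continuous_intros]: "continuous_on S f \<Longrightarrow> continuous_on S (\<lambda>x. peval p (f x))"
proof -
  have "continuous_on UNIV (peval p)"
    by (intro continuous_at_imp_continuous_on ballI) (rule has_derivative_continuous[OF has_derivative_peval])
  then show "continuous_on S f \<Longrightarrow> continuous_on S (\<lambda>x. peval p (f x))"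
    using continuous_on_compose2[of UNIV "peval p" S f] by simp
qed

lemma open_peval_nz: "open {x. peval p x \<noteq> 0}"
  by (intro open_Collect_neq continuous_intros)

lemma pdiff_unique:
  assumes "(peval p has_derivative (\<lambda>v. \<Sum>i\<in>UNIV. d i * v $ i)) (at x)"
  shows "peval (pdiff p i) x = d i"
proof -
  have "(\<Sum>j\<in>UNIV. peval (pdiff p j) x * axis i 1 $ j) = (\<Sum>j\<in>UNIV. d j * axis i 1 $ j)"
    using has_derivative_unique[OF has_derivative_peval assms] by (rule fun_cong)
  then show ?thesis by (simp add: axis_def if_distrib[of "\<lambda>c. _ * c"] cong: if_cong)
qed

lemma pdiff_add: "pdiff (p + q) i = pdiff p i + pdiff q i"
proof (rule pfun_eqI)
  fix x
  have "peval (p + q) = (\<lambda>x. peval p x + peval q x)" by auto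
  with has_derivative_add[OF has_derivative_peval[of p x] has_derivative_peval[of q x]]
  have "(peval (p + q) has_derivative (\<lambda>v. \<Sum>i\<in>UNIV. (peval (pdiff p i) x + peval (pdiff q i) x) * v $ i)) (at x)"
    by (simp add: sum.distrib algebra_simps)
  from pdiff_unique[OF this] show "peval (pdiff (p + q) i) x = peval (pdiff p i + pdiff q i) x" by simp
qed

lemma pdiff_mult: "pdiff (p * q) i = p * pdiff q i + pdiff p i * q"
proof (rule pfun_eqI)
  fix x
  have "peval (p * q) = (\<lambda>x. peval p x * peval q x)" by auto
  with has_derivative_mult[OF has_derivative_peval[of p x] has_derivative_peval[of q x]]
  have "(peval (p * q) has_derivative (\<lambda>v. \<Sum>i\<in>UNIV. (peval p x * peval (pdiff q i) x + peval (pdiff p i) x * peval q x) * v $ i)) (at x)"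
    by (simp add: sum.distrib algebra_simps sum_distrib_left)
  from pdiff_unique[OF this] show "peval (pdiff (p * q) i) x = peval (p * pdiff q i + pdiff p i * q) x" by simp
qed

lemma peval_along_curve:
  assumes "(g has_vector_derivative u) (at s)"
  shows "((\<lambda>s. peval p (g s)) has_real_derivative (\<Sum>i\<in>UNIV. peval (pdiff p i) (g s) * u $ i)) (at s)"
proof -
  have "((\<lambda>s. peval p (g s)) has_derivative (\<lambda>t. \<Sum>i\<in>UNIV. peval (pdiff p i) (g s) * (t *\<^sub>R u) $ i)) (at s)"
    by (rule has_derivative_compose[OF assms[unfolded has_vector_derivative_def] has_derivative_peval])
  moreover have "(\<lambda>t. \<Sum>i\<in>UNIV. peval (pdiff p i) (g s) * (t *\<^sub>R u) $ i) = (*) (\<Sum>i\<in>UNIV. peval (pdiff p i) (g s) * u $ i)"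
    by (auto simp: sum_distrib_left sum_distrib_right algebra_simps)
  ultimately show ?thesis by (simp add: has_field_derivative_def)
qed

lemma grad_peval: "grad (peval p) x = (\<chi> i. peval (pdiff p i) x)"
proof -
  have "deriv (\<lambda>t. peval p (x + t *\<^sub>R axis i 1)) 0 = peval (pdiff p i) x" for i
  proof -
    have "((\<lambda>t. x + t *\<^sub>R axis i 1) has_vector_derivative axis i 1) (at 0)"
      by (auto intro!: derivative_eq_intros)
    from peval_along_curve[OF this, of p]
    have "((\<lambda>t. peval p (x + t *\<^sub>R axis i 1)) has_real_derivative peval (pdiff p i) x) (at 0)"
      by (simp add: axis_def if_distrib[of "\<lambda>c. _ * c"] cong: if_cong)
    then show ?thesis by (rule DERIV_imp_deriv)
  qed
  then show ?thesis by (simp add: grad_def)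
qed

lemma peval_line_poly: "\<exists>q :: real poly. \<forall>t. peval p (a + t *\<^sub>R v) = poly q t"
proof (induction p rule: pfun_induct)
  case (const c)
  show ?case by (rule exI[of _ "[:c:]"]) simp
next
  case (coord i)
  show ?case by (rule exI[of _ "[:a $ i, v $ i:]"]) simp
next
  case (add p q)
  then show ?case by (metis peval_simps(3) poly_add)
next
  case (mult p q)
  then show ?case by (metis peval_simps(4) poly_mult)
qed

text \<open>On each line through \<open>a\<close> the polynomial becomes univariate and has an
  interval of roots.\<close>

lemma pfun_zero_on_open:
  assumes "open U" "a \<in> U" "\<And>x. x \<in> U \<Longrightarrow> peval p x = 0"
  shows "p = 0"
proof (rule pfun_eqI)
  fix x
  obtain q :: "real poly" where q: "\<And>t. peval p (a + t *\<^sub>R (x - a)) = poly q t" using peval_line_poly by blast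
  have "open ((\<lambda>t. a + t *\<^sub>R (x - a)) -` U)"
    by (intro open_vimage assms continuous_intros)
  moreover have "0 \<in> (\<lambda>t. a + t *\<^sub>R (x - a)) -` U" using assms(2) by simp
  ultimately obtain e where e: "e > 0" "ball 0 e \<subseteq> (\<lambda>t. a + t *\<^sub>R (x - a)) -` U"
    by (meson openE)
  have "q = 0"
  proof (rule ccontr)
    assume "q \<noteq> 0"
    moreover have "poly q t = 0" if "t \<in> {0<..<e}" for t
    proof -
      have "t \<in> ball 0 e" using that by simp
      then have "a + t *\<^sub>R (x - a) \<in> U" using e(2) by blast
      then show ?thesis using assms(3) q[of t] by simp
    qed
    then have "{0<..<e} \<subseteq> {t. poly q t = 0}" by blast
    ultimately show False using poly_roots_finite finite_subset infinite_Ioo[OF e(1)] by blast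
  qed
  then show "peval p x = peval 0 x" using q[of 1] by simp
qed

section \<open>Charts made of coordinates and equations\<close>

definition pmat :: "'n::finite pfun^'m^'k \<Rightarrow> real^'n \<Rightarrow> real^'m^'k" where
  "pmat M x = (\<chi> i j. peval (M $ i $ j) x)"

lemma peval_of_int [simp]: "peval (of_int k) x = of_int k"
proof -
  have "peval (of_nat n) x = of_nat n" for n by (induction n) auto
  then show ?thesis by (cases k rule: int_diff_cases) simp
qed

lemma peval_det: "peval (det M) x = det (pmat M x)"
  by (simp add: det_def pmat_def)

text \<open>The Jacobian matrix of the map \<open>chmap J P\<close>, with polynomial entries so that
  its determinant is again a polynomial.\<close>

definition jac :: "'n::finite set \<Rightarrow> ('n \<Rightarrow> 'n pfun) \<Rightarrow> 'n pfun^'n^'n" where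
  "jac J P = (\<chi> i k. if i \<in> J then (if i = k then 1 else 0) else pdiff (P i) k)"

definition jdet :: "'n::finite set \<Rightarrow> ('n \<Rightarrow> 'n pfun) \<Rightarrow> 'n pfun" where
  "jdet J P = det (jac J P)"

definition chmap :: "'n::finite set \<Rightarrow> ('n \<Rightarrow> 'n pfun) \<Rightarrow> real^'n \<Rightarrow> real^'n" where
  "chmap J P x = (\<chi> i. if i \<in> J then x $ i else peval (P i) x)"

lemma jac_mult: "(pmat (jac J P) x *v v) $ i = (if i \<in> J then v $ i else (\<Sum>k\<in>UNIV. peval (pdiff (P i) k) x * v $ k))"
  by (simp add: pmat_def jac_def matrix_vector_mult_def if_distrib[of "\<lambda>p. peval p x"] if_distrib[of "\<lambda>c. c * _"] cong: if_cong)

lemma has_derivative_chmap: "(chmap J P has_derivative (\<lambda>v. pmat (jac J P) x *v v)) (at x)"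
proof -
  have "((\<lambda>x. chmap J P x $ i) has_derivative (\<lambda>v. (pmat (jac J P) x *v v) $ i)) (at x)" for i
    by (cases "i \<in> J")
      (simp_all add: jac_mult chmap_def bounded_linear_imp_has_derivative[OF bounded_linear_vec_nth] has_derivative_peval)
  then show ?thesis
    unfolding has_derivative_componentwise_within[of "chmap J P"]
    by (auto simp: Basis_vec_def inner_axis)
qed

lemma local_inverse:
  assumes "peval (jdet J P) z \<noteq> 0"
  obtains r \<Phi> N where "0 < r" "open N" "z \<in> N"
    "\<And>x. x \<in> N \<Longrightarrow> chmap J P x \<in> ball (chmap J P z) r \<and> \<Phi> (chmap J P x) = x"
    "\<And>y. y \<in> ball (chmap J P z) r \<Longrightarrow> chmap J P (\<Phi> y) = y \<and> peval (jdet J P) (\<Phi> y) \<noteq> 0"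
    "\<And>y. y \<in> ball (chmap J P z) r \<Longrightarrow> \<exists>u. (\<Phi> has_derivative u) (at y) \<and> (\<forall>v. pmat (jac J P) (\<Phi> y) *v u v = v)"
proof -
  define U where "U = {x. peval (jdet J P) x \<noteq> 0}"
  define f' where "f' x = Blinfun (\<lambda>v. pmat (jac J P) x *v v)" for x
  have f': "blinfun_apply (f' x) = (\<lambda>v. pmat (jac J P) x *v v)" for x
    unfolding f'_def by (rule bounded_linear_Blinfun_apply) simp
  obtain B where B: "B ** pmat (jac J P) z = mat 1"
    using assms unfolding jdet_def peval_det by (metis invertible_det_nz invertible_left_inverse)
  define Bf where "Bf = Blinfun (\<lambda>v. B *v v)"
  have Bf: "blinfun_apply Bf = (\<lambda>v. B *v v)" unfolding Bf_def by (rule bounded_linear_Blinfun_apply) simp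
  have "continuous_on U f'"
  proof (rule continuous_on_blinfun_componentwise)
    fix i :: "real^'a"
    have "continuous_on U (\<lambda>x. \<chi> k. if k \<in> J then i $ k else (\<Sum>l\<in>UNIV. peval (pdiff (P k) l) x * i $ l))"
    proof (rule continuous_on_vec_lambda)
      fix k show "continuous_on U (\<lambda>x. if k \<in> J then i $ k else (\<Sum>l\<in>UNIV. peval (pdiff (P k) l) x * i $ l))"
        by (cases "k \<in> J") (auto intro!: continuous_intros)
    qed
    moreover have "blinfun_apply (f' x) i = (\<chi> k. if k \<in> J then i $ k else (\<Sum>l\<in>UNIV. peval (pdiff (P k) l) x * i $ l))" for x
      unfolding f' by (simp add: vec_eq_iff jac_mult)
    ultimately show "continuous_on U (\<lambda>x. blinfun_apply (f' x) i)" by simp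
  qed
  moreover have "open U" unfolding U_def by (rule open_peval_nz)
  moreover have "z \<in> U" using assms by (simp add: U_def)
  moreover have "(chmap J P has_derivative blinfun_apply (f' x)) (at x)" for x unfolding f' by (rule has_derivative_chmap)
  moreover have "Bf o\<^sub>L f' z = id_blinfun"
    by (rule blinfun_eqI) (simp add: Bf f' matrix_vector_mul_assoc B)
  ultimately obtain U' W g g' where W: "open U'" "U' \<subseteq> U" "z \<in> U'" "open W" "chmap J P z \<in> W"
    "homeomorphism U' W (chmap J P) g"
    "\<And>y. y \<in> W \<Longrightarrow> (g has_derivative (g' y)) (at y)"
    "\<And>y. y \<in> W \<Longrightarrow> g' y = inv_into UNIV (blinfun_apply (f' (g y)))"
    "\<And>y. y \<in> W \<Longrightarrow> bij (blinfun_apply (f' (g y)))"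
    using inverse_function_theorem[of U "chmap J P" f' z Bf] by metis
  obtain r where r: "r > 0" "ball (chmap J P z) r \<subseteq> W" using W(4,5) open_contains_ball by blast
  have hom: "\<And>x. x \<in> U' \<Longrightarrow> g (chmap J P x) = x" "\<And>y. y \<in> W \<Longrightarrow> chmap J P (g y) = y" "g ` W = U'"
    "continuous_on U' (chmap J P)"
    using W(6) unfolding homeomorphism_def by auto
  define N where "N = U' \<inter> chmap J P -` ball (chmap J P z) r"
  have "open N" unfolding N_def by (rule continuous_open_preimage[OF hom(4) W(1)]) simp
  moreover have "z \<in> N" using W(3) r by (simp add: N_def)
  moreover have "chmap J P x \<in> ball (chmap J P z) r \<and> g (chmap J P x) = x" if "x \<in> N" for x
    using that hom(1) by (simp add: N_def)
  moreover have "chmap J P (g y) = y \<and> peval (jdet J P) (g y) \<noteq> 0" if "y \<in> ball (chmap J P z) r" for y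
  proof -
    have "y \<in> W" using that r by auto
    then show ?thesis using hom(2,3) W(2) by (force simp: U_def)
  qed
  moreover have "\<exists>u. (g has_derivative u) (at y) \<and> (\<forall>v. pmat (jac J P) (g y) *v u v = v)" if "y \<in> ball (chmap J P z) r" for y
  proof -
    have y: "y \<in> W" using that r by auto
    have "pmat (jac J P) (g y) *v g' y v = v" for v
      using surj_f_inv_f[OF bij_is_surj[OF W(9)[OF y]], of v] W(8)[OF y] by (simp add: f')
    then show ?thesis using W(7)[OF y] by blast
  qed
  ultimately show ?thesis using that r(1) by blast
qed

section \<open>Polynomial derivations and their integral curves\<close>

text \<open>Cramer's numerator: a coordinate of the vector that the Jacobian sends to
  \<open>w\<close>, multiplied by the determinant and hence polynomial.\<close>

definition tau :: "'n::finite set \<Rightarrow> ('n \<Rightarrow> 'n pfun) \<Rightarrow> real^'n \<Rightarrow> 'n \<Rightarrow> 'n pfun" where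
  "tau J P w k = det (\<chi> a b. if b = k then pconst (w $ a) else jac J P $ a $ b)"

lemma tau: 
  assumes "pmat (jac J P) x *v u = w" shows "peval (tau J P w k) x = u $ k * peval (jdet J P) x"
proof -
  have "pmat (\<chi> a b. if b = k then pconst (w $ a) else jac J P $ a $ b) x =
     (\<chi> i j. if j = k then (pmat (jac J P) x *v u) $ i else pmat (jac J P) x $ i $ j)"
    unfolding assms by (simp add: pmat_def vec_eq_iff)
  then show ?thesis unfolding tau_def jdet_def peval_det by (simp add: cramer_lemma)
qed

text \<open>This is \<open>jdet J P\<close> times the derivative in the chart direction
  \<open>w\<close>; the factor clears the denominator of Cramer's rule.\<close>

definition vfield :: "'n::finite set \<Rightarrow> ('n \<Rightarrow> 'n pfun) \<Rightarrow> real^'n \<Rightarrow> 'n pfun \<Rightarrow> 'n pfun" where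
  "vfield J P w p = (\<Sum>k\<in>UNIV. pdiff p k * tau J P w k)"

lemma vfield_add: "vfield J P w (p + q) = vfield J P w p + vfield J P w q"
  by (simp add: vfield_def pdiff_add algebra_simps sum.distrib)

lemma vfield_mult: "vfield J P w (p * q) = p * vfield J P w q + q * vfield J P w p"
  by (simp add: vfield_def pdiff_mult algebra_simps sum.distrib sum_distrib_left)

lemma vfield_zero: "vfield J P w 0 = 0"
  using vfield_add[of J P w 0 0] by simp

text \<open>An integral curve of the field \<open>vfield\<close> divided by \<open>jdet\<close>,
  described by its action on polynomials. Derivatives at both ends of the interval are
  two-sided.\<close>

definition icurve :: "'n::finite set \<Rightarrow> ('n \<Rightarrow> 'n pfun) \<Rightarrow> real^'n \<Rightarrow> (real \<Rightarrow> real^'n) \<Rightarrow> real \<Rightarrow> bool" where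
  "icurve J P w g T \<longleftrightarrow> (\<forall>s\<in>{0..T}. peval (jdet J P) (g s) \<noteq> 0 \<and>
     (\<forall>p. ((\<lambda>s. peval p (g s)) has_real_derivative peval (vfield J P w p) (g s) / peval (jdet J P) (g s)) (at s)))"

lemma icurve_continuous: "icurve J P w g T \<Longrightarrow> continuous_on {0..T} (\<lambda>s. peval p (g s))"
  by (intro continuous_at_imp_continuous_on) (auto simp: icurve_def intro: DERIV_isCont)

text \<open>Straight lines in chart coordinates become integral curves: the derivative of the local
  inverse solves the linear system behind \<open>tau\<close>.\<close>

lemma icurve_chart:
  assumes \<Phi>: "\<And>y. y \<in> ball c r \<Longrightarrow> peval (jdet J P) (\<Phi> y) \<noteq> 0"
    "\<And>y. y \<in> ball c r \<Longrightarrow> \<exists>u. (\<Phi> has_derivative u) (at y) \<and> (\<forall>v. pmat (jac J P) (\<Phi> y) *v u v = v)"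
    and w: "\<And>s. s \<in> {0..T} \<Longrightarrow> c + s *\<^sub>R w \<in> ball c r"
  shows "icurve J P w (\<lambda>s. \<Phi> (c + s *\<^sub>R w)) T"
  unfolding icurve_def
proof (intro ballI conjI allI)
  fix s p assume s: "s \<in> {0..T}"
  show nz: "peval (jdet J P) (\<Phi> (c + s *\<^sub>R w)) \<noteq> 0" by (rule \<Phi>(1)[OF w[OF s]])
  obtain u where u: "(\<Phi> has_derivative u) (at (c + s *\<^sub>R w))" "\<And>v. pmat (jac J P) (\<Phi> (c + s *\<^sub>R w)) *v u v = v"
    using \<Phi>(2)[OF w[OF s]] by blast
  have "((\<lambda>s. c + s *\<^sub>R w) has_derivative (\<lambda>t. t *\<^sub>R w)) (at s)" by (auto intro!: derivative_eq_intros)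
  from has_derivative_compose[OF this u(1)]
  have "((\<lambda>s. \<Phi> (c + s *\<^sub>R w)) has_derivative (\<lambda>t. u (t *\<^sub>R w))) (at s)" .
  moreover have "(\<lambda>t. u (t *\<^sub>R w)) = (\<lambda>t. t *\<^sub>R u w)" using has_derivative_linear[OF u(1)] by (auto simp: linear_scale)
  ultimately have "((\<lambda>s. \<Phi> (c + s *\<^sub>R w)) has_vector_derivative u w) (at s)" by (simp add: has_vector_derivative_def)
  from peval_along_curve[OF this, of p]
  have "((\<lambda>s. peval p (\<Phi> (c + s *\<^sub>R w))) has_real_derivative (\<Sum>i\<in>UNIV. peval (pdiff p i) (\<Phi> (c + s *\<^sub>R w)) * u w $ i)) (at s)" .
  moreover have "(\<Sum>i\<in>UNIV. peval (pdiff p i) (\<Phi> (c + s *\<^sub>R w)) * u w $ i) =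
      peval (vfield J P w p) (\<Phi> (c + s *\<^sub>R w)) / peval (jdet J P) (\<Phi> (c + s *\<^sub>R w))"
    using nz by (simp add: vfield_def tau[OF u(2)] sum_divide_distrib)
  ultimately show "((\<lambda>s. peval p (\<Phi> (c + s *\<^sub>R w))) has_real_derivative
      peval (vfield J P w p) (\<Phi> (c + s *\<^sub>R w)) / peval (jdet J P) (\<Phi> (c + s *\<^sub>R w))) (at s)" by simp
qed

text \<open>The product \<open>exp (- C * s) * E s\<close> is nonincreasing and starts at
  zero.\<close>

lemma gronwall_zero:
  fixes E :: "real \<Rightarrow> real"
  assumes d: "\<And>s. s \<in> {0..T} \<Longrightarrow> (E has_real_derivative E' s) (at s)"
    and E': "\<And>s. s \<in> {0..T} \<Longrightarrow> E' s \<le> C * E s" and E: "E 0 = 0" "\<And>s. s \<in> {0..T} \<Longrightarrow> 0 \<le> E s" and s: "s \<in> {0..T}"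
  shows "E s = 0"
proof -
  have "exp (- C * s) * E s \<le> exp (- C * 0) * E 0"
  proof (rule DERIV_nonpos_imp_nonincreasing[where f = "\<lambda>s. exp (- C * s) * E s"])
    show "0 \<le> s" using s by simp
    fix t assume "0 \<le> t" "t \<le> s"
    then have t: "t \<in> {0..T}" using s by simp
    have "((\<lambda>s. exp (- C * s) * E s) has_real_derivative exp (- C * t) * (E' t - C * E t)) (at t)"
      by (rule derivative_eq_intros d[OF t] refl | simp add: algebra_simps)+
    moreover have "exp (- C * t) * (E' t - C * E t) \<le> 0" using E'[OF t] by (intro mult_nonneg_nonpos) auto
    ultimately show "\<exists>y. ((\<lambda>s. exp (- C * s) * E s) has_real_derivative y) (at t) \<and> y \<le> 0" by blast
  qed
  then have "E s \<le> 0" using E(1) by (simp add: mult_le_0_iff)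
  then show ?thesis using E(2)[OF s] by simp
qed

lemma ideal_span_finite_sum:
  assumes "finite B" "x \<in> ideal_span UNIV B"
  shows "\<exists>c. x = (\<Sum>b\<in>B. c b * b)"
  using assms(2)
proof (induction rule: ideal_span.induct)
  case zero
  show ?case by (intro exI[of _ "\<lambda>_. 0"]) simp
next
  case (step x k b)
  then obtain c where c: "x = (\<Sum>b\<in>B. c b * b)" by blast
  have "(\<Sum>b'\<in>B. (c(b := c b + k)) b' * b') = (\<Sum>b'\<in>B. c b' * b' + (if b' = b then k * b else 0))"
    by (rule sum.cong) (auto simp: algebra_simps)
  also have "\<dots> = x + k * b" using assms(1) step(3) by (simp add: sum.distrib c)
  finally show ?case by metis
qed

text \<open>The generators satisfy a homogeneous linear differential equation along the curve.\<close>

lemma invariant_ideal_vanishes: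
  fixes \<aa> :: "'n::finite pfun set"
  assumes \<aa>: "0 \<in> \<aa>" "\<And>x y. x \<in> \<aa> \<Longrightarrow> y \<in> \<aa> \<Longrightarrow> x + y \<in> \<aa>" "\<And>k x. x \<in> \<aa> \<Longrightarrow> k * x \<in> \<aa>"
    and inv: "\<And>a. a \<in> \<aa> \<Longrightarrow> jdet J P * vfield J P w a \<in> \<aa>"
    and g: "icurve J P w g T" and z: "\<And>a. a \<in> \<aa> \<Longrightarrow> peval a (g 0) = 0"
    and a: "a \<in> \<aa>" and s: "s \<in> {0..T}"
  shows "peval a (g s) = 0"
proof -
  obtain B where B: "finite B" "B \<subseteq> \<aa>" "\<aa> \<subseteq> ideal_span UNIV B" using pfun_ideal_generators[OF \<aa>] .
  have "\<forall>b\<in>B. \<exists>c. jdet J P * vfield J P w b = (\<Sum>b'\<in>B. c b' * b')"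
    using ideal_span_finite_sum[OF B(1)] inv B(2,3) by blast
  then obtain c where c: "\<And>b. b \<in> B \<Longrightarrow> jdet J P * vfield J P w b = (\<Sum>b'\<in>B. c b b' * b')" by metis
  let ?d = "\<lambda>s. peval (jdet J P) (g s)"
  have nz: "?d t \<noteq> 0" if "t \<in> {0..T}" for t using g that by (simp add: icurve_def)
  \<comment> \<open>The coefficients of the linear system carry the square of the determinant in the
    denominator: one factor comes from the speed of the curve, the other from the invariance of the
    ideal. They are bounded on the compact interval.\<close>
  have "\<exists>M. \<forall>t\<in>{0..T}. \<bar>peval (c b b') (g t) / (?d t)\<^sup>2\<bar> \<le> M" for b b'
  proof -
    have "continuous_on {0..T} (\<lambda>t. peval (c b b') (g t) / (?d t)\<^sup>2)"
      using nz by (intro continuous_intros icurve_continuous[OF g]) auto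
    then have "bounded ((\<lambda>t. peval (c b b') (g t) / (?d t)\<^sup>2) ` {0..T})"
      by (intro compact_imp_bounded compact_continuous_image) auto
    then show ?thesis unfolding bounded_iff by auto
  qed
  then obtain M where M: "\<And>b b' t. t \<in> {0..T} \<Longrightarrow> \<bar>peval (c b b') (g t) / (?d t)\<^sup>2\<bar> \<le> M b b'" by metis
  define m where "m = (\<Sum>b\<in>B. \<Sum>b'\<in>B. M b b')"
  have M0: "0 \<le> M b b'" for b b' using M[OF s, of b b'] by (meson abs_ge_zero order_trans)
  have Mm: "M b b' \<le> m" if "b \<in> B" "b' \<in> B" for b b'
  proof -
    have "M b b' \<le> (\<Sum>b'\<in>B. M b b')" using that B(1) M0 by (intro member_le_sum) auto
    also have "\<dots> \<le> m" unfolding m_def using that B(1) M0 by (intro member_le_sum) (auto intro: sum_nonneg)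
    finally show ?thesis .
  qed
  \<comment> \<open>The sum of the squares of the generators turns the linear system into one
    differential inequality, to which \<open>gronwall_zero\<close> applies.\<close>
  define E where "E t = (\<Sum>b\<in>B. (peval b (g t))\<^sup>2)" for t
  define E' where "E' t = (\<Sum>b\<in>B. 2 * peval b (g t) * (peval (vfield J P w b) (g t) / ?d t))" for t
  have "E s = 0"
  proof (rule gronwall_zero[where E = E and E' = E' and C = "2 * m * card B" and T = T and s = s])
    fix t assume t: "t \<in> {0..T}"
    show "(E has_real_derivative E' t) (at t)"
      unfolding E_def E'_def
    proof (intro DERIV_sum)
      fix b
      have "((\<lambda>s. peval b (g s)) has_real_derivative peval (vfield J P w b) (g t) / ?d t) (at t)"
        using g t by (simp add: icurve_def)
      from DERIV_power[OF this, of 2]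
      show "((\<lambda>t. (peval b (g t))\<^sup>2) has_real_derivative 2 * peval b (g t) * (peval (vfield J P w b) (g t) / ?d t)) (at t)"
        by (simp add: algebra_simps)
    qed
    have vf: "peval (vfield J P w b) (g t) / ?d t = (\<Sum>b'\<in>B. peval (c b b') (g t) / (?d t)\<^sup>2 * peval b' (g t))" if "b \<in> B" for b
    proof -
      have "?d t * peval (vfield J P w b) (g t) = (\<Sum>b'\<in>B. peval (c b b') (g t) * peval b' (g t))"
        using arg_cong[OF c[OF that], of "\<lambda>p. peval p (g t)"] by simp
      then have "peval (vfield J P w b) (g t) / ?d t = (\<Sum>b'\<in>B. peval (c b b') (g t) * peval b' (g t)) / (?d t)\<^sup>2"
        using nz[OF t] by (simp add: field_simps power2_eq_square)
      then show ?thesis by (simp add: sum_divide_distrib)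
    qed
    have "E' t = (\<Sum>b\<in>B. \<Sum>b'\<in>B. (peval (c b b') (g t) / (?d t)\<^sup>2) * (2 * peval b (g t) * peval b' (g t)))"
      unfolding E'_def by (intro sum.cong refl) (simp add: vf sum_distrib_left algebra_simps)
    also have "\<dots> \<le> (\<Sum>b\<in>B. \<Sum>b'\<in>B. m * ((peval b (g t))\<^sup>2 + (peval b' (g t))\<^sup>2))"
    proof (intro sum_mono)
      fix b b' assume b: "b \<in> B" "b' \<in> B"
      let ?x = "peval b (g t)" and ?y = "peval b' (g t)"
      have "(peval (c b b') (g t) / (?d t)\<^sup>2) * (2 * ?x * ?y) \<le> \<bar>peval (c b b') (g t) / (?d t)\<^sup>2\<bar> * \<bar>2 * ?x * ?y\<bar>"
        by (metis abs_ge_self abs_mult)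
      also have "\<dots> \<le> m * (?x\<^sup>2 + ?y\<^sup>2)"
      proof (intro mult_mono)
        show "\<bar>peval (c b b') (g t) / (?d t)\<^sup>2\<bar> \<le> m" using M[OF t] Mm[OF b] order_trans by blast
        show "\<bar>2 * ?x * ?y\<bar> \<le> ?x\<^sup>2 + ?y\<^sup>2"
          using sum_squares_bound[of ?x ?y] sum_squares_bound[of "- ?x" ?y] by (simp add: abs_le_iff)
        show "0 \<le> m" using Mm[OF b] M0[of b b'] by linarith
      qed simp
      finally show "(peval (c b b') (g t) / (?d t)\<^sup>2) * (2 * ?x * ?y) \<le> m * (?x\<^sup>2 + ?y\<^sup>2)" .
    qed
    also have "\<dots> = 2 * m * card B * E t"
      by (simp add: E_def sum.distrib sum_distrib_left[symmetric] algebra_simps)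
    finally show "E' t \<le> 2 * m * card B * E t" .
    show "0 \<le> E t" by (simp add: E_def sum_nonneg)
  next
    show "E 0 = 0" unfolding E_def using z B(2) by (intro sum.neutral) auto
  qed (use s in auto)
  then have "\<forall>b\<in>B. peval b (g s) = 0" unfolding E_def using B(1) by (simp add: sum_nonneg_eq_0_iff)
  then show ?thesis using ideal_span_vanish[OF _ ring_map_peval[of "g s"], of a UNIV B] a B(3) by blast
qed

text \<open>By the Leibniz rule, the polynomials whose iterated derivatives all vanish at the start
  form an ideal stable under the derivation. Its finite generation takes the place of analyticity of
  the curve.\<close>

lemma flat_vanishes:
  assumes g: "icurve J P w g T" and z: "\<And>m. peval ((vfield J P w ^^ m) q) (g 0) = 0" and s: "s \<in> {0..T}"
  shows "peval q (g s) = 0"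
proof -
  let ?D = "vfield J P w"
  define \<aa> where "\<aa> = {a. \<forall>m. peval ((?D ^^ m) a) (g 0) = 0}"
  have add: "(?D ^^ m) (p + q) = (?D ^^ m) p + (?D ^^ m) q" for m p q
    by (induction m) (auto simp: vfield_add)
  have D: "?D a \<in> \<aa>" if "a \<in> \<aa>" for a
  proof -
    have "(?D ^^ m) (?D a) = (?D ^^ Suc m) a" for m by (simp add: funpow_swap1)
    moreover have "peval ((?D ^^ Suc m) a) (g 0) = 0" for m using that unfolding \<aa>_def by blast
    ultimately show ?thesis unfolding \<aa>_def mem_Collect_eq by metis
  qed
  have mult: "a \<in> \<aa> \<Longrightarrow> peval ((?D ^^ m) (k * a)) (g 0) = 0" for m k a
  proof (induction m arbitrary: k a)
    case 0
    then have "peval ((?D ^^ 0) a) (g 0) = 0" unfolding \<aa>_def by blast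
    then show ?case by simp
  next
    case (Suc m)
    have "(?D ^^ Suc m) (k * a) = (?D ^^ m) (k * ?D a) + (?D ^^ m) (?D k * a)"
      by (simp add: funpow_swap1 vfield_mult add mult.commute)
    then show ?case using Suc.IH[OF D[OF Suc.prems], of k] Suc.IH[OF Suc.prems, of "?D k"] by simp
  qed
  show ?thesis
  proof (rule invariant_ideal_vanishes[where \<aa> = \<aa>, OF _ _ _ _ g])
    have "(?D ^^ m) 0 = 0" for m by (induction m) (auto simp: vfield_zero)
    then show "0 \<in> \<aa>" by (simp add: \<aa>_def)
    show "x + y \<in> \<aa>" if "x \<in> \<aa>" "y \<in> \<aa>" for x y using that by (simp add: \<aa>_def add)
    show km: "k * x \<in> \<aa>" if "x \<in> \<aa>" for k x using mult[OF that] by (simp add: \<aa>_def)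
    show "jdet J P * ?D a \<in> \<aa>" if "a \<in> \<aa>" for a by (rule km[OF D[OF that]])
    show "peval a (g 0) = 0" if "a \<in> \<aa>" for a
    proof -
      have "peval ((?D ^^ 0) a) (g 0) = 0" using that unfolding \<aa>_def by blast
      then show ?thesis by simp
    qed
    show "q \<in> \<aa>" using z by (simp add: \<aa>_def)
  qed (rule s)
qed

text \<open>The leading Taylor term along the curve, by induction on \<open>m\<close> with
  l'Hospital's rule. A derivative along the curve is \<open>vfield\<close> divided by
  \<open>jdet\<close>, which accounts for the power of the determinant.\<close>

lemma curve_expansion:
  assumes g: "icurve J P w g T" and T: "0 < T"
    and z: "\<And>k. k < m \<Longrightarrow> peval ((vfield J P w ^^ k) q) (g 0) = 0"
  shows "((\<lambda>s. peval q (g s) / s ^ m) \<longlongrightarrow>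
    peval ((vfield J P w ^^ m) q) (g 0) / (peval (jdet J P) (g 0) ^ m * fact m)) (at_right 0)"
proof -
  have cont: "((\<lambda>s. peval p (g s)) \<longlongrightarrow> peval p (g 0)) (at_right 0)" for p
  proof -
    have "((\<lambda>s. peval p (g s)) has_real_derivative peval (vfield J P w p) (g 0) / peval (jdet J P) (g 0)) (at 0)"
      using g T by (simp add: icurve_def)
    then have "isCont (\<lambda>s. peval p (g s)) 0" by (rule DERIV_isCont)
    then show ?thesis by (simp add: isCont_def filterlim_at_split)
  qed
  have ev: "eventually (\<lambda>s. s \<in> {0<..T}) (at_right 0)"
    using T by (auto simp: eventually_at_right_field intro!: exI[of _ T])
  show ?thesis using z
proof (induction m arbitrary: q)
  case 0
  show ?case using cont[of q] by simp
next
  case (Suc m)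
  let ?D = "vfield J P w" and ?d = "\<lambda>s. peval (jdet J P) (g s)"
  have d0: "?d 0 \<noteq> 0" using g T by (simp add: icurve_def)
  have sw: "(?D ^^ k) (?D q) = (?D ^^ Suc k) q" for k by (simp add: funpow_swap1)
  have IH: "((\<lambda>s. peval (?D q) (g s) / s ^ m) \<longlongrightarrow> peval ((?D ^^ Suc m) q) (g 0) / (?d 0 ^ m * fact m)) (at_right 0)"
  proof -
    have "peval ((?D ^^ k) (?D q)) (g 0) = 0" if "k < m" for k
      unfolding sw using Suc.prems[of "Suc k"] that by blast
    from Suc.IH[OF this] show ?thesis unfolding sw .
  qed
  have "((\<lambda>s. peval q (g s) / s ^ Suc m) \<longlongrightarrow> peval ((?D ^^ Suc m) q) (g 0) / (?d 0 ^ m * fact m) / ?d 0 / real (Suc m)) (at_right 0)"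
  proof (rule lhopital_right_0)
    show "((\<lambda>s. peval q (g s)) \<longlongrightarrow> 0) (at_right 0)" using cont[of q] Suc.prems[of 0] by simp
    show "((\<lambda>s. s ^ Suc m) \<longlongrightarrow> 0) (at_right (0::real))"
      by (auto intro!: tendsto_eq_intros)
    show "\<forall>\<^sub>F s in at_right 0. s ^ Suc m \<noteq> (0::real)" using ev by eventually_elim auto
    show "\<forall>\<^sub>F s in at_right 0. real (Suc m) * s ^ m \<noteq> 0" using ev by eventually_elim auto
    show "\<forall>\<^sub>F s in at_right 0. ((\<lambda>s. peval q (g s)) has_real_derivative peval (?D q) (g s) / ?d s) (at s)"
      using ev by eventually_elim (use g in \<open>auto simp: icurve_def\<close>)
    show "\<forall>\<^sub>F s in at_right 0. ((\<lambda>s. s ^ Suc m) has_real_derivative real (Suc m) * s ^ m) (at s)"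
      by (rule always_eventually) (auto intro!: derivative_eq_intros simp del: power_Suc)
    have "((\<lambda>s. peval (?D q) (g s) / s ^ m / ?d s / real (Suc m)) \<longlongrightarrow> peval ((?D ^^ Suc m) q) (g 0) / (?d 0 ^ m * fact m) / ?d 0 / real (Suc m)) (at_right 0)"
      by (intro tendsto_divide IH cont tendsto_const d0) simp
    then show "((\<lambda>s. peval (?D q) (g s) / ?d s / (real (Suc m) * s ^ m)) \<longlongrightarrow> peval ((?D ^^ Suc m) q) (g 0) / (?d 0 ^ m * fact m) / ?d 0 / real (Suc m)) (at_right 0)"
      by (simp add: divide_divide_eq_left mult_ac)
  qed
  then show ?case by (simp add: divide_divide_eq_left mult_ac del: funpow.simps)
qed
qed

section \<open>Smooth varieties\<close>

lemma poly_fun_range: "poly_fun = range (peval :: 'n::finite pfun \<Rightarrow> _)"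
  using type_definition.Rep_range[OF type_definition_pfun] by blast

lemma algebraic_set_iff: "algebraic_set Z \<longleftrightarrow> (\<exists>A :: 'n::finite pfun set. Z = {x. \<forall>p\<in>A. peval p x = 0})"
proof
  assume "algebraic_set Z"
  then obtain S where S: "S \<subseteq> poly_fun" "Z = zero_set S" by (auto simp: algebraic_set_def)
  then have "Z = {x. \<forall>p\<in>{p. peval p \<in> S}. peval p x = 0}"
    unfolding zero_set_def poly_fun_range by (auto simp: subset_iff image_iff)
  then show "\<exists>A :: 'n pfun set. Z = {x. \<forall>p\<in>A. peval p x = 0}" by blast
next
  assume "\<exists>A :: 'n pfun set. Z = {x. \<forall>p\<in>A. peval p x = 0}"
  then obtain A :: "'n pfun set" where "Z = {x. \<forall>p\<in>A. peval p x = 0}" by blast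
  then have "Z = zero_set (peval ` A)" "peval ` A \<subseteq> poly_fun"
    by (auto simp: zero_set_def poly_fun_range)
  then show "algebraic_set Z" by (auto simp: algebraic_set_def)
qed

lemma independent_rows_of_regular:
  fixes A :: "real^'n^'n"
  assumes "det A \<noteq> 0"
  shows "independent ((\<lambda>i. A $ i) ` I)" "card ((\<lambda>i. A $ i) ` I) = card I"
proof -
  let ?f = "\<lambda>v. transpose A *v v"
  have "invertible (transpose A)" using assms by (simp add: invertible_det_nz det_transpose)
  then have inj: "inj ?f" by (rule inj_matrix_vector_mult)
  have e: "?f (axis i 1) = A $ i" for i
    by (simp add: matrix_vector_mult_basis column_def transpose_def vec_eq_iff)
  have "(\<lambda>i. A $ i) ` I = ?f ` ((\<lambda>i. axis i 1) ` I)" by (simp only: image_image e)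
  moreover have "independent (?f ` ((\<lambda>i. axis i (1::real)) ` I))"
  proof (rule linear_independent_injective_image)
    show "linear ?f" by (rule matrix_vector_mul_linear)
    show "independent ((\<lambda>i. axis i (1::real)) ` I)"
      by (rule independent_mono[OF independent_Basis]) (auto simp: axis_in_Basis_iff)
    show "inj_on ?f (span ((\<lambda>i. axis i (1::real)) ` I))" using inj by (rule inj_on_subset) simp
  qed
  ultimately show "independent ((\<lambda>i. A $ i) ` I)" by simp
  have "inj_on (\<lambda>i. A $ i) I"
  proof (rule inj_onI)
    fix i j assume "A $ i = A $ j"
    then have "?f (axis i 1) = ?f (axis j 1)" by (simp only: e)
    then have "axis i (1::real) = axis j 1" using inj by (rule injD[rotated])
    then show "i = j" by (simp add: axis_eq_axis)
  qed
  then show "card ((\<lambda>i. A $ i) ` I) = card I" by (rule card_image)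
qed

text \<open>The number \<open>c\<close> is the codimension, and dimension is expressed through this
  constant rank of the gradients. In the end it is \<open>CARD('n) - alg_dim V\<close>.\<close>

locale smooth_variety =
  fixes V :: "(real^'n::finite) set" and c :: nat
  assumes irr: "irreducible_alg V"
    and rank: "\<And>x. x \<in> V \<Longrightarrow> dim {grad p x |p. p \<in> van_ideal V} = c"
begin

definition IV :: "'n pfun set" where "IV = {p. \<forall>x\<in>V. peval p x = 0}"

lemma IV_D: "p \<in> IV \<Longrightarrow> x \<in> V \<Longrightarrow> peval p x = 0"
  by (simp add: IV_def)

lemma IV_ideal: "0 \<in> IV" "p \<in> IV \<Longrightarrow> q \<in> IV \<Longrightarrow> p + q \<in> IV" "p \<in> IV \<Longrightarrow> k * p \<in> IV"
  by (auto simp: IV_def)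

lemma V_nonempty: "V \<noteq> {}"
  using irr by (simp add: irreducible_alg_def)

lemma V_iff: "x \<in> V \<longleftrightarrow> (\<forall>p\<in>IV. peval p x = 0)"
proof -
  have "algebraic_set V" using irr by (simp add: irreducible_alg_def)
  then obtain A where A: "V = {x. \<forall>p\<in>A. peval p x = 0}" using algebraic_set_iff by blast
  then have "A \<subseteq> IV" unfolding IV_def by blast
  show ?thesis
  proof
    show "x \<in> V \<Longrightarrow> \<forall>p\<in>IV. peval p x = 0" using IV_D by blast
    show "\<forall>p\<in>IV. peval p x = 0 \<Longrightarrow> x \<in> V" using A \<open>A \<subseteq> IV\<close> by blast
  qed
qed

lemma IV_prime: "p * q \<in> IV \<Longrightarrow> p \<in> IV \<or> q \<in> IV"
proof -
  assume pq: "p * q \<in> IV"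
  let ?Z = "\<lambda>p. {x. \<forall>f\<in>insert p IV. peval f x = 0}"
  have "peval p x = 0 \<or> peval q x = 0" if "x \<in> V" for x using IV_D[OF pq that] by simp
  then have "x \<in> V \<longleftrightarrow> x \<in> ?Z p \<union> ?Z q" for x using V_iff[of x] by auto
  then have "V = ?Z p \<union> ?Z q" by blast
  moreover have "algebraic_set (?Z p)" "algebraic_set (?Z q)" unfolding algebraic_set_iff by blast+
  ultimately have "V = ?Z p \<or> V = ?Z q" using irr unfolding irreducible_alg_def by blast
  then show ?thesis unfolding IV_def by blast
qed

lemma IV_one: "1 \<notin> IV"
  using V_nonempty by (auto simp: IV_def)

lemma V_equation: obtains v where "v \<in> IV" "\<And>x. peval v x = 0 \<longleftrightarrow> x \<in> V"
  using ideal_single_equation[of IV] IV_ideal V_iff by metis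

lemma van_ideal_eq: "van_ideal V = peval ` IV"
  unfolding van_ideal_def IV_def poly_fun_range by auto

text \<open>The indices in \<open>J\<close> stand for free coordinates, the other \<open>c\<close>
  slots of the chart are filled with equations of \<open>V\<close>. Regularity of the chart at a
  point is the separate condition that \<open>jdet\<close> is nonzero there.\<close>

definition tangent_chart :: "'n set \<Rightarrow> ('n \<Rightarrow> 'n pfun) \<Rightarrow> bool" where
  "tangent_chart J P \<longleftrightarrow> card (- J) = c \<and> (\<forall>i. i \<notin> J \<longrightarrow> P i \<in> IV)"

lemma grads_eq: "{grad p x |p. p \<in> van_ideal V} = (\<lambda>p. \<chi> i. peval (pdiff p i) x) ` IV"
proof -
  have "{grad p x |p. p \<in> van_ideal V} = (\<lambda>p. grad (peval p) x) ` IV" unfolding van_ideal_eq by blast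
  then show ?thesis by (simp only: grad_peval)
qed

text \<open>A basis of the span of the gradients at \<open>z\<close>, completed by unit vectors,
  provides the rows of an invertible Jacobian. The set \<open>J\<close> collects the indices of
  these unit vectors.\<close>

lemma tangent_chart_exists:
  assumes z: "z \<in> V"
  obtains J P where "tangent_chart J P" "peval (jdet J P) z \<noteq> 0"
proof -
  let ?g = "\<lambda>p. (\<chi> i. peval (pdiff p i) z) :: real^'n"
  obtain B where B: "B \<subseteq> ?g ` IV" "independent B" "card B = c"
    using basis_exists[of "?g ` IV"] rank[OF z] unfolding grads_eq by metis
  obtain B' where B': "B \<subseteq> B'" "B' \<subseteq> B \<union> Basis" "independent B'" "B \<union> Basis \<subseteq> span B'"
    using maximal_independent_subset_extend[of B "B \<union> Basis"] B(2) by blast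
  have sp: "span B' = UNIV"
  proof -
    have "span Basis \<subseteq> span B'" by (rule span_minimal) (use B'(4) in auto)
    then show ?thesis by (simp add: span_Basis top.extremum_uniqueI)
  qed
  have finB': "finite B'" using B'(3) by (rule finiteI_independent)
  have "dim (UNIV :: (real^'n) set) = card B'" using dim_eq_card[of B' UNIV] B'(3) sp by simp
  then have cB': "card B' = CARD('n)" by simp
  define J where "J = {i. axis i 1 \<in> B' - B}"
  have "(\<lambda>i. axis i (1::real)) ` J = B' - B"
  proof
    show "B' - B \<subseteq> (\<lambda>i. axis i 1) ` J"
    proof
      fix b assume b: "b \<in> B' - B"
      then have "b \<in> Basis" using B'(2) by auto
      then obtain i where "b = axis i 1" by (auto simp: Basis_vec_def)
      then show "b \<in> (\<lambda>i. axis i 1) ` J" using b by (auto simp: J_def)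
    qed
  qed (auto simp: J_def)
  moreover have "card ((\<lambda>i. axis i (1::real) :: real^'n) ` J) = card J"
    by (rule card_image) (auto simp: inj_on_def axis_eq_axis)
  ultimately have cJ: "card J = CARD('n) - c"
    using card_Diff_subset[of B B'] B'(1) finB' cB' B(3) by (metis finite_subset)
  have "c \<le> CARD('n)" using B(3) cB' card_mono[OF finB' B'(1)] by simp
  then have cJ': "card (- J) = c" using cJ by (simp add: Compl_eq_Diff_UNIV card_Diff_subset)
  then obtain \<sigma> where \<sigma>: "bij_betw \<sigma> (- J) B"
    using finite_same_card_bij[of "- J" B] B(3) finite_subset[OF B'(1) finB'] by auto
  have "\<forall>b\<in>B. \<exists>p\<in>IV. ?g p = b" using B(1) by blast
  then obtain Q where Q: "\<And>b. b \<in> B \<Longrightarrow> Q b \<in> IV \<and> ?g (Q b) = b" by metis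
  define P where "P i = Q (\<sigma> i)" for i
  have P: "P i \<in> IV" "?g (P i) = \<sigma> i" if "i \<notin> J" for i
    using Q[of "\<sigma> i"] \<sigma> that by (auto simp: P_def bij_betw_def)
  have "v = 0" if v: "pmat (jac J P) z *v v = 0" for v
  proof -
    have orth: "b \<bullet> v = 0" if b: "b \<in> B'" for b
    proof (cases "b \<in> B")
      case True
      then obtain i where i: "i \<notin> J" "\<sigma> i = b" using \<sigma> by (auto simp: bij_betw_def image_iff)
      have "0 = (\<Sum>k\<in>UNIV. peval (pdiff (P i) k) z * v $ k)"
        using arg_cong[OF v, of "\<lambda>u. u $ i"] i(1) by (simp add: jac_mult)
      also have "\<dots> = ?g (P i) \<bullet> v" by (simp add: inner_vec_def)
      finally show ?thesis using P(2)[OF i(1)] i(2) by simp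
    next
      case False
      then have "b \<in> Basis" using b B'(2) by auto
      then obtain i where i: "b = axis i 1" by (auto simp: Basis_vec_def)
      then have "i \<in> J" using b False by (simp add: J_def)
      then show ?thesis using arg_cong[OF v, of "\<lambda>u. u $ i"] i by (simp add: jac_mult inner_axis')
    qed
    have "x \<bullet> v = 0" if "x \<in> span B'" for x
      using that
    proof (induction rule: span_induct)
      case base
      show ?case by (auto simp: subspace_def inner_add_left)
    next
      case (step b)
      then show ?case by (rule orth)
    qed
    from this[of v] show ?thesis using sp by simp
  qed
  then have "\<exists>B. B ** pmat (jac J P) z = mat 1" by (simp add: matrix_left_invertible_ker)
  then have "det (pmat (jac J P) z) \<noteq> 0" by (simp add: invertible_left_inverse flip: invertible_det_nz)
  then have "peval (jdet J P) z \<noteq> 0" by (simp add: jdet_def peval_det)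
  then show ?thesis using that[of J P] P cJ' by (simp add: tangent_chart_def)
qed

text \<open>Where \<open>jdet\<close> is nonzero, the gradients of the \<open>c\<close> chart
  equations span those of all equations of \<open>V\<close>, because the rank is \<open>c\<close>
  there. The vector \<open>u\<close> that the Jacobian sends to \<open>w\<close> is orthogonal to
  them, so it is tangent to \<open>V\<close>. The factor \<open>jdet\<close> disposes of the other
  points of \<open>V\<close>.\<close>

lemma IV_invariant:
  assumes ch: "tangent_chart J P" and w: "\<And>i. i \<notin> J \<Longrightarrow> w $ i = 0" and p: "p \<in> IV"
  shows "jdet J P * vfield J P w p \<in> IV"
  unfolding IV_def
proof (intro CollectI ballI)
  fix x assume x: "x \<in> V"
  show "peval (jdet J P * vfield J P w p) x = 0"
  proof (cases "peval (jdet J P) x = 0")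
    case False
    let ?A = "pmat (jac J P) x"
    have A: "det ?A \<noteq> 0" using False by (simp add: jdet_def peval_det)
    then obtain u where u: "?A *v u = w" using cramer by blast
    let ?g = "\<lambda>p. (\<chi> i. peval (pdiff p i) x) :: real^'n"
    have row: "?A $ i = ?g (P i)" if "i \<notin> J" for i using that by (simp add: pmat_def jac_def vec_eq_iff)
    have sub: "(\<lambda>i. ?A $ i) ` (- J) \<subseteq> ?g ` IV" using ch row by (auto simp: tangent_chart_def)
    have "?g ` IV \<subseteq> span ((\<lambda>i. ?A $ i) ` (- J))"
    proof (rule card_ge_dim_independent[OF sub independent_rows_of_regular(1)[OF A]])
      show "dim (?g ` IV) \<le> card ((\<lambda>i. ?A $ i) ` (- J))"
        using independent_rows_of_regular(2)[OF A, of "- J"] rank[OF x] ch unfolding grads_eq by (simp add: tangent_chart_def)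
    qed
    then have "?g p \<in> span ((\<lambda>i. ?A $ i) ` (- J))" using p by blast
    then have "?g p \<bullet> u = 0"
    proof (induction rule: span_induct)
      case base
      show ?case by (auto simp: subspace_def inner_add_left)
    next
      case (step b)
      then obtain i where i: "i \<notin> J" "b = ?A $ i" by auto
      have "b \<bullet> u = (?A *v u) $ i" by (simp add: i(2) matrix_vector_mult_def inner_vec_def)
      then show ?case using w[OF i(1)] u by simp
    qed
    moreover have "peval (vfield J P w p) x = peval (jdet J P) x * (?g p \<bullet> u)"
      by (simp add: vfield_def tau[OF u] inner_vec_def sum_distrib_left algebra_simps)
    ultimately show ?thesis by simp
  qed simp
qed

text \<open>The last conclusion is the essential one, that the slice of the chart lies in
  \<open>V\<close>: the segment from the image of \<open>z\<close> to \<open>y\<close> lifts to an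
  integral curve that starts in \<open>V\<close>, and the ideal of \<open>V\<close> is
  invariant.\<close>

lemma chart_at:
  assumes ch: "tangent_chart J P" and z: "z \<in> V" "peval (jdet J P) z \<noteq> 0"
  obtains r \<Phi> N where "0 < r" "open N" "z \<in> N"
    "\<And>x. x \<in> N \<Longrightarrow> chmap J P x \<in> ball (chmap J P z) r \<and> \<Phi> (chmap J P x) = x"
    "\<And>y. y \<in> ball (chmap J P z) r \<Longrightarrow> chmap J P (\<Phi> y) = y"
    "\<And>y. y \<in> ball (chmap J P z) r \<Longrightarrow> \<Phi> differentiable at y"
    "\<And>w T. (\<And>s. s \<in> {0..T} \<Longrightarrow> chmap J P z + s *\<^sub>R w \<in> ball (chmap J P z) r) \<Longrightarrow>
        icurve J P w (\<lambda>s. \<Phi> (chmap J P z + s *\<^sub>R w)) T"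
    "\<And>y. y \<in> ball (chmap J P z) r \<Longrightarrow> (\<And>i. i \<notin> J \<Longrightarrow> y $ i = 0) \<Longrightarrow> \<Phi> y \<in> V"
proof -
  obtain r \<Phi> N where r: "0 < r" "open N" "z \<in> N"
    "\<And>x. x \<in> N \<Longrightarrow> chmap J P x \<in> ball (chmap J P z) r \<and> \<Phi> (chmap J P x) = x"
    "\<And>y. y \<in> ball (chmap J P z) r \<Longrightarrow> chmap J P (\<Phi> y) = y \<and> peval (jdet J P) (\<Phi> y) \<noteq> 0"
    "\<And>y. y \<in> ball (chmap J P z) r \<Longrightarrow> \<exists>u. (\<Phi> has_derivative u) (at y) \<and> (\<forall>v. pmat (jac J P) (\<Phi> y) *v u v = v)"
    using local_inverse[OF z(2)] by metis
  let ?c = "chmap J P z"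
  have ic: "icurve J P w (\<lambda>s. \<Phi> (?c + s *\<^sub>R w)) T" if "\<And>s. s \<in> {0..T} \<Longrightarrow> ?c + s *\<^sub>R w \<in> ball ?c r" for w T
    by (rule icurve_chart[where r = r]) (use r(5,6) that in auto)
  have c0: "?c $ i = 0" if "i \<notin> J" for i using that ch IV_D[OF _ z(1)] by (simp add: chmap_def tangent_chart_def)
  have "\<Phi> y \<in> V" if y: "y \<in> ball ?c r" "\<And>i. i \<notin> J \<Longrightarrow> y $ i = 0" for y
  proof -
    define w where "w = y - ?c"
    have nw: "norm w < r" using y(1) by (simp add: w_def dist_norm norm_minus_commute)
    have "?c + s *\<^sub>R w \<in> ball ?c r" if "s \<in> {0..1}" for s
    proof -
      have "norm (s *\<^sub>R w) \<le> norm w" using that by (simp add: mult_left_le_one_le)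
      then show ?thesis using nw by (simp add: dist_norm)
    qed
    then have g: "icurve J P w (\<lambda>s. \<Phi> (?c + s *\<^sub>R w)) 1" by (rule ic)
    have "peval p (\<Phi> (?c + 1 *\<^sub>R w)) = 0" if "p \<in> IV" for p
    proof (rule invariant_ideal_vanishes[where \<aa> = IV, OF IV_ideal _ g _ that])
      show "jdet J P * vfield J P w a \<in> IV" if "a \<in> IV" for a
        by (rule IV_invariant[OF ch _ that]) (use y(2) c0 in \<open>simp add: w_def\<close>)
      show "peval a (\<Phi> (?c + 0 *\<^sub>R w)) = 0" if "a \<in> IV" for a
        using IV_D[OF that z(1)] r(4)[OF r(3)] by simp
    qed auto
    then show ?thesis unfolding V_iff by (simp add: w_def)
  qed
  moreover have "\<Phi> differentiable at y" if "y \<in> ball ?c r" for y using r(6)[OF that] by (auto simp: differentiable_def)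
  moreover have "chmap J P (\<Phi> y) = y" if "y \<in> ball ?c r" for y using r(5)[OF that] by blast
  ultimately show ?thesis using r(1-4) ic by (intro that[of r N \<Phi>]) simp_all
qed

end

section \<open>Quotients on subvarieties\<close>

lemma psubst_exists:
  fixes s :: "'m::finite \<Rightarrow> 'n::finite pfun"
  shows "\<exists>p'. \<forall>x. peval p' x = peval p (\<chi> j. peval (s j) x)"
proof (induction p rule: pfun_induct)
  case (const c)
  show ?case by (rule exI[of _ "pconst c"]) simp
next
  case (coord j)
  show ?case by (rule exI[of _ "s j"]) simp
next
  case (add p q)
  then show ?case by (metis peval_simps(3))
next
  case (mult p q)
  then show ?case by (metis peval_simps(4))
qed

definition psubst :: "('m::finite \<Rightarrow> 'n::finite pfun) \<Rightarrow> 'm pfun \<Rightarrow> 'n pfun" where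
  "psubst s p = (SOME p'. \<forall>x. peval p' x = peval p (\<chi> j. peval (s j) x))"

lemma peval_psubst [simp]: "peval (psubst s p) x = peval p (\<chi> j. peval (s j) x)"
  using someI_ex[OF psubst_exists[of p s]] unfolding psubst_def by blast

text \<open>Coordinates of the graph of \<open>q\<close>: the extra index \<open>None\<close>
  carries the value of \<open>q\<close>.\<close>

definition graph_coord :: "'n::finite pfun \<Rightarrow> 'n option \<Rightarrow> 'n pfun" where
  "graph_coord q k = (case k of None \<Rightarrow> q | Some i \<Rightarrow> pcoord i)"

lemma pdiff_pconst: "pdiff (pconst a) i = 0"
  by (rule pfun_eqI) (use pdiff_unique[of "pconst a" "\<lambda>_. 0"] in \<open>simp add: pconst.rep_eq\<close>)

context smooth_variety
begin

text \<open>Near \<open>z\<close> the variety is parametrised by the coordinates in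
  \<open>K\<close>, which are \<open>c\<close> fewer than all. Adding the \<open>c\<close>
  coordinates of \<open>a\<close> at indices outside \<open>J\<close>, which are free, gives
  \<open>CARD('n)\<close> parameters for a set in dimension \<open>CARD('n) + 1\<close>. So the set
  lies in a differentiable image of a space of lower dimension.\<close>

lemma cylinder_negligible_local:
  assumes J: "card (- J) = c" and z: "z \<in> V"
  shows "\<exists>N. open N \<and> z \<in> N \<and>
    negligible {a :: real^'n option. \<exists>x\<in>V \<inter> N. (\<forall>j\<in>J. x $ j = a $ Some j) \<and> peval q x = a $ None}"
proof -
  obtain K P where K: "tangent_chart K P" "peval (jdet K P) z \<noteq> 0" using tangent_chart_exists[OF z] .
  obtain r \<Phi> N where r: "0 < r" "open N" "z \<in> N"
    "\<And>x. x \<in> N \<Longrightarrow> chmap K P x \<in> ball (chmap K P z) r \<and> \<Phi> (chmap K P x) = x"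
    "\<And>y. y \<in> ball (chmap K P z) r \<Longrightarrow> \<Phi> differentiable at y"
    using chart_at[OF K(1) z K(2)] by metis
  have "card (- K) = card (- J)" using K(1) J by (simp add: tangent_chart_def)
  \<comment> \<open>The bijection stores the free coordinates of \<open>a\<close> in those slots of
    \<open>u\<close> that the chart leaves open.\<close>
  then obtain \<sigma> where \<sigma>: "bij_betw \<sigma> (- J) (- K)" using finite_same_card_bij[of "- J" "- K"] by auto
  define L :: "real^'n \<Rightarrow> real^'n" where "L u = (\<chi> i. if i \<in> K then u $ i else 0)" for u
  have "linear L" by (rule linearI) (auto simp: L_def vec_eq_iff)
  then have L: "L differentiable at u" for u by (simp add: bounded_linear_imp_differentiable linear_conv_bounded_linear)
  define \<Psi> :: "real^'n \<Rightarrow> real^'n option" where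
    "\<Psi> u = (\<chi> k. case k of None \<Rightarrow> peval q (\<Phi> (L u)) | Some i \<Rightarrow> if i \<in> J then \<Phi> (L u) $ i else u $ \<sigma> i)" for u
  define S where "S = {u. L u \<in> ball (chmap K P z) r}"
  have "\<Psi> differentiable_on S"
    unfolding differentiable_on_def
  proof
    fix u assume "u \<in> S"
    then have "\<Phi> differentiable at (L u)" using r(5) by (simp add: S_def)
    then have d1: "(\<lambda>u. \<Phi> (L u)) differentiable at u" using differentiable_chain_at[OF L] by (simp add: o_def)
    then obtain D where D: "((\<lambda>u. \<Phi> (L u)) has_derivative D) (at u)" by (auto simp: differentiable_def)
    have "(\<lambda>u. \<Psi> u $ k) differentiable at u" for k
    proof (cases k)
      case None
      have "((\<lambda>u. peval q (\<Phi> (L u))) has_derivative (\<lambda>v. \<Sum>i\<in>UNIV. peval (pdiff q i) (\<Phi> (L u)) * D v $ i)) (at u)"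
        by (rule has_derivative_compose[OF D has_derivative_peval])
      then show ?thesis using None by (auto simp: \<Psi>_def differentiable_def)
    next
      case (Some i)
      have "((\<lambda>u. \<Phi> (L u) $ i) has_derivative (\<lambda>v. D v $ i)) (at u)"
        by (rule bounded_linear.has_derivative[OF bounded_linear_vec_nth D])
      moreover have "((\<lambda>u. u $ \<sigma> i) has_derivative (\<lambda>v. v $ \<sigma> i)) (at u)"
        by (rule bounded_linear_imp_has_derivative[OF bounded_linear_vec_nth])
      ultimately show ?thesis using Some by (cases "i \<in> J") (auto simp: \<Psi>_def differentiable_def)
    qed
    then have "\<Psi> differentiable at u"
      unfolding differentiable_componentwise_within[of \<Psi>] by (auto simp: Basis_vec_def inner_axis)
    then show "\<Psi> differentiable at u within S" by (rule differentiable_at_withinI)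
  qed
  moreover have "DIM(real^'n) < DIM(real^'n option)" by (simp add: card_UNIV_option)
  ultimately have "negligible (\<Psi> ` S)" by (intro negligible_differentiable_image_lowdim)
  moreover have "{a. \<exists>x\<in>V \<inter> N. (\<forall>j\<in>J. x $ j = a $ Some j) \<and> peval q x = a $ None} \<subseteq> \<Psi> ` S"
  proof clarify
    fix a :: "real^'n option" and x assume x: "x \<in> V" "x \<in> N" "\<forall>j\<in>J. x $ j = a $ Some j" "peval q x = a $ None"
    define u where "u = (\<chi> i. if i \<in> K then x $ i else a $ Some (inv_into (- J) \<sigma> i))"
    have Lu: "L u = chmap K P x"
      using x(1) K(1) by (auto simp: L_def u_def chmap_def vec_eq_iff tangent_chart_def IV_D)
    then have \<Phi>: "\<Phi> (L u) = x" "u \<in> S" using r(4)[OF x(2)] by (auto simp: S_def)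
    have "u $ \<sigma> i = a $ Some i" if "i \<notin> J" for i
      using \<sigma> that by (auto simp: u_def bij_betw_def)
    then have "\<Psi> u = a" unfolding \<Psi>_def \<Phi>(1) using x(3,4) by (auto simp: vec_eq_iff split: option.split)
    then show "a \<in> \<Psi> ` S" using \<Phi>(2) by blast
  qed
  ultimately show ?thesis using r(2,3) negligible_subset by blast
qed

lemma cylinder_negligible:
  assumes J: "card (- J) = c"
  shows "negligible {a :: real^'n option. \<exists>x\<in>V. (\<forall>j\<in>J. x $ j = a $ Some j) \<and> peval q x = a $ None}"
proof -
  let ?E = "\<lambda>N. {a :: real^'n option. \<exists>x\<in>V \<inter> N. (\<forall>j\<in>J. x $ j = a $ Some j) \<and> peval q x = a $ None}"
  have "\<forall>z\<in>V. \<exists>N. open N \<and> z \<in> N \<and> negligible (?E N)" using cylinder_negligible_local[OF J] by blast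
  from bchoice[OF this] obtain N where N: "\<And>z. z \<in> V \<Longrightarrow> open (N z) \<and> z \<in> N z \<and> negligible (?E (N z))"
    by blast
  obtain C where C: "C \<subseteq> N ` V" "countable C" "\<Union>C = \<Union>(N ` V)"
    using Lindelof[of "N ` V"] N by blast
  have "negligible (\<Union>(?E ` C))"
    by (rule negligible_countable_Union) (use C(1,2) N in auto)
  moreover have "{a :: real^'n option. \<exists>x\<in>V. (\<forall>j\<in>J. x $ j = a $ Some j) \<and> peval q x = a $ None} \<subseteq> \<Union>(?E ` C)"
  proof clarify
    fix a :: "real^'n option" and x assume x: "x \<in> V" "\<forall>j\<in>J. x $ j = a $ Some j" "peval q x = a $ None"
    have "x \<in> \<Union>C" unfolding C(3) using N x(1) by blast
    then show "a \<in> \<Union>(?E ` C)" using x by blast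
  qed
  ultimately show ?thesis by (rule negligible_subset)
qed

lemma IV_prime_prod: "finite A \<Longrightarrow> (\<Prod>a\<in>A. f a) \<in> IV \<Longrightarrow> \<exists>a\<in>A. f a \<in> IV"
  by (induction A rule: finite_induct) (use IV_one IV_prime in auto)

lemma IV_prime_power: "p ^ k \<in> IV \<Longrightarrow> p \<in> IV"
  by (induction k) (use IV_one IV_prime in auto)

text \<open>By elimination, the projection of the graph of \<open>q\<close> to the coordinates in
  \<open>J\<close> and \<open>None\<close> is governed by the signs of finitely many polynomials in
  these coordinates. If at a point of \<open>V\<close> none of the nonzero ones vanished, a whole
  open set would lie in the negligible cylinder. So their product vanishes on \<open>V\<close>, and
  primality selects a factor.\<close>

lemma algebraic_relation:
  assumes J: "card (- J) = c"
  obtains s :: "'n option pfun" where "s \<in> pvars (insert None (Some ` J))" "s \<noteq> 0" "psubst (graph_coord q) s \<in> IV"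
proof -
  obtain v where v: "\<And>x. peval v x = 0 \<longleftrightarrow> x \<in> V" using V_equation by metis
  define emb :: "'n pfun \<Rightarrow> 'n option pfun" where "emb = psubst (\<lambda>i. pcoord (Some i))"
  have emb: "peval (emb p) a = peval p (\<chi> i. a $ Some i)" for p a by (simp add: emb_def)
  let ?I = "insert None (Some ` J)"
  define F where "F = {emb v, pcoord None - emb q}"
  obtain S where S: "finite S" "S \<subseteq> pvars ?I" and S': "\<And>a (b :: 'n option pfun \<Rightarrow> real). ring_map b \<Longrightarrow>
      \<forall>s\<in>S. ssign (peval s a) (b s) \<Longrightarrow> \<exists>a'. (\<forall>i\<in>?I. a' $ i = a $ i) \<and> (\<forall>f\<in>F. ssign (peval f a') (b f))"
    using elimination[of F ?I, where 'r = real] by (auto simp: F_def)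
  \<comment> \<open>The zero polynomial is dropped, since its sign agrees everywhere.\<close>
  define S0 where "S0 = S - {0}"
  have "\<exists>s\<in>S0. peval (psubst (graph_coord q) s) x = 0" if x: "x \<in> V" for x
  proof (rule ccontr)
    assume n: "\<not> ?thesis"
    define b where "b = (\<chi> k. peval (graph_coord q k) x)"
    have b: "peval s b \<noteq> 0" if "s \<in> S0" for s using n that by (auto simp: b_def)
    define U where "U = (\<Inter>s\<in>S0. {a. 0 < peval s a * peval s b})"
    have "open U" unfolding U_def
    proof (rule open_INT)
      show "finite S0" using S by (simp add: S0_def)
      show "\<forall>s\<in>S0. open {a. 0 < peval s a * peval s b}"
        by (intro ballI open_Collect_less continuous_intros)
    qed
    have "b \<in> U" unfolding U_def using b by (auto simp: zero_less_mult_iff linorder_neq_iff)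
    have "\<exists>x\<in>V. (\<forall>j\<in>J. x $ j = a $ Some j) \<and> peval q x = a $ None" if a: "a \<in> U" for a
    proof -
      have "ssign (peval s a) (peval s b)" if "s \<in> S" for s
      proof (cases "s = 0")
        case False
        then have "0 < peval s a * peval s b" using that a by (auto simp: U_def S0_def)
        then show ?thesis by (auto simp: ssign_def zero_less_mult_iff)
      qed (simp add: ssign_def)
      then obtain a' where a': "\<forall>i\<in>?I. a' $ i = a $ i" "\<forall>f\<in>F. ssign (peval f a') (peval f b)"
        using S'[OF ring_map_peval[of b], of a] by blast
      have bx: "(\<chi> i. b $ Some i) = x" "b $ None = peval q x" by (auto simp: b_def graph_coord_def vec_eq_iff)
      have "peval (emb v) b = 0" "peval (pcoord None - emb q) b = 0"
        using x v by (simp_all add: emb bx)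
      then have "peval (emb v) a' = 0" "peval (pcoord None - emb q) a' = 0"
        using a'(2) by (auto simp: F_def dest: ssign_zero)
      then have "(\<chi> i. a' $ Some i) \<in> V" "peval q (\<chi> i. a' $ Some i) = a' $ None" using v by (auto simp: emb)
      then show ?thesis using a'(1) by (intro bexI[of _ "\<chi> i. a' $ Some i"]) auto
    qed
    then have "U \<subseteq> {a. \<exists>x\<in>V. (\<forall>j\<in>J. x $ j = a $ Some j) \<and> peval q x = a $ None}" by blast
    then have "negligible U" using cylinder_negligible[OF J] negligible_subset by blast
    then show False using open_not_negligible[OF \<open>open U\<close>] \<open>b \<in> U\<close> by blast
  qed
  then have "(\<Prod>s\<in>S0. psubst (graph_coord q) s) \<in> IV"
    unfolding IV_def using S(1) by (auto simp: S0_def prod_zero_iff)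
  then obtain s where "s \<in> S0" "psubst (graph_coord q) s \<in> IV" using IV_prime_prod[of S0] S(1) by (auto simp: S0_def)
  then show ?thesis using that[of s] S(2) by (auto simp: S0_def)
qed

text \<open>As \<open>V\<close> may be disconnected, continuation along curves does not reach all of
  it. Instead \<open>q\<close> satisfies a polynomial relation over the chart coordinates, and if
  \<open>q\<close> is not zero on \<open>V\<close>, a power of \<open>q\<close> can be divided out
  until the constant coefficient \<open>c0\<close> is nonzero. Where \<open>q\<close> vanishes so
  does \<open>c0\<close>, but the chart coordinates of such points fill an open set.\<close>

theorem identity_theorem:
  assumes z: "z \<in> V" and U: "open U" "z \<in> U" and q: "\<And>x. x \<in> V \<Longrightarrow> x \<in> U \<Longrightarrow> peval q x = 0"
  shows "q \<in> IV"
proof (rule ccontr)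
  assume nq: "q \<notin> IV"
  obtain J P where J: "tangent_chart J P" "peval (jdet J P) z \<noteq> 0" using tangent_chart_exists[OF z] .
  then have "card (- J) = c" by (simp add: tangent_chart_def)
  then obtain s :: "'n option pfun" where s: "s \<in> pvars (insert None (Some ` J))" "s \<noteq> 0" "psubst (graph_coord q) s \<in> IV"
    using algebraic_relation[of J q] by blast
  obtain R where R: "coeffs_in (pvars (Some ` J)) R" "s = poly R (pcoord None)" using pvars_as_poly[OF s(1)] by blast
  have "R \<noteq> 0" using s(2) R(2) by auto
  define k where "k = (LEAST k. coeff R k \<noteq> 0)"
  have "\<exists>k. coeff R k \<noteq> 0" using \<open>R \<noteq> 0\<close> leading_coeff_0_iff[of R] by blast
  from LeastI_ex[OF this] have k: "coeff R k \<noteq> 0" unfolding k_def .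
  have klow: "coeff R j = 0" if "j < k" for j
  proof -
    have "j < (LEAST k. coeff R k \<noteq> 0)" using that by (simp only: k_def)
    from not_less_Least[OF this] show ?thesis by simp
  qed
  define R1 where "R1 = poly_shift k R"
  have "R = Polynomial.monom 1 k * R1"
    by (rule poly_eqI) (auto simp: coeff_monom_mult R1_def coeff_poly_shift klow)
  then have "s = pcoord None ^ k * poly R1 (pcoord None)" using R(2) by (simp add: Polynomial.poly_monom)
  then have "psubst (graph_coord q) s = q ^ k * psubst (graph_coord q) (poly R1 (pcoord None))"
    by (intro pfun_eqI) (simp add: graph_coord_def)
  then have "q ^ k * psubst (graph_coord q) (poly R1 (pcoord None)) \<in> IV" using s(3) by simp
  then have "psubst (graph_coord q) (poly R1 (pcoord None)) \<in> IV"
    using IV_prime[of "q ^ k"] IV_prime_power[of q k] nq by blast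
  note R1V = IV_D[OF this]
  define c0 where "c0 = coeff R k"
  have c0: "c0 \<in> pvars (Some ` J)" "c0 \<noteq> 0" using R(1) k by (auto simp: coeffs_in_def c0_def)
  have c00: "coeff R1 0 = c0" by (simp add: R1_def coeff_poly_shift c0_def)
  have c0z: "peval c0 (\<chi> k. peval (graph_coord q k) x) = 0" if x: "x \<in> V" "x \<in> U" for x
  proof -
    let ?b = "\<chi> k. peval (graph_coord q k) x"
    have "0 = peval (poly R1 (pcoord None)) ?b" using R1V[OF x(1)] by simp
    also have "\<dots> = poly (map_poly (\<lambda>p. peval p ?b) R1) (peval q x)"
      using ring_map_poly[OF ring_map_peval[of ?b]] by (simp add: graph_coord_def)
    also have "\<dots> = peval c0 ?b" using q[OF x] c00 by (simp add: poly_0_coeff_0 coeff_map_poly)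
    finally show ?thesis by simp
  qed
  obtain r \<Phi> N where r: "0 < r" "open N" "z \<in> N"
    "\<And>x. x \<in> N \<Longrightarrow> chmap J P x \<in> ball (chmap J P z) r \<and> \<Phi> (chmap J P x) = x"
    "\<And>y. y \<in> ball (chmap J P z) r \<Longrightarrow> chmap J P (\<Phi> y) = y"
    "\<And>y. y \<in> ball (chmap J P z) r \<Longrightarrow> \<Phi> differentiable at y"
    "\<And>w T. (\<And>s. s \<in> {0..T} \<Longrightarrow> chmap J P z + s *\<^sub>R w \<in> ball (chmap J P z) r) \<Longrightarrow>
        icurve J P w (\<lambda>s. \<Phi> (chmap J P z + s *\<^sub>R w)) T"
    "\<And>y. y \<in> ball (chmap J P z) r \<Longrightarrow> (\<And>i. i \<notin> J \<Longrightarrow> y $ i = 0) \<Longrightarrow> \<Phi> y \<in> V"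
  proof (rule chart_at[OF J(1) z J(2)], goal_cases)
    case (1 r \<Phi> N)
    show ?case by (rule that(1)[of r N \<Phi>]; fact 1)
  qed
  let ?c = "chmap J P z"
  have "continuous_on (ball ?c r) \<Phi>"
    using r(6) by (intro continuous_at_imp_continuous_on) (auto intro: differentiable_imp_continuous_within)
  then have op: "open (ball ?c r \<inter> \<Phi> -` U)" using U(1) continuous_open_preimage by blast
  define proj :: "real^'n option \<Rightarrow> real^'n" where "proj a = (\<chi> i. if i \<in> J then a $ Some i else 0)" for a
  have pc: "continuous_on UNIV proj" unfolding proj_def
  proof (rule continuous_on_vec_lambda)
    show "continuous_on UNIV (\<lambda>a :: real^'n option. if i \<in> J then a $ Some i else 0)" for i
      by (cases "i \<in> J") (auto intro!: continuous_intros)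
  qed
  define a0 :: "real^'n option" where "a0 = (\<chi> k. case k of None \<Rightarrow> 0 | Some i \<Rightarrow> z $ i)"
  have "proj a0 = ?c" using IV_D[OF _ z] J(1) by (auto simp: proj_def a0_def chmap_def vec_eq_iff tangent_chart_def)
  have "c0 = 0"
  proof (rule pfun_zero_on_open)
    show "open (proj -` (ball ?c r \<inter> \<Phi> -` U))" by (rule open_vimage[OF op pc])
    show "a0 \<in> proj -` (ball ?c r \<inter> \<Phi> -` U)" using \<open>proj a0 = ?c\<close> r(1) r(4)[OF r(3)] U(2) by simp
    fix a assume a: "a \<in> proj -` (ball ?c r \<inter> \<Phi> -` U)"
    define x where "x = \<Phi> (proj a)"
    have x: "x \<in> V" "x \<in> U" using a r(8)[of "proj a"] by (auto simp: x_def proj_def)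
    have "chmap J P x = proj a" using a r(5) by (simp add: x_def)
    then have "x $ i = a $ Some i" if "i \<in> J" for i
      using that by (auto simp: chmap_def proj_def vec_eq_iff) (metis (full_types))
    then have "peval c0 a = peval c0 (\<chi> k. peval (graph_coord q k) x)"
      by (intro pvars_local[OF c0(1)]) (auto simp: graph_coord_def)
    then show "peval c0 a = 0" using c0z[OF x] by simp
  qed
  then show False using c0(2) by simp
qed

lemma nonvanishing_nearby:
  assumes "q \<notin> IV" "z \<in> V" "open U" "z \<in> U"
  obtains x where "x \<in> V" "x \<in> U" "peval q x \<noteq> 0"
  using identity_theorem[of z U q] assms by blast

section \<open>Quotients of iterated derivatives\<close>

lemma vfield_pow_lin: "(vfield J P w ^^ k) (p - pconst a * q) = (vfield J P w ^^ k) p - pconst a * (vfield J P w ^^ k) q"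
proof (induction k)
  case (Suc k)
  have const: "vfield J P w (pconst a) = 0" for a by (simp add: vfield_def pdiff_pconst)
  have m: "p' - pconst a * q' = p' + pconst (- a) * q'" for p' q' by (simp add: pconst_simps)
  have "vfield J P w (p' - pconst a * q') = vfield J P w p' - pconst a * vfield J P w q'" for p' q'
    unfolding m vfield_add vfield_mult const by simp
  then show ?case using Suc by simp
qed simp

text \<open>At a point where all lower derivatives of the denominator vanish, l'Hospital's rule along a curve in
  the variety recovers the value of the function from the next derivatives.\<close>

lemma derivative_quotient:
  assumes ch: "tangent_chart J P" and z: "z \<in> V" "peval (jdet J P) z \<noteq> 0" and w: "\<And>i. i \<notin> J \<Longrightarrow> w $ i = 0"
    and f: "continuous_on V f" "\<And>x. x \<in> V \<Longrightarrow> peval q x * f x = peval p x"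
    and low: "\<And>k. k < m \<Longrightarrow> peval ((vfield J P w ^^ k) q) z = 0"
  shows "peval ((vfield J P w ^^ m) q) z * f z = peval ((vfield J P w ^^ m) p) z"
proof -
  let ?D = "vfield J P w" and ?c = "chmap J P z"
  obtain r \<Phi> N where r: "0 < r" "open N" "z \<in> N"
    "\<And>x. x \<in> N \<Longrightarrow> chmap J P x \<in> ball (chmap J P z) r \<and> \<Phi> (chmap J P x) = x"
    "\<And>y. y \<in> ball (chmap J P z) r \<Longrightarrow> chmap J P (\<Phi> y) = y"
    "\<And>y. y \<in> ball (chmap J P z) r \<Longrightarrow> \<Phi> differentiable at y"
    "\<And>w T. (\<And>s. s \<in> {0..T} \<Longrightarrow> chmap J P z + s *\<^sub>R w \<in> ball (chmap J P z) r) \<Longrightarrow>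
        icurve J P w (\<lambda>s. \<Phi> (chmap J P z + s *\<^sub>R w)) T"
    "\<And>y. y \<in> ball (chmap J P z) r \<Longrightarrow> (\<And>i. i \<notin> J \<Longrightarrow> y $ i = 0) \<Longrightarrow> \<Phi> y \<in> V"
  proof (rule chart_at[OF ch z], goal_cases)
    case (1 r \<Phi> N)
    show ?case by (rule that(1)[of r N \<Phi>]; fact 1)
  qed
  \<comment> \<open>The summand 1 keeps \<open>b\<close> positive when \<open>w = 0\<close>.\<close>
  define b where "b = norm w + 1"
  have b: "0 < b" "norm w \<le> b" by (simp_all add: b_def add_nonneg_pos)
  define T where "T = r / 2 / b"
  have T: "0 < T" unfolding T_def using r(1) b by simp
  have Tw: "T * norm w < r"
  proof -
    have "T * norm w \<le> T * b" using T b by simp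
    also have "\<dots> = r / 2" using b by (simp add: T_def)
    finally show ?thesis using r(1) by simp
  qed
  have inb: "?c + s *\<^sub>R w \<in> ball ?c r" if "s \<in> {0..T}" for s
  proof -
    have "norm (s *\<^sub>R w) \<le> T * norm w" using that by (simp add: mult_right_mono)
    then show ?thesis using Tw by (simp add: dist_norm)
  qed
  define g where "g s = \<Phi> (?c + s *\<^sub>R w)" for s
  have g: "icurve J P w g T" unfolding g_def by (rule r(7)[OF inb])
  have g0: "g 0 = z" using r(4)[OF r(3)] by (simp add: g_def)
  have c0: "?c $ i = 0" if "i \<notin> J" for i using that ch IV_D[OF _ z(1)] by (simp add: chmap_def tangent_chart_def)
  have gV: "g s \<in> V" if "s \<in> {0..T}" for s unfolding g_def
    by (rule r(8)[OF inb[OF that]]) (simp add: c0 w)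
  have ev: "eventually (\<lambda>s. s \<in> {0<..T}) (at_right 0)"
    using T by (auto simp: eventually_at_right_field intro!: exI[of _ T])
  have "isCont \<Phi> ?c" using r(1) by (intro differentiable_imp_continuous_within r(6)) simp
  then have "isCont \<Phi> (?c + 0 *\<^sub>R w)" by simp
  moreover have "isCont (\<lambda>s. ?c + s *\<^sub>R w) 0" by (intro continuous_intros)
  ultimately have "isCont g 0" unfolding g_def by (rule isCont_o2[rotated])
  then have "(g \<longlongrightarrow> g 0) (at_right 0)" by (simp add: isCont_def filterlim_at_split)
  then have fg: "((\<lambda>s. f (g s)) \<longlongrightarrow> f z) (at_right 0)" unfolding g0
    by (rule continuous_on_tendsto_compose[OF f(1) _ z(1)]) (use ev gV in \<open>auto elim!: eventually_mono\<close>)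
  have qm: "((\<lambda>s. peval q (g s) / s ^ m) \<longlongrightarrow> peval ((?D ^^ m) q) z / (peval (jdet J P) z ^ m * fact m)) (at_right 0)"
    using curve_expansion[OF g T, of m q] low unfolding g0 by blast
  \<comment> \<open>Along the curve \<open>h\<close> equals \<open>(f - f z) * q\<close>, which is
    of smaller order than \<open>s ^ m\<close>. Hence its derivatives up to order \<open>m\<close>
    vanish at \<open>z\<close>, and the vanishing of the \<open>m\<close>-th one is the
    claim.\<close>
  define h where "h = p - pconst (f z) * q"
  have hz: "k \<le> m \<Longrightarrow> peval ((?D ^^ k) h) z = 0" for k
  proof (induction k rule: less_induct)
    case (less k)
    have "((\<lambda>s. peval h (g s) / s ^ k) \<longlongrightarrow> peval ((?D ^^ k) h) z / (peval (jdet J P) z ^ k * fact k)) (at_right 0)"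
      using curve_expansion[OF g T, of k h] less unfolding g0 by auto
    moreover have "((\<lambda>s. peval h (g s) / s ^ k) \<longlongrightarrow> 0) (at_right 0)"
    proof -
      have "((\<lambda>s. (f (g s) - f z) * (peval q (g s) / s ^ m) * s ^ (m - k)) \<longlongrightarrow>
          (f z - f z) * (peval ((?D ^^ m) q) z / (peval (jdet J P) z ^ m * fact m)) * 0 ^ (m - k)) (at_right 0)"
        by (intro tendsto_intros fg qm)
      moreover have "eventually (\<lambda>s. (f (g s) - f z) * (peval q (g s) / s ^ m) * s ^ (m - k) = peval h (g s) / s ^ k) (at_right 0)"
        using ev
      proof eventually_elim
        case (elim s)
        have e: "peval h (g s) = (f (g s) - f z) * peval q (g s)"
          using f(2)[OF gV, of s] elim by (simp add: h_def algebra_simps)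
        have "s ^ m = s ^ k * s ^ (m - k)" using less.prems by (simp flip: power_add)
        then show ?case unfolding e using elim by (simp add: field_simps)
      qed
      ultimately show ?thesis using tendsto_cong by fastforce
    qed
    ultimately have "peval ((?D ^^ k) h) z / (peval (jdet J P) z ^ k * fact k) = 0"
      using tendsto_unique trivial_limit_at_right_real by blast
    then show ?case using z(2) by simp
  qed
  from hz[of m] show ?thesis by (simp add: h_def vfield_pow_lin)
qed

text \<open>Some iterated derivative of \<open>q\<close> along a tangent field is not identically
  zero on \<open>Z\<close>: otherwise \<open>q\<close> would be flat at \<open>z\<close>, hence zero
  on \<open>V\<close> near \<open>z\<close>, and zero on \<open>V\<close> by the identity theorem.
  For the least such order all lower derivatives vanish on the whole of \<open>Z\<close>, so there
  \<open>f\<close> is a quotient of derivatives wherever \<open>jdet\<close> is nonzero. Multiplying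
  by \<open>jdet\<close> covers its zeros, and primality keeps the new denominator from vanishing on
  \<open>Z\<close>.\<close>

theorem regular_on_subvariety:
  assumes f: "continuous_on V f" "\<And>x. x \<in> V \<Longrightarrow> peval q x * f x = peval p x" and q: "q \<notin> IV"
    and Z: "Z \<subseteq> V" "Z \<noteq> {}"
    and prime: "\<And>a b. (\<forall>x\<in>Z. peval (a * b) x = 0) \<Longrightarrow> (\<forall>x\<in>Z. peval a x = 0) \<or> (\<forall>x\<in>Z. peval b x = 0)"
  obtains p' q' where "\<exists>x\<in>Z. peval q' x \<noteq> 0" "\<And>x. x \<in> Z \<Longrightarrow> peval q' x * f x = peval p' x"
proof -
  obtain z where z: "z \<in> Z" "z \<in> V" using Z by blast
  obtain J P where J: "tangent_chart J P" "peval (jdet J P) z \<noteq> 0" using tangent_chart_exists[OF z(2)] .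
  let ?c = "chmap J P z"
  have c0: "chmap J P x $ i = 0" if "i \<notin> J" "x \<in> V" for i x
    using that J(1) IV_D by (simp add: chmap_def tangent_chart_def)
  have "\<exists>m w. (\<forall>i. i \<notin> J \<longrightarrow> w $ i = 0) \<and> (\<exists>x\<in>Z. peval ((vfield J P w ^^ m) q) x \<noteq> 0)"
  proof (rule ccontr)
    assume n: "\<not> ?thesis"
    obtain r \<Phi> N where r: "0 < r" "open N" "z \<in> N"
      "\<And>x. x \<in> N \<Longrightarrow> chmap J P x \<in> ball ?c r \<and> \<Phi> (chmap J P x) = x"
      "\<And>w T. (\<And>s. s \<in> {0..T} \<Longrightarrow> ?c + s *\<^sub>R w \<in> ball ?c r) \<Longrightarrow> icurve J P w (\<lambda>s. \<Phi> (?c + s *\<^sub>R w)) T"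
      using chart_at[OF J(1) z(2) J(2)] by metis
    have "peval q x = 0" if x: "x \<in> V" "x \<in> N" for x
    proof -
      define w where "w = chmap J P x - ?c"
      have nw: "norm w < r" using r(4)[OF x(2)] by (simp add: w_def dist_norm norm_minus_commute)
      have "?c + s *\<^sub>R w \<in> ball ?c r" if "s \<in> {0..1}" for s
      proof -
        have "norm (s *\<^sub>R w) \<le> norm w" using that by (simp add: mult_left_le_one_le)
        then show ?thesis using nw by (simp add: dist_norm)
      qed
      then have g: "icurve J P w (\<lambda>s. \<Phi> (?c + s *\<^sub>R w)) 1" by (rule r(5))
      have "\<forall>i. i \<notin> J \<longrightarrow> w $ i = 0" using c0[OF _ x(1)] c0[OF _ z(2)] by (simp add: w_def)
      then have "peval ((vfield J P w ^^ m) q) (\<Phi> (?c + 0 *\<^sub>R w)) = 0" for m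
        using n z(1) r(4)[OF r(3)] by auto
      then have "peval q (\<Phi> (?c + 1 *\<^sub>R w)) = 0" by (rule flat_vanishes[OF g]) simp
      then show ?thesis using r(4)[OF x(2)] by (simp add: w_def)
    qed
    then show False using identity_theorem[OF z(2) r(2,3)] q by blast
  qed
  then obtain m where m: "\<exists>w. (\<forall>i. i \<notin> J \<longrightarrow> w $ i = 0) \<and> (\<exists>x\<in>Z. peval ((vfield J P w ^^ m) q) x \<noteq> 0)"
    and min: "\<And>k. k < m \<Longrightarrow> \<not> (\<exists>w. (\<forall>i. i \<notin> J \<longrightarrow> w $ i = 0) \<and> (\<exists>x\<in>Z. peval ((vfield J P w ^^ k) q) x \<noteq> 0))"
    using exists_least_iff[of "\<lambda>m. \<exists>w. (\<forall>i. i \<notin> J \<longrightarrow> w $ i = 0) \<and> (\<exists>x\<in>Z. peval ((vfield J P w ^^ m) q) x \<noteq> 0)"] by blast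
  from m obtain w x0 where w: "\<And>i. i \<notin> J \<Longrightarrow> w $ i = 0" and x0: "x0 \<in> Z" "peval ((vfield J P w ^^ m) q) x0 \<noteq> 0" by blast
  let ?D = "vfield J P w"
  show ?thesis
  proof (rule that[of "jdet J P * (?D ^^ m) q" "jdet J P * (?D ^^ m) p"])
    show "\<exists>x\<in>Z. peval (jdet J P * (?D ^^ m) q) x \<noteq> 0" using prime[of "jdet J P" "(?D ^^ m) q"] J(2) z x0 by blast
    fix x assume x: "x \<in> Z"
    show "peval (jdet J P * (?D ^^ m) q) x * f x = peval (jdet J P * (?D ^^ m) p) x"
    proof (cases "peval (jdet J P) x = 0")
      case False
      have "peval ((?D ^^ m) q) x * f x = peval ((?D ^^ m) p) x"
      proof (rule derivative_quotient[OF J(1) _ False w f])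
        show "x \<in> V" using x Z by blast
        show "peval ((?D ^^ k) q) x = 0" if "k < m" for k using min[OF that] w x by blast
      qed
      then show ?thesis by simp
    qed simp
  qed
qed

end

section \<open>The inequality of Lojasiewicz\<close>

lemma poly_bounded_unit:
  fixes C :: "real poly"
  shows "\<exists>L\<ge>0. \<forall>x. 0 \<le> x \<longrightarrow> x \<le> 1 \<longrightarrow> \<bar>poly C x\<bar> \<le> L"
proof -
  have "bounded (poly C ` {0..1})" by (intro compact_imp_bounded compact_continuous_image continuous_intros) auto
  then obtain L where L: "\<forall>y\<in>poly C ` {0..1}. norm y \<le> L" unfolding bounded_iff by blast
  then have "\<bar>poly C x\<bar> \<le> L" if "0 \<le> x" "x \<le> 1" for x using that by auto
  moreover from this[of 0] have "0 \<le> L" by auto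
  ultimately show ?thesis by blast
qed

text \<open>The lowest nonzero term decides. The exponent \<open>M\<close> found is its degree plus
  one, so that \<open>x ^ M\<close> also absorbs the size of the coefficient.\<close>

lemma poly_sign_near_0:
  fixes C :: "real poly"
  assumes "C \<noteq> 0"
  shows "\<exists>e M. 0 < e \<and> (\<forall>x. 0 < x \<longrightarrow> x < e \<longrightarrow> x ^ M \<le> \<bar>poly C x\<bar>) \<and> ((\<forall>x. 0 < x \<longrightarrow> x < e \<longrightarrow> 0 < poly C x) \<or> (\<forall>x. 0 < x \<longrightarrow> x < e \<longrightarrow> poly C x < 0))"
  using assms
proof (induction C)
  case (pCons a C)
  show ?case
  proof (cases "a = 0")
    case True
    then obtain e M where e: "0 < e" "\<forall>x. 0 < x \<longrightarrow> x < e \<longrightarrow> x ^ M \<le> \<bar>poly C x\<bar>"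
      "(\<forall>x. 0 < x \<longrightarrow> x < e \<longrightarrow> 0 < poly C x) \<or> (\<forall>x. 0 < x \<longrightarrow> x < e \<longrightarrow> poly C x < 0)" using pCons by auto
    then show ?thesis using True
      by (intro exI[of _ e] exI[of _ "Suc M"]) (auto simp: abs_mult mult_pos_neg)
  next
    case False
    obtain L where L: "0 \<le> L" "\<And>x. 0 \<le> x \<Longrightarrow> x \<le> 1 \<Longrightarrow> \<bar>poly C x\<bar> \<le> L" using poly_bounded_unit by blast
    \<comment> \<open>Below \<open>e\<close>, both \<open>x\<close> and the contribution of the
      higher terms are at most half of the constant term in absolute value; \<open>L + 1\<close>
      keeps the divisor positive.\<close>
    define e where "e = min 1 (\<bar>a\<bar> / (2 * (L + 1)))"
    have pos: "0 < e" using L False by (simp add: e_def)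
    have small: "x \<le> \<bar>a\<bar> / 2 \<and> \<bar>x * poly C x\<bar> < \<bar>a\<bar> / 2" if "0 < x" "x < e" for x
    proof -
      have x: "x < 1" "x * (L + 1) < \<bar>a\<bar> / 2" using that L by (auto simp: e_def field_simps)
      have "x * 1 \<le> x * (L + 1)" using that L by (intro mult_left_mono) auto
      moreover have "\<bar>x * poly C x\<bar> \<le> x * (L + 1)"
        unfolding abs_mult using that x L(2)[of x] L(1) by (intro mult_mono) auto
      ultimately show ?thesis using x(2) by linarith
    qed
    show ?thesis
    proof (intro exI[of _ e] exI[of _ 1] conjI)
      show "0 < e" by (fact pos)
      show "\<forall>x. 0 < x \<longrightarrow> x < e \<longrightarrow> x ^ 1 \<le> \<bar>poly (pCons a C) x\<bar>"
      proof (intro allI impI)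
        fix x assume "0 < x" "x < e"
        from small[OF this] show "x ^ 1 \<le> \<bar>poly (pCons a C) x\<bar>" by (simp add: abs_if split: if_splits)
      qed
      show "(\<forall>x. 0 < x \<longrightarrow> x < e \<longrightarrow> 0 < poly (pCons a C) x) \<or> (\<forall>x. 0 < x \<longrightarrow> x < e \<longrightarrow> poly (pCons a C) x < 0)"
      proof (cases "0 < a")
        case True
        have "0 < poly (pCons a C) x" if "0 < x" "x < e" for x using small[OF that] True by (simp add: abs_if split: if_splits)
        then show ?thesis by blast
      next
        case n: False
        have "poly (pCons a C) x < 0" if "0 < x" "x < e" for x using small[OF that] n False by (simp add: abs_if split: if_splits)
        then show ?thesis by blast
      qed
    qed
  qed
qed simp

definition poly2 :: "real poly poly \<Rightarrow> real \<Rightarrow> real \<Rightarrow> real" where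
  "poly2 R x y = poly (map_poly (\<lambda>c. poly c x) R) y"

lemma poly2_simps: "poly2 0 x y = 0" "poly2 (pCons c R) x y = poly c x + y * poly2 R x y"
  "poly2 (R + R') x y = poly2 R x y + poly2 R' x y" "poly2 (R * R') x y = poly2 R x y * poly2 R' x y"
proof -
  have "ring_map (\<lambda>c. poly c x)" by (simp add: ring_map_def)
  note h = map_poly_ring_map[OF this]
  show "poly2 0 x y = 0" "poly2 (pCons c R) x y = poly c x + y * poly2 R x y"
    "poly2 (R + R') x y = poly2 R x y + poly2 R' x y" "poly2 (R * R') x y = poly2 R x y * poly2 R' x y"
    by (simp_all add: poly2_def map_poly_pCons h)
qed

lemma poly2_bounded: "\<exists>K. 0 \<le> K \<and> (\<forall>x\<in>{0..1}. \<forall>y\<in>{0..1}. \<bar>poly2 R x y\<bar> \<le> K)"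
proof (induction R)
  case 0
  then show ?case by (intro exI[of _ 0]) (simp add: poly2_simps)
next
  case (pCons c R)
  then obtain K where K: "0 \<le> K" "\<forall>x\<in>{0..1}. \<forall>y\<in>{0..1}. \<bar>poly2 R x y\<bar> \<le> K" by blast
  obtain L where L: "\<And>x. x \<in> {0..1} \<Longrightarrow> \<bar>poly c x\<bar> \<le> L" using poly_bounded_unit[of c] by auto
  have "\<bar>poly2 (pCons c R) x y\<bar> \<le> L + K" if "x \<in> {0..1}" "y \<in> {0..1}" for x y
  proof -
    have "\<bar>y * poly2 R x y\<bar> \<le> 1 * K" unfolding abs_mult using K that by (intro mult_mono) auto
    then show ?thesis using L[OF that(1)] unfolding poly2_simps by (simp add: abs_if split: if_splits)
  qed
  moreover have "0 \<le> L + K" using L[of 0] K by force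
  ultimately show ?case by blast
qed

text \<open>Raising \<open>N\<close> makes \<open>y\<close> negligible against a given power of
  \<open>x\<close>. The strict bounds exclude both axes, where signs may differ.\<close>

definition horn :: "nat \<Rightarrow> real \<Rightarrow> real \<Rightarrow> real \<Rightarrow> bool" where
  "horn N e x y \<longleftrightarrow> 0 < x \<and> x < e \<and> 0 < y \<and> y \<le> x ^ N"

text \<open>The polynomial is a term \<open>c\<close> in \<open>x\<close> alone plus
  \<open>y\<close> times a polynomial of lower degree in \<open>y\<close>. If \<open>c\<close> is
  nonzero, it is at least \<open>x ^ M\<close> in absolute value and dominates, as the second part
  is at most \<open>K * x ^ Suc M\<close>. If \<open>c\<close> is zero, the positive factor
  \<open>y\<close> splits off.\<close>

lemma poly2_sign_constant:
  "\<exists>N e. 0 < e \<and> (\<forall>x y x' y'. horn N e x y \<longrightarrow> horn N e x' y' \<longrightarrow> ssign (poly2 R x y) (poly2 R x' y'))"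
proof (induction R)
  case 0
  then show ?case by (intro exI[of _ 0] exI[of _ 1]) (simp add: poly2_simps ssign_def)
next
  case (pCons c R)
  show ?case
  proof (cases "c = 0")
    case True
    obtain N e where "0 < e" and IH: "\<And>x y x' y'. horn N e x y \<Longrightarrow> horn N e x' y' \<Longrightarrow> ssign (poly2 R x y) (poly2 R x' y')"
      using pCons.IH by blast
    have "ssign (poly2 (pCons c R) x y) (poly2 (pCons c R) x' y')" if xy: "horn N e x y" "horn N e x' y'" for x y x' y'
    proof -
      have "ssign y y'" using xy by (simp add: horn_def ssign_def)
      then have "ssign (y * poly2 R x y) (y' * poly2 R x' y')" using IH[OF xy] by (rule ssign_mult)
      then show ?thesis by (simp add: poly2_simps True)
    qed
    then show ?thesis using \<open>0 < e\<close> by blast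
  next
    case False
    obtain e M where e: "0 < e" "\<forall>x. 0 < x \<longrightarrow> x < e \<longrightarrow> x ^ M \<le> \<bar>poly c x\<bar>"
      "(\<forall>x. 0 < x \<longrightarrow> x < e \<longrightarrow> 0 < poly c x) \<or> (\<forall>x. 0 < x \<longrightarrow> x < e \<longrightarrow> poly c x < 0)"
      using poly_sign_near_0[OF False] by (elim exE conjE)
    obtain K where K: "0 \<le> K" "\<forall>x\<in>{0..1}. \<forall>y\<in>{0..1}. \<bar>poly2 R x y\<bar> \<le> K" using poly2_bounded[of R] by (elim exE conjE)
    define e' where "e' = min e (1 / (K + 1))"
    have e'1: "e' \<le> 1" using K(1) by (simp add: e'_def min_le_iff_disj)
    have small: "\<bar>y * poly2 R x y\<bar> < \<bar>poly c x\<bar>" if xy: "horn (Suc M) e' x y" for x y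
    proof -
      have xy: "0 < x" "x < e'" "0 < y" "y \<le> x ^ Suc M" using xy by (simp_all add: horn_def)
      have x1: "x < 1" "x < e" "x < 1 / (K + 1)" using xy e'1 by (auto simp: e'_def)
      then have xK: "x * (K + 1) < 1" using K(1) by (simp add: pos_less_divide_eq)
      have "x ^ Suc M \<le> 1" using xy x1 by (intro power_le_one) auto
      then have y1: "y \<le> 1" using xy by linarith
      have "\<bar>poly2 R x y\<bar> \<le> K" using K(2) xy x1 y1 by simp
      then have "\<bar>y * poly2 R x y\<bar> \<le> x ^ Suc M * K" unfolding abs_mult using xy by (intro mult_mono) simp_all
      also have "\<dots> = x ^ M * (x * K)" by simp
      also have "\<dots> < x ^ M * 1"
      proof (rule mult_strict_left_mono)
        show "x * K < 1" using xK xy(1) by (simp add: algebra_simps)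
      qed (use xy in simp)
      also have "\<dots> \<le> \<bar>poly c x\<bar>" using e(2) xy x1 by simp
      finally show ?thesis .
    qed
    have dom: "0 < c + u \<longleftrightarrow> 0 < c" "c + u < 0 \<longleftrightarrow> c < 0" if "\<bar>u\<bar> < \<bar>c\<bar>" for c u :: real
      using that by linarith+
    have "ssign (poly2 (pCons c R) x y) (poly2 (pCons c R) x' y')" if xy: "horn (Suc M) e' x y" "horn (Suc M) e' x' y'" for x y x' y'
    proof -
      have "0 < x" "0 < x'" "x < e" "x' < e" using xy by (auto simp: e'_def horn_def)
      then have "ssign (poly c x) (poly c x')" using e(3) by (auto simp: ssign_def)
      then show ?thesis using dom[OF small[OF xy(1)]] dom[OF small[OF xy(2)]] unfolding poly2_simps ssign_def
        by simp
    qed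
    moreover have "0 < e'" using e(1) K(1) by (simp add: e'_def)
    ultimately show ?thesis by blast
  qed
qed

lemma poly2_sign_constant_finite:
  assumes "finite S"
  shows "\<exists>N e. 0 < e \<and> (\<forall>R\<in>S. \<forall>x y x' y'. horn N e x y \<longrightarrow> horn N e x' y' \<longrightarrow> ssign (poly2 R x y) (poly2 R x' y'))"
  using assms
proof (induction S rule: finite_induct)
  case empty
  show ?case by (intro exI[of _ 0] exI[of _ 1]) simp
next
  case (insert R S)
  obtain N e where N: "0 < e" "\<forall>R\<in>S. \<forall>x y x' y'. horn N e x y \<longrightarrow> horn N e x' y' \<longrightarrow> ssign (poly2 R x y) (poly2 R x' y')"
    using insert.IH by (elim exE conjE)
  obtain N' e' where N': "0 < e'" "\<forall>x y x' y'. horn N' e' x y \<longrightarrow> horn N' e' x' y' \<longrightarrow> ssign (poly2 R x y) (poly2 R x' y')"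
    using poly2_sign_constant[of R] by (elim exE conjE)
  define d where "d = min 1 (min e e')"
  have mono: "horn n f x y" if h: "horn (max N N') d x y" "n \<le> max N N'" "d \<le> f" for n f x y
  proof -
    have "x ^ max N N' \<le> x ^ n"
      using h by (intro power_decreasing) (auto simp: d_def horn_def)
    then show ?thesis using h by (auto simp: horn_def)
  qed
  have "horn N e x y" "horn N' e' x y" if "horn (max N N') d x y" for x y
    by (rule mono[OF that]; simp add: d_def)+
  then have "\<forall>R'\<in>insert R S. \<forall>x y x' y'. horn (max N N') d x y \<longrightarrow> horn (max N N') d x' y' \<longrightarrow> ssign (poly2 R' x y) (poly2 R' x' y')"
    using N(2) N'(2) by simp
  moreover have "0 < d" using N N' by (simp add: d_def)
  ultimately show ?case by blast
qed

lemma pvars_two_poly2: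
  assumes "s \<in> pvars {i, j}" "i \<noteq> j"
  shows "\<exists>R. \<forall>a. peval s a = poly2 R (a $ i) (a $ j)"
  using assms(1)
proof (induction rule: pvars.induct)
  case (const c)
  show ?case by (rule exI[of _ "[:[:c:]:]"]) (simp add: poly2_simps)
next
  case (coord k)
  then show ?case
  proof
    assume "k = i"
    then show ?thesis by (intro exI[of _ "[:[:0, 1:]:]"]) (simp add: poly2_simps)
  next
    assume "k \<in> {j}"
    then show ?thesis by (intro exI[of _ "[:0, 1:]"]) (simp add: poly2_simps)
  qed
next
  case (add p q)
  then show ?case by (metis peval_simps(3) poly2_simps(3))
next
  case (mult p q)
  then show ?case by (metis peval_simps(4) poly2_simps(4))
qed

section \<open>The inequality on the variety\<close>

context smooth_variety
begin

lemma V_closed: "closed V"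
proof -
  obtain v where "\<And>x. peval v x = 0 \<longleftrightarrow> x \<in> V" using V_equation by metis
  then have "V = {x. peval v x = 0}" by auto
  then show ?thesis by (auto intro!: closed_Collect_eq continuous_intros)
qed

text \<open>The pairs (x, y) of parameters for which the bound fails form a semialgebraic set, which near the
  origin is constant on a horn below the curve y = x ^ N. Compactness gives the bound for some y.\<close>

lemma lojasiewicz_uniform:
  assumes h: "continuous_on V h" "\<And>x. x \<in> V \<Longrightarrow> peval q x * h x = peval p x"
    and z: "\<And>x. x \<in> V \<Longrightarrow> peval g x = 0 \<Longrightarrow> h x = 0"
  obtains N e where "0 < e"
    "\<And>t x. 0 < t \<Longrightarrow> t < e \<Longrightarrow> x \<in> V \<Longrightarrow> t * (x \<bullet> x) \<le> 1 \<Longrightarrow> peval q x \<noteq> 0 \<Longrightarrow> \<bar>peval g x\<bar> \<le> t ^ N \<Longrightarrow> \<bar>h x\<bar> \<le> t"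
proof -
  obtain v where v: "\<And>x. peval v x = 0 \<longleftrightarrow> x \<in> V" using V_equation by metis
  define emb :: "'n pfun \<Rightarrow> ('n + bool) pfun" where "emb = psubst (\<lambda>i. pcoord (Inl i))"
  have emb: "peval (emb p) a = peval p (\<chi> i. a $ Inl i)" for p a by (simp add: emb_def)
  let ?X = "pcoord (Inr True) :: ('n + bool) pfun" and ?Y = "pcoord (Inr False) :: ('n + bool) pfun"
  define nrm :: "'n pfun" where "nrm = (\<Sum>i\<in>UNIV. pcoord i * pcoord i)"
  have nrm: "peval nrm x = x \<bullet> x" for x by (simp add: nrm_def inner_vec_def)
  \<comment> \<open>The signs of \<open>F\<close> encode \<open>bad\<close> by polynomials only:
    where \<open>q\<close> is nonzero, \<open>h\<close> is \<open>p / q\<close>, and absolute values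
    are compared through their squares.\<close>
  define F where "F = {emb v, 1 - ?X * emb nrm, emb q, ?Y * ?Y - emb g * emb g, emb p * emb p - ?X * ?X * (emb q * emb q)}"
  define bad where "bad t y x \<longleftrightarrow> x \<in> V \<and> t * (x \<bullet> x) \<le> 1 \<and> peval q x \<noteq> 0 \<and> (peval g x)\<^sup>2 \<le> y\<^sup>2 \<and> t\<^sup>2 * (peval q x)\<^sup>2 < (peval p x)\<^sup>2" for t y x
  let ?I = "{Inr True, Inr False} :: ('n + bool) set"
  obtain S where S: "finite S" "S \<subseteq> pvars ?I" and S': "\<And>a (b :: ('n + bool) pfun \<Rightarrow> real). ring_map b \<Longrightarrow>
      \<forall>s\<in>S. ssign (peval s a) (b s) \<Longrightarrow> \<exists>a'. (\<forall>i\<in>?I. a' $ i = a $ i) \<and> (\<forall>f\<in>F. ssign (peval f a') (b f))"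
    using elimination[of F ?I, where 'r = real] by (auto simp: F_def)
  have "\<forall>s\<in>S. \<exists>R. \<forall>a. peval s a = poly2 R (a $ Inr True) (a $ Inr False)" using S(2) pvars_two_poly2 by blast
  then obtain R where R: "\<And>s a. s \<in> S \<Longrightarrow> peval s a = poly2 (R s) (a $ Inr True) (a $ Inr False)" by metis
  obtain N e where e: "0 < e" and N: "\<forall>P\<in>R ` S. \<forall>x y x' y'. horn N e x y \<longrightarrow> horn N e x' y' \<longrightarrow> ssign (poly2 P x y) (poly2 P x' y')"
    using poly2_sign_constant_finite[OF finite_imageI[OF S(1)], of R] by (elim exE conjE)
  have transfer: "\<exists>x'. bad t' y' x'" if b: "bad t y x" and ty: "horn N e t y" "horn N e t' y'" for t y x t' y'
  proof -
    define b where "b = (\<chi> k. case k of Inl i \<Rightarrow> x $ i | Inr k \<Rightarrow> if k then t else y)"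
    define a where "a = (\<chi> k :: 'n + bool. case k of Inl i \<Rightarrow> 0 | Inr k \<Rightarrow> if k then t' else y')"
    have "\<forall>s\<in>S. ssign (peval s a) (peval s b)" using N ty by (simp add: R a_def b_def)
    then obtain a' where a': "\<forall>i\<in>?I. a' $ i = a $ i" "\<forall>f\<in>F. ssign (peval f a') (peval f b)"
      using S'[OF ring_map_peval[of b], of a] by blast
    have bx: "(\<chi> i. b $ Inl i) = x" "b $ Inr True = t" "b $ Inr False = y" by (auto simp: b_def vec_eq_iff)
    have ax: "a' $ Inr True = t'" "a' $ Inr False = y'" using a'(1) by (auto simp: a_def)
    define x' where "x' = (\<chi> i. a' $ Inl i)"
    have s: "ssign (peval v x') (peval v x)" "ssign (1 - t' * (x' \<bullet> x')) (1 - t * (x \<bullet> x))" "ssign (peval q x') (peval q x)"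
      "ssign (y' * y' - peval g x' * peval g x') (y * y - peval g x * peval g x)"
      "ssign (peval p x' * peval p x' - t' * t' * (peval q x' * peval q x')) (peval p x * peval p x - t * t * (peval q x * peval q x))"
      using a'(2) by (auto simp: F_def emb bx ax nrm x'_def)
    have "x' \<in> V" using ssign_zero[OF s(1)] v b by (auto simp: bad_def)
    moreover have "t' * (x' \<bullet> x') \<le> 1" using s(2) b by (auto simp: ssign_def bad_def)
    moreover have "peval q x' \<noteq> 0" using ssign_zero[OF s(3)] b by (auto simp: bad_def)
    moreover have "(peval g x')\<^sup>2 \<le> y'\<^sup>2" using s(4) b by (auto simp: ssign_def bad_def power2_eq_square)
    moreover have "t'\<^sup>2 * (peval q x')\<^sup>2 < (peval p x')\<^sup>2" using s(5) b by (auto simp: ssign_def bad_def power2_eq_square)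
    ultimately show ?thesis by (auto simp: bad_def)
  qed
  have bad_iff: "bad t y x \<Longrightarrow> t < \<bar>h x\<bar> \<and> \<bar>peval g x\<bar> \<le> y" if "0 < t" "0 < y" for t y x
  proof -
    assume b: "bad t y x"
    then have "t\<^sup>2 * (peval q x)\<^sup>2 < (h x)\<^sup>2 * (peval q x)\<^sup>2" using h(2)[of x, symmetric] by (simp add: bad_def power_mult_distrib mult.commute)
    then have "t\<^sup>2 < (h x)\<^sup>2" using b by (auto simp: bad_def mult_less_cancel_right)
    then have "t < \<bar>h x\<bar>" by (metis abs_ge_zero power2_abs power2_less_imp_less)
    moreover have "\<bar>peval g x\<bar> \<le> \<bar>y\<bar>" using b by (simp add: bad_def abs_le_square_iff)
    ultimately show ?thesis using that by simp
  qed
  have good: "\<exists>y>0. y \<le> t ^ N \<and> (\<forall>x. \<not> bad t y x)" if t: "0 < t" "t < e" for t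
  proof -
    \<comment> \<open>On this compact set \<open>g\<close> has no zero, so it stays away from 0.
      That excludes bad points for a small \<open>y\<close> depending on \<open>t\<close>.\<close>
    define K where "K = {x \<in> V. t * (x \<bullet> x) \<le> 1 \<and> t \<le> \<bar>h x\<bar>}"
    have K: "K = (V \<inter> {x. t * (x \<bullet> x) \<le> 1}) \<inter> {x \<in> V. t \<le> \<bar>h x\<bar>}" by (auto simp: K_def)
    have "closed {x \<in> V. t \<le> \<bar>h x\<bar>}"
      using continuous_closed_preimage[OF continuous_on_rabs[OF h(1)] V_closed, of "{t..}"]
      by (simp add: vimage_def Int_def)
    moreover have "closed {x :: real^'n. t * (x \<bullet> x) \<le> 1}" by (intro closed_Collect_le continuous_intros)
    ultimately have cl: "closed K" unfolding K using V_closed by auto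
    have "K \<subseteq> cball 0 (sqrt (1 / t))"
    proof
      fix x assume "x \<in> K"
      then have "x \<bullet> x \<le> 1 / t" using t by (simp add: K_def field_simps)
      then show "x \<in> cball 0 (sqrt (1 / t))" by (simp add: norm_eq_sqrt_inner)
    qed
    then have cK: "compact K" using cl bounded_subset[OF bounded_cball] compact_eq_bounded_closed by blast
    have "\<exists>d>0. \<forall>x\<in>K. d \<le> \<bar>peval g x\<bar>"
    proof (cases "K = {}")
      case True
      then show ?thesis by (intro exI[of _ 1]) simp
    next
      case False
      have "continuous_on K (\<lambda>x. \<bar>peval g x\<bar>)" by (intro continuous_intros)
      then obtain x where x: "x \<in> K" "\<forall>y\<in>K. \<bar>peval g x\<bar> \<le> \<bar>peval g y\<bar>"
        using continuous_attains_inf[OF cK False] by blast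
      have "peval g x \<noteq> 0" using x(1) z[of x] t by (auto simp: K_def)
      then show ?thesis using x(2) by (intro exI[of _ "\<bar>peval g x\<bar>"]) simp
    qed
    then obtain d where d: "0 < d" "\<And>x. x \<in> K \<Longrightarrow> d \<le> \<bar>peval g x\<bar>" by blast
    define y where "y = min (t ^ N) (d / 2)"
    have y: "0 < y" "y \<le> t ^ N" "y < d" using t d by (auto simp: y_def)
    moreover have "\<not> bad t y x" for x
    proof
      assume b: "bad t y x"
      then have "t < \<bar>h x\<bar>" "\<bar>peval g x\<bar> \<le> y" using bad_iff[OF t(1) y(1)] by auto
      moreover from this b have "x \<in> K" by (auto simp: K_def bad_def)
      ultimately show False using d(2)[of x] y by linarith
    qed
    ultimately show ?thesis by blast
  qed
  show ?thesis
  proof (rule that[OF e])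
    fix t x assume t: "0 < t" "t < e" and x: "x \<in> V" "t * (x \<bullet> x) \<le> 1" "peval q x \<noteq> 0" "\<bar>peval g x\<bar> \<le> t ^ N"
    show "\<bar>h x\<bar> \<le> t"
    proof (rule ccontr)
      assume "\<not> \<bar>h x\<bar> \<le> t"
      then have "t\<^sup>2 < (h x)\<^sup>2" using t(1) by (metis abs_of_pos not_le power2_abs power_strict_mono abs_ge_zero pos2 less_imp_le)
      then have "t\<^sup>2 * (peval q x)\<^sup>2 < (peval p x)\<^sup>2" using h(2)[OF x(1), symmetric] x(3) by (simp add: power_mult_distrib mult.commute)
      moreover have "(peval g x)\<^sup>2 \<le> (t ^ N)\<^sup>2" using x(4) t(1) by (simp add: abs_le_square_iff[symmetric])
      ultimately have "bad t (t ^ N) x" using x by (simp add: bad_def)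
      moreover obtain y where "0 < y" "y \<le> t ^ N" "\<forall>x. \<not> bad t y x" using good[OF t] by blast
      ultimately show False using transfer[of t "t ^ N" x t y] t by (auto simp: horn_def)
    qed
  qed
qed

text \<open>Near a zero of \<open>g\<close>, taking half of \<open>|h|\<close> as the parameter of
  the uniform bound would give \<open>|h| \<le> |h| / 2\<close>, unless \<open>|h| ^ N\<close> is at
  most \<open>2 ^ N * |g|\<close>. Hence \<open>h ^ Suc N / g\<close> is bounded by a multiple of
  \<open>|h|\<close> and tends to 0, which is the value that division by zero assigns.\<close>

theorem lojasiewicz:
  assumes h: "continuous_on V h" "\<And>x. x \<in> V \<Longrightarrow> peval q x * h x = peval p x" and q: "q \<notin> IV"
    and z: "\<And>x. x \<in> V \<Longrightarrow> peval g x = 0 \<Longrightarrow> h x = 0"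
  obtains N where "continuous_on V (\<lambda>x. h x ^ Suc N / peval g x)"
proof -
  obtain N e where e: "0 < e" and N: "\<And>t x. 0 < t \<Longrightarrow> t < e \<Longrightarrow> x \<in> V \<Longrightarrow> t * (x \<bullet> x) \<le> 1 \<Longrightarrow> peval q x \<noteq> 0 \<Longrightarrow> \<bar>peval g x\<bar> \<le> t ^ N \<Longrightarrow> \<bar>h x\<bar> \<le> t"
    by (rule lojasiewicz_uniform[OF h z]; (assumption | (rule that, assumption, blast)))
  have "((\<lambda>x. h x ^ Suc N / peval g x) \<longlongrightarrow> h a ^ Suc N / peval g a) (at a within V)" if a: "a \<in> V" for a
  proof (cases "peval g a = 0")
    case False
    have "((\<lambda>x. peval g x) \<longlongrightarrow> peval g a) (at a within V)"
      using continuous_on_peval[of V "\<lambda>x. x" g] a by (simp add: continuous_on_def)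
    moreover have "(h \<longlongrightarrow> h a) (at a within V)" using h(1) a by (simp add: continuous_on_def)
    ultimately show ?thesis using False by (intro tendsto_divide tendsto_power)
  next
    case True
    then have ha: "h a = 0" using z a by blast
    have hl: "(h \<longlongrightarrow> 0) (at a within V)" using h(1) a ha by (auto simp: continuous_on_def)
    \<comment> \<open>This bounds \<open>x \<bullet> x\<close> on the unit ball around
      \<open>a\<close>, so that \<open>t * (x \<bullet> x) \<le> 1\<close> holds once
      \<open>t\<close> is small.\<close>
    define b where "b = (norm a + 1)\<^sup>2"
    have "0 < norm a + 1" by (simp add: add_nonneg_pos)
    then have b: "0 < b" by (simp add: b_def)
    obtain d where d: "0 < d" "\<And>x. x \<in> V \<Longrightarrow> dist x a < d \<Longrightarrow> \<bar>h x\<bar> < min e (1 / b)"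
    proof -
      have "\<exists>d>0. \<forall>x\<in>V. dist x a < d \<longrightarrow> dist (h x) (h a) < min e (1 / b)"
        by (rule h(1)[unfolded continuous_on_iff, rule_format, OF a]) (use e b in simp)
      then show ?thesis using that ha by (auto simp: dist_real_def)
    qed
    define U where "U = ball a (min d 1)"
    have near: "\<bar>h x\<bar> ^ N \<le> 2 ^ N * \<bar>peval g x\<bar>" if x: "x \<in> V" "x \<in> U" "peval q x \<noteq> 0" "h x \<noteq> 0" for x
    proof (rule ccontr)
      assume n: "\<not> ?thesis"
      define t where "t = \<bar>h x\<bar> / 2"
      have hx: "\<bar>h x\<bar> < min e (1 / b)" using d(2)[of x] x by (simp add: U_def dist_commute)
      have "norm x \<le> norm a + 1"
        using x(2) norm_triangle_sub[of x a] by (simp add: U_def dist_norm norm_minus_commute)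
      then have "x \<bullet> x \<le> b" unfolding b_def power2_norm_eq_inner[symmetric] by (intro power_mono) auto
      then have "t * (x \<bullet> x) \<le> t * b" by (intro mult_left_mono) (simp_all add: t_def)
      also have "\<dots> \<le> 1" using hx b by (simp add: t_def field_simps)
      finally have "t * (x \<bullet> x) \<le> 1" .
      moreover have "0 < t" "t < e" using hx x(4) by (auto simp: t_def)
      moreover have "\<bar>peval g x\<bar> \<le> t ^ N" using n by (simp add: t_def power_divide field_simps)
      ultimately have "\<bar>h x\<bar> \<le> t" using N x by blast
      then show False using x(4) by (simp add: t_def)
    qed
    \<comment> \<open>The zeros of \<open>q\<close> are handled by density: failure of the bound is
      an open condition on \<open>V\<close>, and every nonempty open part of \<open>V\<close>
      contains points where \<open>q\<close> is nonzero.\<close>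
    have near': "\<bar>h x\<bar> ^ N \<le> 2 ^ N * \<bar>peval g x\<bar>" if x: "x \<in> V" "x \<in> U" "h x \<noteq> 0" for x
    proof (rule ccontr)
      assume n: "\<not> ?thesis"
      define f where "f x = \<bar>h x\<bar> ^ N - 2 ^ N * \<bar>peval g x\<bar>" for x
      have "continuous_on V f" unfolding f_def by (intro continuous_intros h(1))
      then have "openin (top_of_set V) (V \<inter> f -` {0<..})" "openin (top_of_set V) (V \<inter> h -` (- {0}))"
        using h(1) continuous_openin_preimage_gen open_greaterThan open_Compl closed_singleton by blast+
      then obtain W W' where W: "open W" "V \<inter> f -` {0<..} = V \<inter> W" "open W'" "V \<inter> h -` (- {0}) = V \<inter> W'"
        unfolding openin_open by auto
      have "x \<in> W" "x \<in> W'" using W n x by (auto simp: f_def)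
      then have "x \<in> U \<inter> W \<inter> W'" "open (U \<inter> W \<inter> W')" using x(2) W by (auto simp: U_def)
      then obtain y where y: "y \<in> V" "y \<in> U \<inter> W \<inter> W'" "peval q y \<noteq> 0"
        using nonvanishing_nearby[OF q x(1), of "U \<inter> W \<inter> W'"] by metis
      then have "y \<in> V \<inter> f -` {0<..}" "y \<in> V \<inter> h -` (- {0})" unfolding W by auto
      then show False using near[of y] y by (auto simp: f_def)
    qed
    have "\<bar>h x ^ Suc N / peval g x\<bar> \<le> 2 ^ N * \<bar>h x\<bar>" if x: "x \<in> V" "x \<in> U" for x
    proof (cases "h x = 0 \<or> peval g x = 0")
      case False
      have "\<bar>h x\<bar> ^ Suc N = \<bar>h x\<bar> * \<bar>h x\<bar> ^ N" by simp
      also have "\<dots> \<le> \<bar>h x\<bar> * (2 ^ N * \<bar>peval g x\<bar>)" using near'[OF x] False by (intro mult_left_mono) auto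
      finally show ?thesis using False by (simp add: abs_mult power_abs field_simps)
    qed auto
    then have "eventually (\<lambda>x. norm (h x ^ Suc N / peval g x) \<le> 2 ^ N * \<bar>h x\<bar>) (at a within V)"
      unfolding eventually_at using d(1)
      by (intro exI[of _ "min d 1"]) (auto simp: U_def dist_commute)
    moreover have "((\<lambda>x. 2 ^ N * \<bar>h x\<bar>) \<longlongrightarrow> 0) (at a within V)" using tendsto_mult_right_zero[OF tendsto_rabs_zero[OF hl]] .
    ultimately have "((\<lambda>x. h x ^ Suc N / peval g x) \<longlongrightarrow> 0) (at a within V)" by (rule Lim_null_comparison)
    then show ?thesis by (simp add: ha)
  qed
  then have "continuous_on V (\<lambda>x. h x ^ Suc N / peval g x)" by (simp add: continuous_on_def)
  then show ?thesis by (rule that)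
qed

end

section \<open>Extension of cones and homomorphisms\<close>

context smooth_variety
begin

definition rs :: "'n pfun \<Rightarrow> real^'n \<Rightarrow> real" where "rs p = restr V (peval p)"

lemma rs_simps: "(\<lambda>x. rs p x + rs q x) = rs (p + q)" "(\<lambda>x. rs p x * rs q x) = rs (p * q)" "(\<lambda>x. - rs p x) = rs (- p)"
  "one_on V = rs 1" "(\<lambda>x. - (rs p x * rs q x)) = rs (- (p * q))"
  by (auto simp: rs_def restr_def one_on_def)

lemma rs_in: "x \<in> V \<Longrightarrow> rs p x = peval p x"
  by (simp add: rs_def restr_def)

lemma coord_ring_eq: "coord_ring V = range rs"
  unfolding coord_ring_def poly_fun_range rs_def by auto

lemma rs_eq_iff: "rs p = rs q \<longleftrightarrow> p - q \<in> IV"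
  unfolding rs_def restr_def IV_def fun_eq_iff by auto

text \<open>Multiplying numerator and denominator by a polynomial \<open>s\<close> that vanishes on
  the complement of the open set makes the relation hold on all of \<open>V\<close>. In this form
  without division it is stable under sums and products, because the ideal of \<open>V\<close> is
  prime.\<close>

lemma cont_rat_iff:
  "f \<in> cont_rat V \<longleftrightarrow> (\<forall>x. x \<notin> V \<longrightarrow> f x = 0) \<and> continuous_on V f \<and>
     (\<exists>p q. q \<notin> IV \<and> (\<forall>x\<in>V. peval q x * f x = peval p x))"
proof -
  have "(\<exists>W. zariski_open_in V W \<and> W \<noteq> {} \<and> regular_on V W f) \<longleftrightarrow>
     (\<exists>p q. q \<notin> IV \<and> (\<forall>x\<in>V. peval q x * f x = peval p x))"
  proof
    assume "\<exists>W. zariski_open_in V W \<and> W \<noteq> {} \<and> regular_on V W f"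
    then obtain W x where W: "zariski_open_in V W" "x \<in> W" "regular_on V W f" by blast
    then obtain U p0 q0 where U: "zariski_open_in V U" "x \<in> U" "p0 \<in> poly_fun" "q0 \<in> poly_fun" "\<forall>y\<in>U. q0 y \<noteq> 0 \<and> f y = p0 y / q0 y"
      unfolding regular_on_def by blast
    obtain p q where pq: "p0 = peval p" "q0 = peval q" using U(3,4) unfolding poly_fun_range by blast
    obtain S where S: "U \<subseteq> V" "S \<subseteq> poly_fun" "V - U = V \<inter> zero_set S"
      using U(1) unfolding zariski_open_in_def zariski_closed_in_def by blast
    then obtain s0 where "s0 \<in> S" "s0 x \<noteq> 0" using U(2) unfolding zero_set_def by blast
    then obtain s where s: "peval s \<in> S" "peval s x \<noteq> 0" using S(2) unfolding poly_fun_range by blast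
    have "peval (q * s) y * f y = peval (p * s) y" if y: "y \<in> V" for y
    proof (cases "peval s y = 0")
      case False
      then have "y \<in> U" using y S(3) s(1) unfolding zero_set_def by blast
      then have "f y = peval p y / peval q y" "peval q y \<noteq> 0" using U(5) pq by auto
      then show ?thesis by simp
    qed simp
    moreover have "q * s \<notin> IV" using IV_D[of "q * s" x] S(1) U(2,5) s(2) pq by auto
    ultimately show "\<exists>p q. q \<notin> IV \<and> (\<forall>x\<in>V. peval q x * f x = peval p x)" by blast
  next
    assume "\<exists>p q. q \<notin> IV \<and> (\<forall>x\<in>V. peval q x * f x = peval p x)"
    then obtain p q where pq: "q \<notin> IV" "\<And>x. x \<in> V \<Longrightarrow> peval q x * f x = peval p x" by blast
    define W where "W = {x \<in> V. peval q x \<noteq> 0}"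
    have "V - W = V \<inter> zero_set {peval q}" by (auto simp: W_def zero_set_def)
    moreover have "{peval q} \<subseteq> poly_fun" by (simp add: peval)
    ultimately have W: "zariski_open_in V W" unfolding zariski_open_in_def zariski_closed_in_def W_def by blast
    have "regular_on V W f"
      unfolding regular_on_def
    proof
      fix x assume "x \<in> W"
      moreover have "\<forall>y\<in>W. peval q y \<noteq> 0 \<and> f y = peval p y / peval q y"
        using pq(2) by (auto simp: W_def field_simps)
      ultimately show "\<exists>U p q. zariski_open_in V U \<and> x \<in> U \<and> U \<subseteq> W \<and> p \<in> poly_fun \<and> q \<in> poly_fun \<and> (\<forall>y\<in>U. q y \<noteq> 0 \<and> f y = p y / q y)"
        using W peval by blast
    qed
    moreover have "W \<noteq> {}" using pq(1) by (auto simp: W_def IV_def)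
    ultimately show "\<exists>W. zariski_open_in V W \<and> W \<noteq> {} \<and> regular_on V W f" using W by blast
  qed
  then show ?thesis unfolding cont_rat_def by simp
qed

lemma cont_ratI:
  assumes "\<And>x. x \<notin> V \<Longrightarrow> f x = 0" "continuous_on V f" "q \<notin> IV" "\<And>x. x \<in> V \<Longrightarrow> peval q x * f x = peval p x"
  shows "f \<in> cont_rat V"
  using assms unfolding cont_rat_iff by blast

lemma cont_ratD:
  assumes "f \<in> cont_rat V"
  shows "x \<notin> V \<Longrightarrow> f x = 0" "continuous_on V f" "\<exists>p q. q \<notin> IV \<and> (\<forall>x\<in>V. peval q x * f x = peval p x)"
  using assms unfolding cont_rat_iff by simp_all

lemma cont_rat_ring:
  assumes f: "f \<in> cont_rat V" and g: "g \<in> cont_rat V"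
  shows "(\<lambda>x. f x + g x) \<in> cont_rat V" "(\<lambda>x. f x * g x) \<in> cont_rat V" "(\<lambda>x. - f x) \<in> cont_rat V"
proof -
  obtain p q where rf: "q \<notin> IV" "\<forall>x\<in>V. peval q x * f x = peval p x"
    using cont_ratD(3)[OF f] by (elim exE conjE)
  note f' = cont_ratD(1,2)[OF f] rf(1) bspec[OF rf(2)]
  obtain p' q' where rg: "q' \<notin> IV" "\<forall>x\<in>V. peval q' x * g x = peval p' x"
    using cont_ratD(3)[OF g] by (elim exE conjE)
  note g' = cont_ratD(1,2)[OF g] rg(1) bspec[OF rg(2)]
  have qq: "q * q' \<notin> IV" using IV_prime f'(3) g'(3) by blast
  show "(\<lambda>x. f x + g x) \<in> cont_rat V"
  proof (rule cont_ratI[OF _ _ qq])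
    show "peval (q * q') x * (f x + g x) = peval (p * q' + p' * q) x" if "x \<in> V" for x
      using f'(4)[OF that, symmetric] g'(4)[OF that, symmetric] by (simp add: algebra_simps)
  qed (use f'(1,2) g'(1,2) in \<open>auto intro!: continuous_intros\<close>)
  show "(\<lambda>x. f x * g x) \<in> cont_rat V"
  proof (rule cont_ratI[OF _ _ qq])
    show "peval (q * q') x * (f x * g x) = peval (p * p') x" if "x \<in> V" for x
      using f'(4)[OF that, symmetric] g'(4)[OF that, symmetric] by simp
  qed (use f'(1,2) g'(1,2) in \<open>auto intro!: continuous_intros\<close>)
  show "(\<lambda>x. - f x) \<in> cont_rat V"
  proof (rule cont_ratI[OF _ _ f'(3)])
    show "peval q x * (- f x) = peval (- p) x" if "x \<in> V" for x using f'(4)[OF that] by simp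
  qed (use f'(1,2) in \<open>auto intro!: continuous_intros\<close>)
qed

lemma rs_cont_rat: "rs p \<in> cont_rat V"
proof (rule cont_ratI[OF _ _ IV_one])
  have "continuous_on V (peval p)" by (intro continuous_intros)
  then show "continuous_on V (rs p)" by (rule continuous_on_eq) (simp add: rs_in)
  show "peval 1 x * rs p x = peval p x" if "x \<in> V" for x using that by (simp add: rs_in)
qed (simp add: rs_def restr_def)

lemma cont_rat_power: "f \<in> cont_rat V \<Longrightarrow> (\<lambda>x. f x ^ Suc n) \<in> cont_rat V"
  by (induction n) (auto intro: cont_rat_ring)

text \<open>The algebraic form of the inequality: a homomorphism or a prime cone on the continuous
  rational functions that kills \<open>g\<close> also kills \<open>h\<close>. If \<open>g\<close> is
  zero on \<open>V\<close>, then \<open>h\<close> and the quotient are zero.\<close>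

lemma vanishing_power_factor:
  assumes h: "h \<in> cont_rat V" and z: "\<And>x. x \<in> V \<Longrightarrow> peval g x = 0 \<Longrightarrow> h x = 0"
  obtains N k where "k \<in> cont_rat V" "(\<lambda>x. h x ^ Suc N) = (\<lambda>x. rs g x * k x)"
proof -
  obtain p q where rh: "q \<notin> IV" "\<forall>x\<in>V. peval q x * h x = peval p x"
    using cont_ratD(3)[OF h] by (elim exE conjE)
  note h' = cont_ratD(1,2)[OF h] rh(1) bspec[OF rh(2)]
  obtain N where N: "continuous_on V (\<lambda>x. h x ^ Suc N / peval g x)" using lojasiewicz[OF h'(2,4,3) z] by blast
  define k where "k x = h x ^ Suc N / peval g x" for x
  have eq: "(\<lambda>x. h x ^ Suc N) = (\<lambda>x. rs g x * k x)"
  proof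
    fix x show "h x ^ Suc N = rs g x * k x"
      using z[of x] h'(1)[of x] by (cases "x \<in> V"; cases "peval g x = 0") (auto simp: rs_in k_def)
  qed
  show ?thesis
  proof (cases "g \<in> IV")
    case True
    then have "h x = 0" for x using z[of x] h'(1)[of x] IV_D by (cases "x \<in> V") auto
    then have "k = rs 0" by (auto simp: k_def rs_def restr_def)
    then show ?thesis using that[of k N] eq rs_cont_rat by simp
  next
    case False
    have nz: "q ^ Suc N * g \<notin> IV" using IV_prime[of "q ^ Suc N" g] IV_prime_power[of q "Suc N"] h'(3) False by blast
    have "k \<in> cont_rat V"
    proof (rule cont_ratI[OF _ _ nz])
      show "k x = 0" if "x \<notin> V" for x using h'(1)[OF that] by (simp add: k_def)
      show "continuous_on V k" using N by (simp add: k_def[abs_def])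
      show "peval (q ^ Suc N * g) x * k x = peval (p ^ Suc N) x" if x: "x \<in> V" for x
        using z[OF x] h'(4)[OF x, symmetric] by (cases "peval g x = 0") (auto simp: k_def power_mult_distrib)
    qed
    then show ?thesis using that[of k N] eq by simp
  qed
qed

section \<open>Representing functions on the zero set of the support\<close>

definition zeros :: "'n pfun set \<Rightarrow> (real^'n) set" where
  "zeros Q = {x. \<forall>p\<in>csupp Q. peval p x = 0}"

text \<open>The denominator may vanish at some points of \<open>zeros Q\<close>, but being outside
  the support it does not vanish identically there.\<close>

definition reps :: "'n pfun set \<Rightarrow> (real^'n \<Rightarrow> real) \<Rightarrow> 'n pfun \<Rightarrow> 'n pfun \<Rightarrow> bool" where
  "reps Q f p q \<longleftrightarrow> q \<notin> csupp Q \<and> (\<forall>x\<in>zeros Q. peval q x * f x = peval p x)"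

text \<open>The prime cones of the coordinate ring, lifted to polynomials.\<close>

definition vcone :: "'n pfun set \<Rightarrow> bool" where
  "vcone Q \<longleftrightarrow> rcone Q \<and> IV \<subseteq> csupp Q"

lemma zeros_equation:
  assumes Q: "vcone Q"
  obtains g where "g \<in> csupp Q" "\<And>x. peval g x = 0 \<longleftrightarrow> x \<in> zeros Q"
proof -
  have Q': "rcone Q" using Q by (simp add: vcone_def)
  obtain g where "g \<in> csupp Q" "\<And>x. peval g x = 0 \<longleftrightarrow> (\<forall>p\<in>csupp Q. peval p x = 0)"
    using ideal_single_equation[of "csupp Q", OF rconeD(9,11,12)[OF Q']] by metis
  then show ?thesis by (intro that[of g]) (simp_all add: zeros_def)
qed

lemma zeros_subset: "vcone Q \<Longrightarrow> zeros Q \<subseteq> V"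
  unfolding vcone_def zeros_def by (auto simp: V_iff subset_iff)

text \<open>With \<open>g\<close> an equation of \<open>zeros Q\<close> in the support, the
  Artin--Lang theorem for \<open>g\<close> and \<open>p\<close> gives a real point where
  \<open>g\<close> vanishes, and where \<open>p\<close> vanishes only if it lies in the
  support.\<close>

lemma real_nullstellensatz:
  assumes Q: "vcone Q" shows "p \<in> csupp Q \<longleftrightarrow> (\<forall>x\<in>zeros Q. peval p x = 0)"
proof
  assume a: "\<forall>x\<in>zeros Q. peval p x = 0"
  have Q': "rcone Q" using Q by (simp add: vcone_def)
  obtain g where g: "g \<in> csupp Q" "\<And>x. peval g x = 0 \<longleftrightarrow> x \<in> zeros Q" using zeros_equation[OF Q] by metis
  obtain x where x: "\<And>s. s \<in> {g, p} \<Longrightarrow> 0 < peval s x \<longleftrightarrow> - s \<notin> Q" "\<And>s. s \<in> {g, p} \<Longrightarrow> peval s x < 0 \<longleftrightarrow> s \<notin> Q"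
    by (rule artin_lang[OF Q', of "{g, p}"]) (simp, rule that, blast+)
  have "peval g x = 0" using x[of g] g(1) by (auto simp: csupp_def)
  then have "peval p x = 0" using a g(2) by blast
  then show "p \<in> csupp Q" using x[of p] by (auto simp: csupp_def)
qed (simp add: zeros_def)

lemma reps_exists:
  assumes Q: "vcone Q" and f: "f \<in> cont_rat V"
  obtains p q where "reps Q f p q"
proof -
  have Q': "rcone Q" using Q by (simp add: vcone_def)
  note n = real_nullstellensatz[OF Q]
  obtain p q where f': "continuous_on V f" "q \<notin> IV" "\<And>x. x \<in> V \<Longrightarrow> peval q x * f x = peval p x"
    using cont_ratD[OF f] by metis
  have ne: "zeros Q \<noteq> {}" using n[of 1] rconeD(10)[OF Q'] by auto
  have pr: "(\<forall>x\<in>zeros Q. peval a x = 0) \<or> (\<forall>x\<in>zeros Q. peval b x = 0)" if "\<forall>x\<in>zeros Q. peval (a * b) x = 0" for a b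
    using rconeD(8)[OF Q', of a b] that n by blast
  obtain p' q' where "\<exists>x\<in>zeros Q. peval q' x \<noteq> 0" "\<And>x. x \<in> zeros Q \<Longrightarrow> peval q' x * f x = peval p' x"
    by (rule regular_on_subvariety[OF f'(1,3,2) zeros_subset[OF Q] ne pr]; (assumption | (rule that, assumption, blast)))
  then have "reps Q f p' q'" unfolding reps_def n by blast
  then show ?thesis by (rule that)
qed

lemma reps_ring:
  assumes Q: "vcone Q" and f: "reps Q f p q" and g: "reps Q g p' q'"
  shows "reps Q (\<lambda>x. f x + g x) (p * q' + p' * q) (q * q')" "reps Q (\<lambda>x. f x * g x) (p * p') (q * q')"
    "reps Q (\<lambda>x. - f x) (- p) q"
proof -
  have Q': "rcone Q" using Q by (simp add: vcone_def)
  have qq: "q * q' \<notin> csupp Q" using rconeD(8)[OF Q', of q q'] f g by (auto simp: reps_def)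
  have e: "peval p x = peval q x * f x" "peval p' x = peval q' x * g x" if "x \<in> zeros Q" for x
    using f g that by (auto simp: reps_def)
  show "reps Q (\<lambda>x. f x + g x) (p * q' + p' * q) (q * q')" "reps Q (\<lambda>x. f x * g x) (p * p') (q * q')"
    "reps Q (\<lambda>x. - f x) (- p) q"
    using qq f unfolding reps_def by (auto simp: e algebra_simps)
qed

lemma reps_rs: "vcone Q \<Longrightarrow> reps Q (rs p) p 1"
  unfolding reps_def using rconeD(10)[of Q] zeros_subset[of Q] by (auto simp: rs_in vcone_def)

lemma reps_cross:
  assumes Q: "vcone Q" and f: "reps Q f p q" "reps Q f p' q'"
  shows "p * q' - p' * q \<in> csupp Q"
proof -
  have "peval p x = peval q x * f x" "peval p' x = peval q' x * f x" if "x \<in> zeros Q" for x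
    using f that by (simp_all add: reps_def)
  then show ?thesis unfolding real_nullstellensatz[OF Q] by simp
qed

lemma rcone_diff_supp:
  assumes "rcone Q" "a - b \<in> csupp Q" shows "a \<in> Q \<longleftrightarrow> b \<in> Q"
proof -
  have "a - b \<in> Q" "b - a \<in> Q" using assms(2) by (auto simp: csupp_def)
  then show ?thesis using rconeD(1)[OF assms(1), of "a - b" b] rconeD(1)[OF assms(1), of "b - a" a] by auto
qed

lemma reps_sign:
  assumes Q: "vcone Q" and f: "reps Q f p q" "reps Q f p' q'"
  shows "p * q \<in> Q \<longleftrightarrow> p' * q' \<in> Q"
proof -
  have Q': "rcone Q" using Q by (simp add: vcone_def)
  have q: "q \<notin> csupp Q" "q' \<notin> csupp Q" using f by (auto simp: reps_def)
  have "q' * q' * (p * q) - q * q * (p' * q') = (q * q') * (p * q' - p' * q)" by (simp add: algebra_simps)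
  then have "q' * q' * (p * q) - q * q * (p' * q') \<in> csupp Q"
    using rconeD(12)[OF Q' reps_cross[OF Q f]] by simp
  then have "q' * q' * (p * q) \<in> Q \<longleftrightarrow> q * q * (p' * q') \<in> Q" by (rule rcone_diff_supp[OF Q'])
  then show ?thesis using rcone_square_cancel[OF Q' q(1)] rcone_square_cancel[OF Q' q(2)] by simp
qed

text \<open>The sign of \<open>p / q\<close> is that of \<open>p * q\<close>, which spares
  fractions.\<close>

definition ext :: "'n pfun set \<Rightarrow> (real^'n \<Rightarrow> real) set" where
  "ext Q = {f \<in> cont_rat V. \<exists>p q. reps Q f p q \<and> p * q \<in> Q}"

lemma ext_iff: "vcone Q \<Longrightarrow> f \<in> cont_rat V \<Longrightarrow> reps Q f p q \<Longrightarrow> f \<in> ext Q \<longleftrightarrow> p * q \<in> Q"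
  unfolding ext_def using reps_sign by blast

lemma ext_rs: "vcone Q \<Longrightarrow> rs p \<in> ext Q \<longleftrightarrow> p \<in> Q"
  using ext_iff[OF _ rs_cont_rat reps_rs] by simp

lemma prime_cone_ext:
  assumes Q: "vcone Q" shows "prime_cone V (cont_rat V) (ext Q)"
  unfolding prime_cone_def
proof (intro conjI ballI impI)
  have Q': "rcone Q" using Q by (simp add: vcone_def)
  show "ext Q \<subseteq> cont_rat V" by (auto simp: ext_def)
  show "(\<lambda>x. - one_on V x) \<notin> ext Q"
    unfolding rs_simps ext_rs[OF Q] using rconeD(4)[OF Q'] .
  fix f assume "f \<in> cont_rat V"
  then obtain p q where f: "f \<in> cont_rat V" "reps Q f p q" using reps_exists[OF Q] by blast
  note fm = cont_rat_ring(3)[OF f(1) f(1)] reps_ring(3)[OF Q f(2) f(2)]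
  show "f \<in> ext Q \<or> (\<lambda>x. - f x) \<in> ext Q"
    unfolding ext_iff[OF Q f] ext_iff[OF Q fm] using rconeD(3)[OF Q', of "p * q"] by simp
  fix g assume "g \<in> cont_rat V"
  then obtain p' q' where g: "g \<in> cont_rat V" "reps Q g p' q'" using reps_exists[OF Q] by blast
  note gm = cont_rat_ring(3)[OF g(1) g(1)] reps_ring(3)[OF Q g(2) g(2)]
  note fg = cont_rat_ring(2)[OF f(1) g(1)] reps_ring(2)[OF Q f(2) g(2)]
  note fgm = cont_rat_ring(3)[OF fg(1) fg(1)] reps_ring(3)[OF Q fg(2) fg(2)]
  assume "(\<lambda>x. f x * g x) \<in> ext Q \<and> (\<lambda>x. - (f x * g x)) \<in> ext Q"
  then have "(p * q) * (p' * q') \<in> csupp Q"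
    unfolding ext_iff[OF Q fg] ext_iff[OF Q fgm] by (simp add: csupp_def mult_ac)
  then have "p * q \<in> csupp Q \<or> p' * q' \<in> csupp Q" by (rule rconeD(8)[OF Q'])
  then show "f \<in> ext Q \<and> (\<lambda>x. - f x) \<in> ext Q \<or> g \<in> ext Q \<and> (\<lambda>x. - g x) \<in> ext Q"
    unfolding ext_iff[OF Q f] ext_iff[OF Q fm] ext_iff[OF Q g] ext_iff[OF Q gm] by (simp add: csupp_def)
next
  have Q': "rcone Q" using Q by (simp add: vcone_def)
  fix f g assume fg: "f \<in> ext Q" "g \<in> ext Q"
  then have c: "f \<in> cont_rat V" "g \<in> cont_rat V" by (auto simp: ext_def)
  obtain p q p' q' where r: "reps Q f p q" "p * q \<in> Q" "reps Q g p' q'" "p' * q' \<in> Q" using fg unfolding ext_def by blast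
  have "(p * q' + p' * q) * (q * q') = q' * q' * (p * q) + q * q * (p' * q')" by (simp add: algebra_simps)
  also have "\<dots> \<in> Q" using r rconeD(1,2,7)[OF Q'] by blast
  finally show "(\<lambda>x. f x + g x) \<in> ext Q" using ext_iff[OF Q cont_rat_ring(1)[OF c] reps_ring(1)[OF Q r(1,3)]] by simp
  have "(p * p') * (q * q') = (p * q) * (p' * q')" by (simp add: algebra_simps)
  also have "\<dots> \<in> Q" using r rconeD(2)[OF Q'] by blast
  finally show "(\<lambda>x. f x * g x) \<in> ext Q" using ext_iff[OF Q cont_rat_ring(2)[OF c] reps_ring(2)[OF Q r(1,3)]] by simp
qed

section \<open>Restriction and extension of prime cones are inverse to each other\<close>

definition pull :: "(real^'n \<Rightarrow> real) set \<Rightarrow> 'n pfun set" where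
  "pull P = {p. rs p \<in> P}"

lemma vcone_pull:
  assumes P: "prime_cone V (coord_ring V) P"
  shows "vcone (pull P)"
proof -
  have tot: "rs p \<in> P \<or> rs (- p) \<in> P" for p using P unfolding prime_cone_def coord_ring_eq rs_simps[symmetric] by blast
  have "rcone (pull P)"
    unfolding rcone_def pull_def
  proof (intro conjI ballI allI impI)
    show "x + y \<in> {p. rs p \<in> P}" "x * y \<in> {p. rs p \<in> P}" if "x \<in> {p. rs p \<in> P}" "y \<in> {p. rs p \<in> P}" for x y
      using P that unfolding prime_cone_def mem_Collect_eq rs_simps[symmetric] by blast+
    show "x \<in> {p. rs p \<in> P} \<or> - x \<in> {p. rs p \<in> P}" for x using tot by simp
    have "rs (- 1) = (\<lambda>x. - one_on V x)" by (simp only: rs_simps)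
    then show "- 1 \<notin> {p. rs p \<in> P}" using P unfolding prime_cone_def by simp
    show "x \<in> {p. rs p \<in> P} \<and> - x \<in> {p. rs p \<in> P} \<or> y \<in> {p. rs p \<in> P} \<and> - y \<in> {p. rs p \<in> P}"
      if "x * y \<in> {p. rs p \<in> P} \<and> - (x * y) \<in> {p. rs p \<in> P}" for x y
    proof -
      have "\<forall>f\<in>range rs. \<forall>g\<in>range rs. (\<lambda>x. f x * g x) \<in> P \<and> (\<lambda>x. - (f x * g x)) \<in> P \<longrightarrow>
          (f \<in> P \<and> (\<lambda>x. - f x) \<in> P) \<or> (g \<in> P \<and> (\<lambda>x. - g x) \<in> P)"
        using P unfolding prime_cone_def coord_ring_eq by blast
      from this[rule_format, OF rangeI rangeI, of x y] show ?thesis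
        using that unfolding rs_simps by simp
    qed
  qed
  moreover have "IV \<subseteq> csupp (pull P)"
  proof
    fix p assume "p \<in> IV"
    then have "rs p = rs 0" "rs (- p) = rs 0" by (auto simp: rs_eq_iff IV_def)
    moreover have "rs 0 \<in> P" using tot[of 0] by simp
    ultimately show "p \<in> csupp (pull P)" by (simp add: csupp_def pull_def)
  qed
  ultimately show ?thesis by (simp add: vcone_def)
qed

lemma prime_cone_restrict:
  assumes C: "prime_cone V (cont_rat V) C" shows "prime_cone V (coord_ring V) (C \<inter> coord_ring V)"
proof -
  have A: "(\<lambda>x. f x + g x) \<in> coord_ring V" "(\<lambda>x. f x * g x) \<in> coord_ring V" "(\<lambda>x. - f x) \<in> coord_ring V"
    if "f \<in> coord_ring V" "g \<in> coord_ring V" for f g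
    using that unfolding coord_ring_eq by (auto simp: rs_simps)
  have AB: "coord_ring V \<subseteq> cont_rat V" unfolding coord_ring_eq using rs_cont_rat by blast
  show ?thesis
    using C AB A unfolding prime_cone_def by (auto simp: subset_iff)
qed

text \<open>With \<open>g\<close> the equation of the zero set, a power of \<open>q * f - p\<close>
  is a multiple of \<open>g\<close>, so it lies in the support \<open>N\<close> of \<open>C\<close>.
  As \<open>N\<close> is prime, \<open>q * f\<close> equals \<open>p\<close> modulo
  \<open>N\<close>, and after multiplication by \<open>q\<close> the polynomial \<open>p * q\<close>
  decides whether \<open>f\<close> is in \<open>C\<close>.\<close>

lemma cone_unique:
  assumes C: "prime_cone V (cont_rat V) C" shows "C = ext (pull (C \<inter> coord_ring V))"
proof -
  define Q where "Q = pull (C \<inter> coord_ring V)"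
  have Q: "vcone Q" unfolding Q_def by (rule vcone_pull[OF prime_cone_restrict[OF C]])
  have Q': "rcone Q" using Q by (simp add: vcone_def)
  have inQ: "p \<in> Q \<longleftrightarrow> rs p \<in> C" for p by (simp add: Q_def pull_def coord_ring_eq)
  have Csub: "C \<subseteq> cont_rat V" and add: "\<And>f g. f \<in> C \<Longrightarrow> g \<in> C \<Longrightarrow> (\<lambda>x. f x + g x) \<in> C"
    and mult: "\<And>f g. f \<in> C \<Longrightarrow> g \<in> C \<Longrightarrow> (\<lambda>x. f x * g x) \<in> C"
    and tot: "\<And>f. f \<in> cont_rat V \<Longrightarrow> f \<in> C \<or> (\<lambda>x. - f x) \<in> C"
    and pr: "\<And>f g. f \<in> cont_rat V \<Longrightarrow> g \<in> cont_rat V \<Longrightarrow> (\<lambda>x. f x * g x) \<in> C \<Longrightarrow> (\<lambda>x. - (f x * g x)) \<in> C \<Longrightarrow>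
       (f \<in> C \<and> (\<lambda>x. - f x) \<in> C) \<or> (g \<in> C \<and> (\<lambda>x. - g x) \<in> C)"
    using C unfolding prime_cone_def by blast+
  define N where "N = {f. f \<in> C \<and> (\<lambda>x. - f x) \<in> C}"
  have Nmult: "(\<lambda>x. f x * g x) \<in> N" if f: "f \<in> N" and g: "g \<in> cont_rat V" for f g
    using tot[OF g] f mult[of f g] mult[of "\<lambda>x. - f x" g] mult[of f "\<lambda>x. - g x"] mult[of "\<lambda>x. - f x" "\<lambda>x. - g x"]
    unfolding N_def by auto
  have Npow: "f \<in> cont_rat V \<Longrightarrow> (\<lambda>x. f x ^ Suc n) \<in> N \<Longrightarrow> f \<in> N" for f n
  proof (induction n)
    case (Suc n)
    then have "f \<in> N \<or> (\<lambda>x. f x ^ Suc n) \<in> N"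
      using pr[of f "\<lambda>x. f x ^ Suc n"] cont_rat_power[of f n] unfolding N_def by auto
    then show ?case using Suc by blast
  qed simp
  have suppN: "p \<in> csupp Q \<longleftrightarrow> rs p \<in> N" for p by (simp add: csupp_def inQ N_def rs_simps)
  have rel: "(\<lambda>x. rs q x * f x + - rs p x) \<in> N" if f: "f \<in> cont_rat V" "reps Q f p q" for f p q
  proof -
    let ?h = "\<lambda>x. rs q x * f x + - rs p x"
    have h: "?h \<in> cont_rat V" unfolding rs_simps(3)
      by (intro cont_rat_ring(1) cont_rat_ring(2) cont_rat_ring(3)[OF rs_cont_rat rs_cont_rat] rs_cont_rat f)
    obtain g where g: "g \<in> csupp Q" "\<And>x. peval g x = 0 \<longleftrightarrow> x \<in> zeros Q" using zeros_equation[OF Q] by metis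
    have "?h x = 0" if "x \<in> V" "peval g x = 0" for x using f(2) that g(2) by (simp add: reps_def rs_in)
    then obtain n k where k: "k \<in> cont_rat V" "(\<lambda>x. ?h x ^ Suc n) = (\<lambda>x. rs g x * k x)"
      by (rule vanishing_power_factor[OF h]; (assumption | (rule that; assumption) | simp))
    have "(\<lambda>x. ?h x ^ Suc n) \<in> N" unfolding k(2) using Nmult[OF _ k(1)] g(1) suppN by blast
    then show ?thesis by (rule Npow[OF h])
  qed
  have imp: "rs (p * q) \<in> C" if f: "f \<in> C" "reps Q f p q" for f p q
  proof -
    have fB: "f \<in> cont_rat V" using f(1) Csub by blast
    have "(\<lambda>x. (rs q x * f x + - rs p x) * rs q x) \<in> N" using Nmult[OF rel[OF fB f(2)] rs_cont_rat] .
    then have n: "(\<lambda>x. - ((rs q x * f x + - rs p x) * rs q x)) \<in> C" by (simp add: N_def)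
    have "rs (q * q) \<in> C" using rconeD(7)[OF Q', of q] inQ by blast
    then have "(\<lambda>x. rs (q * q) x * f x) \<in> C" using mult f(1) by blast
    from add[OF this n] have "(\<lambda>x. rs (q * q) x * f x + - ((rs q x * f x + - rs p x) * rs q x)) \<in> C" .
    also have "(\<lambda>x. rs (q * q) x * f x + - ((rs q x * f x + - rs p x) * rs q x)) = rs (p * q)"
      unfolding rs_simps(2)[symmetric] by (auto simp: algebra_simps)
    finally show ?thesis .
  qed
  have "f \<in> C \<longleftrightarrow> f \<in> ext Q" if f: "f \<in> cont_rat V" for f
  proof -
    obtain p q where r: "reps Q f p q" using reps_exists[OF Q f] by blast
    \<comment> \<open>If \<open>f\<close> were not in \<open>C\<close>, both \<open>p * q\<close>
      and its negative would be. Then \<open>q * q * f\<close> lies in \<open>N\<close>, and as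
      \<open>q * q\<close> does not, primality puts \<open>f\<close> there.\<close>
    have "f \<in> C" if pq: "p * q \<in> Q"
    proof (rule ccontr)
      assume n: "f \<notin> C"
      then have "(\<lambda>x. - f x) \<in> C" using tot[OF f] by blast
      then have "rs (- p * q) \<in> C" using imp reps_ring(3)[OF Q r r] by blast
      then have "p * q \<in> csupp Q" using pq by (simp add: csupp_def inQ)
      then have pqN: "rs (p * q) \<in> N" using suppN by blast
      have "(\<lambda>x. (rs q x * f x + - rs p x) * rs q x) \<in> N" using Nmult[OF rel[OF f r] rs_cont_rat] .
      then have "(\<lambda>x. (rs q x * f x + - rs p x) * rs q x + rs (p * q) x) \<in> N"
        using pqN add[of "\<lambda>x. (rs q x * f x + - rs p x) * rs q x" "rs (p * q)"]
          add[of "\<lambda>x. - ((rs q x * f x + - rs p x) * rs q x)" "\<lambda>x. - rs (p * q) x"]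
        unfolding N_def by (simp add: algebra_simps)
      moreover have "(\<lambda>x. (rs q x * f x + - rs p x) * rs q x + rs (p * q) x) = (\<lambda>x. rs (q * q) x * f x)"
        unfolding rs_simps(2)[symmetric] by (auto simp: algebra_simps)
      ultimately have "(\<lambda>x. rs (q * q) x * f x) \<in> N" by simp
      then have "rs (q * q) \<in> N \<or> f \<in> N" using pr[OF rs_cont_rat f, of "q * q"] unfolding N_def by auto
      moreover have "rs (q * q) \<notin> N" using suppN rconeD(8)[OF Q', of q q] r by (auto simp: reps_def)
      ultimately show False using n by (simp add: N_def)
    qed
    moreover have "p * q \<in> Q" if "f \<in> C" using imp[OF that r] inQ by blast
    ultimately show ?thesis using ext_iff[OF Q f r] by blast
  qed
  then show ?thesis using Csub unfolding Q_def[symmetric] ext_def by blast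
qed

lemma pull_ext: "prime_cone V (coord_ring V) P \<Longrightarrow> ext (pull P) \<inter> coord_ring V = P"
proof -
  assume P: "prime_cone V (coord_ring V) P"
  have "rs p \<in> ext (pull P) \<longleftrightarrow> rs p \<in> P" for p using ext_rs[OF vcone_pull[OF P]] by (simp add: pull_def)
  moreover have "P \<subseteq> range rs" using P unfolding prime_cone_def coord_ring_eq by (elim conjE)
  ultimately show ?thesis unfolding coord_ring_eq by auto
qed

section \<open>The constructible topologies\<close>

lemma topspace_constructible: "rs 0 \<in> A \<Longrightarrow> topspace (constructible_topology V A) = real_spectrum V A"
  unfolding constructible_topology_def topology_generated_by_topspace by (auto simp: pos_set_def)

lemma openin_pos:
  assumes "a \<in> A" shows "openin (constructible_topology V A) (pos_set V A a)"
    "openin (constructible_topology V A) (real_spectrum V A - pos_set V A a)"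
  unfolding constructible_topology_def using assms by (auto intro!: topology_generated_by_Basis)

text \<open>On the constructible set of cones at which the equation \<open>g\<close> of the subvariety vanishes and the
  denominator does not, one quotient of polynomials gives the sign of a continuous rational function.\<close>

lemma locally_polynomial_sign:
  assumes P: "P \<in> real_spectrum V (coord_ring V)" and f: "f \<in> cont_rat V"
  obtains W a where "openin (constructible_topology V (coord_ring V)) W" "P \<in> W" "a \<in> coord_ring V"
    "\<And>P'. P' \<in> W \<Longrightarrow> P' \<in> real_spectrum V (coord_ring V) \<and> ((\<lambda>x. - f x) \<in> ext (pull P') \<longleftrightarrow> (\<lambda>x. - a x) \<in> P')"
proof -
  let ?A = "coord_ring V" and ?T = "constructible_topology V (coord_ring V)"
  have pc: "prime_cone V ?A P" using P by (simp add: real_spectrum_def)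
  note Q = vcone_pull[OF pc]
  obtain p q where r: "reps (pull P) f p q" using reps_exists[OF Q f] by blast
  obtain g where g: "g \<in> csupp (pull P)" "\<And>x. peval g x = 0 \<longleftrightarrow> x \<in> zeros (pull P)" using zeros_equation[OF Q] by metis
  have inA: "rs p \<in> ?A" for p by (simp add: coord_ring_eq)
  \<comment> \<open>That \<open>g\<close> is in the support and \<open>q\<close> outside it is
    expressed through the signs of \<open>g\<close>, \<open>- g\<close>, \<open>q\<close> and
    \<open>- q\<close>. For cones in \<open>W\<close> the zero set can only shrink, so
    \<open>p\<close> and \<open>q\<close> still represent \<open>f\<close>.\<close>
  define W where "W = (real_spectrum V ?A - pos_set V ?A (rs g)) \<inter> (real_spectrum V ?A - pos_set V ?A (rs (- g))) \<inter>
     (pos_set V ?A (rs q) \<union> pos_set V ?A (rs (- q)))"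
  have W: "P' \<in> W \<longleftrightarrow> P' \<in> real_spectrum V ?A \<and> g \<in> csupp (pull P') \<and> q \<notin> csupp (pull P')" for P'
    unfolding W_def pos_set_def by (auto simp: rs_simps csupp_def pull_def)
  show ?thesis
  proof (rule that[of W "rs (p * q)"])
    show "openin ?T W" unfolding W_def by (intro openin_Int openin_Un openin_pos inA)
    show "P \<in> W" using P g(1) r unfolding W by (simp add: reps_def)
    show "rs (p * q) \<in> ?A" by (rule inA)
    fix P' assume P': "P' \<in> W"
    then have s: "P' \<in> real_spectrum V ?A" and gq: "g \<in> csupp (pull P')" "q \<notin> csupp (pull P')" unfolding W by auto
    have Q': "vcone (pull P')" using s by (intro vcone_pull) (simp add: real_spectrum_def)
    have "zeros (pull P') \<subseteq> zeros (pull P)" using gq(1) g(2) by (auto simp: zeros_def[of "pull P'"])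
    then have r': "reps (pull P') f p q" using r gq(2) by (auto simp: reps_def)
    have "(\<lambda>x. - f x) \<in> ext (pull P') \<longleftrightarrow> - p * q \<in> pull P'"
      by (rule ext_iff[OF Q' cont_rat_ring(3)[OF f f] reps_ring(3)[OF Q' r' r']])
    also have "\<dots> \<longleftrightarrow> (\<lambda>x. - rs (p * q) x) \<in> P'" by (simp add: pull_def rs_simps)
    finally show "P' \<in> real_spectrum V ?A \<and> ((\<lambda>x. - f x) \<in> ext (pull P') \<longleftrightarrow> (\<lambda>x. - rs (p * q) x) \<in> P')" using s by blast
  qed
qed

text \<open>Restriction is continuous because generating sets pull back to generating sets. Its
  inverse is the extension of cones, whose continuity is local: near a given cone one polynomial
  decides the sign of \<open>f\<close>.\<close>

theorem spectrum_homeomorphism: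
  "homeomorphic_map (constructible_topology V (cont_rat V)) (constructible_topology V (coord_ring V)) (\<lambda>P. P \<inter> coord_ring V)"
proof -
  let ?A = "coord_ring V" and ?B = "cont_rat V"
  let ?TA = "constructible_topology V ?A" and ?TB = "constructible_topology V ?B"
  have A0: "rs 0 \<in> ?A" by (simp add: coord_ring_eq)
  have tA: "topspace ?TA = real_spectrum V ?A" and tB: "topspace ?TB = real_spectrum V ?B"
    using topspace_constructible A0 rs_cont_rat by blast+
  have AB: "?A \<subseteq> ?B" unfolding coord_ring_eq using rs_cont_rat by blast
  have mA: "(\<lambda>x. - a x) \<in> ?A" if "a \<in> ?A" for a using that unfolding coord_ring_eq by (auto simp: rs_simps)
  have res: "C \<inter> ?A \<in> real_spectrum V ?A" if "C \<in> real_spectrum V ?B" for C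
    using that prime_cone_restrict by (simp add: real_spectrum_def)
  have exs: "ext (pull P) \<in> real_spectrum V ?B" if "P \<in> real_spectrum V ?A" for P
    using that prime_cone_ext[OF vcone_pull] by (simp add: real_spectrum_def)
  have c1: "continuous_map ?TB ?TA (\<lambda>P. P \<inter> ?A)"
    unfolding constructible_topology_def[of V ?A]
  proof (rule continuous_on_generated_topo)
    fix U assume "U \<in> {pos_set V ?A a |a. a \<in> ?A} \<union> {real_spectrum V ?A - pos_set V ?A a |a. a \<in> ?A}"
    then obtain a where a: "a \<in> ?A" "U = pos_set V ?A a \<or> U = real_spectrum V ?A - pos_set V ?A a" by blast
    have "(\<lambda>P. P \<inter> ?A) -` pos_set V ?A a \<inter> topspace ?TB = pos_set V ?B a"
      "(\<lambda>P. P \<inter> ?A) -` (real_spectrum V ?A - pos_set V ?A a) \<inter> topspace ?TB = real_spectrum V ?B - pos_set V ?B a"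
      unfolding tB using res mA[OF a(1)] by (auto simp: pos_set_def)
    then show "openin ?TB ((\<lambda>P. P \<inter> ?A) -` U \<inter> topspace ?TB)"
      using a(2) openin_pos[of a ?B] a(1) AB by auto
  next
    show "(\<lambda>P. P \<inter> ?A) ` topspace ?TB \<subseteq> \<Union>({pos_set V ?A a |a. a \<in> ?A} \<union> {real_spectrum V ?A - pos_set V ?A a |a. a \<in> ?A})"
      using tA res unfolding tB constructible_topology_def[of V ?A] topology_generated_by_topspace by auto
  qed
  have c2: "continuous_map ?TA ?TB (\<lambda>P. ext (pull P))"
    unfolding constructible_topology_def[of V ?B]
  proof (rule continuous_on_generated_topo)
    fix U assume "U \<in> {pos_set V ?B a |a. a \<in> ?B} \<union> {real_spectrum V ?B - pos_set V ?B a |a. a \<in> ?B}"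
    then obtain f where f: "f \<in> ?B" "U = pos_set V ?B f \<or> U = real_spectrum V ?B - pos_set V ?B f" by blast
    show "openin ?TA ((\<lambda>P. ext (pull P)) -` U \<inter> topspace ?TA)"
    proof (subst openin_subopen, intro ballI)
      fix P assume "P \<in> (\<lambda>P. ext (pull P)) -` U \<inter> topspace ?TA"
      then have P: "P \<in> real_spectrum V ?A" "ext (pull P) \<in> U" unfolding tA by auto
      obtain W a where W: "openin ?TA W" "P \<in> W" "a \<in> ?A"
        "\<And>P'. P' \<in> W \<Longrightarrow> P' \<in> real_spectrum V ?A \<and> ((\<lambda>x. - f x) \<in> ext (pull P') \<longleftrightarrow> (\<lambda>x. - a x) \<in> P')"
        using locally_polynomial_sign[OF P(1) f(1)] by blast
      have pos: "ext (pull P') \<in> pos_set V ?B f \<longleftrightarrow> P' \<in> pos_set V ?A a" "ext (pull P') \<in> real_spectrum V ?B" "P' \<in> real_spectrum V ?A" if "P' \<in> W" for P'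
        using W(4)[OF that] exs by (auto simp: pos_set_def)
      let ?O = "if U = pos_set V ?B f then W \<inter> pos_set V ?A a else W \<inter> (real_spectrum V ?A - pos_set V ?A a)"
      have "openin ?TA ?O" using W(1,3) openin_pos[of a ?A] by (auto intro: openin_Int)
      moreover have "P \<in> ?O" using P W(2) pos f(2) by auto
      moreover have "?O \<subseteq> (\<lambda>P. ext (pull P)) -` U \<inter> topspace ?TA" unfolding tA using pos f(2) by auto
      ultimately show "\<exists>T. openin ?TA T \<and> P \<in> T \<and> T \<subseteq> (\<lambda>P. ext (pull P)) -` U \<inter> topspace ?TA" by blast
    qed
  next
    show "(\<lambda>P. ext (pull P)) ` topspace ?TA \<subseteq> \<Union>({pos_set V ?B a |a. a \<in> ?B} \<union> {real_spectrum V ?B - pos_set V ?B a |a. a \<in> ?B})"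
      using tB exs unfolding tA constructible_topology_def[of V ?B] topology_generated_by_topspace by auto
  qed
  have "homeomorphic_maps ?TB ?TA (\<lambda>P. P \<inter> ?A) (\<lambda>P. ext (pull P))"
    unfolding homeomorphic_maps_def tA tB
    using c1 c2 cone_unique pull_ext by (auto simp: real_spectrum_def)
  then show ?thesis using homeomorphic_map_maps by blast
qed

text \<open>The polynomials with nonnegative image form a cone whose support is the kernel of
  \<open>h\<close>, so a representation on its zero set suggests the value \<open>h p / h q\<close>
  for \<open>f\<close>. This value is forced: every extension kills a power of
  \<open>q * f - p\<close>.\<close>

theorem substitution:
  "substitution_property TYPE('r::linordered_field) V (coord_ring V) (cont_rat V)"
  unfolding substitution_property_def
proof (intro impI allI)
  fix \<phi> :: "(real^'n \<Rightarrow> real) \<Rightarrow> 'r" assume \<phi>: "ring_hom_on V (coord_ring V) \<phi>"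
  define h where "h p = \<phi> (rs p)" for p
  have h: "ring_map h"
    using \<phi> unfolding ring_hom_on_def ring_map_def h_def coord_ring_eq by (auto simp: rs_simps)
  note hs = ring_map_simps[OF h]
  define Q where "Q = {p. 0 \<le> h p}"
  have supp: "p \<in> csupp Q \<longleftrightarrow> h p = 0" for p by (auto simp: csupp_def Q_def hs)
  have "rcone Q" unfolding rcone_def
  proof (intro conjI ballI allI impI)
    show "x \<in> Q \<and> - x \<in> Q \<or> y \<in> Q \<and> - y \<in> Q" if "x * y \<in> Q \<and> - (x * y) \<in> Q" for x y
    proof -
      have "h x * h y = 0" using that by (auto simp: Q_def hs)
      then show ?thesis by (auto simp: Q_def hs)
    qed
  qed (auto simp: Q_def hs)
  moreover have "IV \<subseteq> csupp Q"
  proof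
    fix p assume "p \<in> IV"
    then have "rs p = rs 0" by (simp add: rs_eq_iff)
    then have "h p = h 0" by (simp add: h_def)
    then show "p \<in> csupp Q" by (simp add: supp hs)
  qed
  ultimately have Q: "vcone Q" by (simp add: vcone_def)
  \<comment> \<open>Unique, because by \<open>reps_cross\<close> two representations differ by an
    element of the kernel of \<open>h\<close> after cross-multiplication.\<close>
  define \<psi> where "\<psi> f = (THE t. \<exists>p q. reps Q f p q \<and> t = h p / h q)" for f
  have \<psi>: "\<psi> f = h p / h q" if r: "reps Q f p q" for f p q
    unfolding \<psi>_def
  proof (rule the_equality)
    show "\<exists>p' q'. reps Q f p' q' \<and> h p / h q = h p' / h q'" using r by blast
    fix t assume "\<exists>p q. reps Q f p q \<and> t = h p / h q"
    then obtain p' q' where r': "reps Q f p' q'" "t = h p' / h q'" by blast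
    have "h q \<noteq> 0" "h q' \<noteq> 0" using r r'(1) by (auto simp: reps_def supp)
    moreover have "h p * h q' = h p' * h q" using reps_cross[OF Q r r'(1)] by (simp add: supp hs)
    ultimately show "t = h p / h q" using r'(2) by (simp add: frac_eq_eq)
  qed
  have nzq: "h q \<noteq> 0" if "reps Q f p q" for f p q using that by (simp add: reps_def supp)
  have "ring_hom_on V (cont_rat V) \<psi>"
    unfolding ring_hom_on_def
  proof (intro conjI ballI)
    show "\<psi> (one_on V) = 1" unfolding rs_simps using \<psi>[OF reps_rs[OF Q, of 1]] by (simp add: hs)
    fix f g assume "f \<in> cont_rat V" "g \<in> cont_rat V"
    then obtain p q p' q' where r: "reps Q f p q" "reps Q g p' q'" using reps_exists[OF Q] by metis
    show "\<psi> (\<lambda>x. f x + g x) = \<psi> f + \<psi> g"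
      unfolding \<psi>[OF reps_ring(1)[OF Q r]] \<psi>[OF r(1)] \<psi>[OF r(2)] using nzq[OF r(1)] nzq[OF r(2)] by (simp add: hs field_simps)
    show "\<psi> (\<lambda>x. f x * g x) = \<psi> f * \<psi> g"
      using \<psi>[OF reps_ring(2)[OF Q r]] \<psi>[OF r(1)] \<psi>[OF r(2)] by (simp add: hs)
  qed
  moreover have "\<forall>f\<in>coord_ring V. \<psi> f = \<phi> f"
    using \<psi>[OF reps_rs[OF Q]] unfolding coord_ring_eq by (auto simp: hs(1) h_def[symmetric])
  moreover have "\<psi>' f = \<psi> f" if \<psi>': "ring_hom_on V (cont_rat V) \<psi>'" "\<forall>f\<in>coord_ring V. \<psi>' f = \<phi> f" and f: "f \<in> cont_rat V" for \<psi>' f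
  proof -
    obtain p q where r: "reps Q f p q" using reps_exists[OF Q f] by blast
    obtain g where g: "g \<in> csupp Q" "\<And>x. peval g x = 0 \<longleftrightarrow> x \<in> zeros Q" using zeros_equation[OF Q] by metis
    have add: "\<psi>' (\<lambda>x. u x + v x) = \<psi>' u + \<psi>' v" and mult: "\<psi>' (\<lambda>x. u x * v x) = \<psi>' u * \<psi>' v"
      if "u \<in> cont_rat V" "v \<in> cont_rat V" for u v using \<psi>'(1) that unfolding ring_hom_on_def by blast+
    have rs: "\<psi>' (rs p) = h p" for p using \<psi>'(2) by (simp add: h_def coord_ring_eq)
    let ?u = "\<lambda>x. rs q x * f x + rs (- p) x"
    have u: "?u \<in> cont_rat V" by (intro cont_rat_ring(1,2) rs_cont_rat f)
    have "?u x = 0" if "x \<in> V" "peval g x = 0" for x using r that g(2) by (simp add: reps_def rs_in)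
    then obtain n k where k: "k \<in> cont_rat V" "(\<lambda>x. ?u x ^ Suc n) = (\<lambda>x. rs g x * k x)"
      by (rule vanishing_power_factor[OF u]; (assumption | (rule that; assumption) | simp))
    have pow: "\<psi>' (\<lambda>x. ?u x ^ Suc m) = \<psi>' ?u ^ Suc m" for m
    proof (induction m)
      case (Suc m)
      have "\<psi>' (\<lambda>x. ?u x * ?u x ^ Suc m) = \<psi>' ?u * \<psi>' (\<lambda>x. ?u x ^ Suc m)"
        by (rule mult[OF u cont_rat_power[OF u]])
      then show ?case using Suc by simp
    qed simp
    have "\<psi>' ?u ^ Suc n = h g * \<psi>' k" using pow[of n] mult[OF rs_cont_rat[of g] k(1)] unfolding k(2) rs by simp
    also have "\<dots> = 0" using g(1) by (simp add: supp)
    finally have "\<psi>' ?u = 0" by (auto simp del: power_Suc)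
    moreover have "\<psi>' ?u = h q * \<psi>' f - h p"
      using add[OF cont_rat_ring(2)[OF rs_cont_rat f] rs_cont_rat] mult[OF rs_cont_rat f] by (simp add: rs hs)
    ultimately show ?thesis using \<psi>[OF r] nzq[OF r] by (simp add: field_simps)
  qed
  ultimately show "\<exists>\<psi>. ring_hom_on V (cont_rat V) \<psi> \<and> (\<forall>f\<in>coord_ring V. \<psi> f = \<phi> f) \<and>
     (\<forall>\<psi>'. ring_hom_on V (cont_rat V) \<psi>' \<and> (\<forall>f\<in>coord_ring V. \<psi>' f = \<phi> f) \<longrightarrow> (\<forall>f\<in>cont_rat V. \<psi>' f = \<psi> f))"
    by blast
qed

end

theorem theorem2p12:
  fixes V :: "(real^'n) set"
  assumes "irreducible_alg V" and "nonsingular_alg V"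
  shows "substitution_property TYPE('r::linordered_field) V (coord_ring V) (cont_rat V)
    \<and> homeomorphic_map (constructible_topology V (cont_rat V)) (constructible_topology V (coord_ring V))
        (\<lambda>P. P \<inter> coord_ring V)"
proof -
  interpret smooth_variety V "CARD('n) - alg_dim V"
    using assms unfolding nonsingular_alg_def by unfold_locales auto
  show ?thesis using substitution spectrum_homeomorphism by blast
qed

end
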